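(* Let $\mathcal{X}$ be a separable complete metric space and let $\lambda=(\lambda_1,\lambda_2,\dots)\in\Lambda^\infty$. Suppose that $$\sum_{i=1}^\infty\frac{\inf_{x\in\mathcal{X}}\lambda_i(x)/\lambda_*(x)}{\sup_{x\in\mathcal{X}}\lambda_i(x)/\lambda_*(x)}=\infty\quad\text{for some }\lambda_*\in\Lambda.$$ Then $\lambda\in\Lambda_{\mathsf{dF}}$; that is, for every $\lambda$-weighted exchangeable distribution $Q$ on $\mathcal{X}^\infty$ there exists a distribution $\mu$ on $\mathcal{M}_{\mathcal{X}}(\lambda)$ such that $Q=(P\circ\lambda)_\mu$.
   Context: $\mathcal{X}$ is a separable complete metric space with Borel $\sigma$-algebra $\mathcal{B}(\mathcal{X})$; $\mathcal{X}^n$ and $\mathcal{X}^\infty$ are the products with their Borel $\sigma$-algebras. $\Lambda$ is the set of measurable functions $\mathcal{X}\to(0,\infty)$; $\Lambda^n$, $\Lambda^\infty$ are the sets of finite/infinite sequences of such functions. $\mathcal{M}_{\mathcal{X}}$ is the set of all (not necessarily finite) measures on $\mathcal{X}$, with the $\sigma$-algebra generated by the sets $\{P:P(A)\le t\}$, $A\in\mathcal{B}(\mathcal{X})$, $t\ge0$. "Distribution" means probability measure. A ratio with infinite supremum in the denominator is read as $0$. A measure $R$ on $\mathcal{X}^n$ is exchangeable if $R(A_1\times\dots\times A_n)=R(A_{\sigma(1)}\times\dots\times A_{\sigma(n)})$ for all $A_1,\dots,A_n\in\mathcal{B}(\mathcal{X})$ and all permutations $\sigma$ of $\{1,\dots,n\}$.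 For $\lambda\in\Lambda^n$, a measure $Q$ on $\mathcal{X}^n$ is $\lambda$-weighted exchangeable if the measure $\overline{Q}(A)=\int_A\frac{dQ(x_1,\dots,x_n)}{\lambda_1(x_1)\cdots\lambda_n(x_n)}$ is exchangeable. For $\lambda\in\Lambda^\infty$, a measure $Q$ on $\mathcal{X}^\infty$ is $\lambda$-weighted exchangeable if for every $n\ge1$ its marginal on the first $n$ coordinates is $(\lambda_1,\dots,\lambda_n)$-weighted exchangeable. For $\lambda\in\Lambda^\infty$, $\mathcal{M}_{\mathcal{X}}(\lambda)=\{P\in\mathcal{M}_{\mathcal{X}}:0<\int_{\mathcal{X}}\lambda_i\,dP<\infty\text{ for all }i\}$. For $P\in\mathcal{M}_{\mathcal{X}}(\lambda)$, $(P\circ\lambda_i)(A)=\int_A\lambda_i\,dP\big/\int_{\mathcal{X}}\lambda_i\,dP$, and $P\circ\lambda=(P\circ\lambda_1)\times(P\circ\lambda_2)\times\cdots$ is the product distribution on $\mathcal{X}^\infty$. For a distribution $\mu$ on $\mathcal{M}_{\mathcal{X}}(\lambda)$, $(P\circ\lambda)_\mu$ is the distribution $A\mapsto\mathbb{E}_{P\sim\mu}[(P\circ\lambda)(A)]$ on $\mathcal{X}^\infty$. *)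

theory Defs
  imports "HOL-Probability.Probability" "HOL-Combinatorics.Combinatorics"
begin

definition weight_functions :: "('a::topological_space \<Rightarrow> real) set" where
  "weight_functions = {w \<in> borel_measurable borel. \<forall>x. 0 < w x}"

text \<open>
  Sequences are indexed from 0. The carrier spaces \<open>X\<^sup>n\<close> and \<open>X\<^sup>\<infinity>\<close> are the product spaces over
  \<open>{..<n}\<close> and over all of \<open>nat\<close>; as \<open>X\<close> is second countable, their product
  \<open>\<sigma>\<close>-algebras are the Borel ones.
\<close>

abbreviation fin_prod :: "nat \<Rightarrow> (nat \<Rightarrow> 'a::polish_space) measure" where
  "fin_prod n \<equiv> PiM {..<n} (\<lambda>_. borel)"

abbreviation inf_prod :: "(nat \<Rightarrow> 'a::polish_space) measure" where
  "inf_prod \<equiv> PiM UNIV (\<lambda>_. borel)"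

definition exchangeable :: "nat \<Rightarrow> (nat \<Rightarrow> 'a::polish_space) measure \<Rightarrow> bool" where
  "exchangeable n R \<longleftrightarrow>
     sets R = sets (fin_prod n) \<and>
     (\<forall>A \<sigma>. (\<forall>i<n. A i \<in> sets borel) \<longrightarrow> \<sigma> permutes {..<n} \<longrightarrow>
        emeasure R (PiE {..<n} A) = emeasure R (PiE {..<n} (\<lambda>i. A (\<sigma> i))))"

definition weighted_exchangeable_fin ::
    "nat \<Rightarrow> (nat \<Rightarrow> 'a \<Rightarrow> real) \<Rightarrow> (nat \<Rightarrow> 'a::polish_space) measure \<Rightarrow> bool" where
  "weighted_exchangeable_fin n l Q \<longleftrightarrow>
     sets Q = sets (fin_prod n) \<and>
     exchangeable n (density Q (\<lambda>x. ennreal (1 / (\<Prod>i<n. l i (x i)))))"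

definition weighted_exchangeable ::
    "(nat \<Rightarrow> 'a \<Rightarrow> real) \<Rightarrow> (nat \<Rightarrow> 'a::polish_space) measure \<Rightarrow> bool" where
  "weighted_exchangeable l Q \<longleftrightarrow>
     sets Q = sets inf_prod \<and>
     (\<forall>n\<ge>1. weighted_exchangeable_fin n l (distr Q (fin_prod n) (\<lambda>x. restrict x {..<n})))"

text \<open>
  The measurable space of all measures on \<open>X\<close>, of arbitrary (possibly infinite) total mass; only
  the underlying set and the \<open>\<sigma>\<close>-algebra of this \<^const>\<open>sigma\<close> term matter.
\<close>

definition all_measures :: "'a::polish_space measure measure" where
  "all_measures =
     sigma {P. sets P = sets borel}
       {{P. sets P = sets borel \<and> emeasure P A \<le> ennreal t} | A t. A \<in> sets borel \<and> 0 \<le> t}"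

definition measures_for :: "(nat \<Rightarrow> 'a \<Rightarrow> real) \<Rightarrow> 'a::polish_space measure set" where
  "measures_for l =
     {P. sets P = sets borel \<and>
         (\<forall>i. 0 < (\<integral>\<^sup>+x. ennreal (l i x) \<partial>P) \<and> (\<integral>\<^sup>+x. ennreal (l i x) \<partial>P) < \<infinity>)}"

definition tilt :: "'a measure \<Rightarrow> ('a \<Rightarrow> real) \<Rightarrow> 'a measure" where
  "tilt P w = density P (\<lambda>x. ennreal (w x) / (\<integral>\<^sup>+y. ennreal (w y) \<partial>P))"

lemma emeasure_tilt:
  assumes "w \<in> borel_measurable P" "A \<in> sets P"
  shows "emeasure (tilt P w) A = (\<integral>\<^sup>+x\<in>A. ennreal (w x) \<partial>P) / (\<integral>\<^sup>+x. ennreal (w x) \<partial>P)"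
proof -
  have "emeasure (tilt P w) A =
      (\<integral>\<^sup>+x. (ennreal (w x) * indicator A x) / (\<integral>\<^sup>+y. ennreal (w y) \<partial>P) \<partial>P)"
    unfolding tilt_def using assms
    by (subst emeasure_density) (auto simp: divide_ennreal_def mult_ac)
  also have "\<dots> = (\<integral>\<^sup>+x\<in>A. ennreal (w x) \<partial>P) / (\<integral>\<^sup>+x. ennreal (w x) \<partial>P)"
    using assms by (intro nn_integral_divide) auto
  finally show ?thesis .
qed

definition tilted_product ::
    "'a measure \<Rightarrow> (nat \<Rightarrow> 'a \<Rightarrow> real) \<Rightarrow> (nat \<Rightarrow> 'a) measure" where
  "tilted_product P l = PiM UNIV (\<lambda>i. tilt P (l i))"

definition distribution_on_measures_for ::
    "(nat \<Rightarrow> 'a \<Rightarrow> real) \<Rightarrow> 'a::polish_space measure measure \<Rightarrow> bool" where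
  "distribution_on_measures_for l \<mu> \<longleftrightarrow>
     prob_space \<mu> \<and> sets \<mu> = sets (restrict_space all_measures (measures_for l))"

text \<open>
  \<^const>\<open>measure_of\<close> falls back to the zero measure when the given set function is not countably
  additive; for \<open>\<mu>\<close> as above this does not happen, since \<open>P \<mapsto> (P \<circ> l)(A)\<close> is measurable.
\<close>

definition tilted_mixture ::
    "(nat \<Rightarrow> 'a \<Rightarrow> real) \<Rightarrow> 'a::polish_space measure measure \<Rightarrow> (nat \<Rightarrow> 'a) measure" where
  "tilted_mixture l \<mu> =
     measure_of (space inf_prod) (sets inf_prod)
       (\<lambda>A. \<integral>\<^sup>+P. emeasure (tilted_product P l) A \<partial>\<mu>)"

definition Lambda_dF :: "(nat \<Rightarrow> 'a::polish_space \<Rightarrow> real) set" where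
  "Lambda_dF =
     {l. (\<forall>i. l i \<in> weight_functions) \<and>
         (\<forall>Q. prob_space Q \<and> weighted_exchangeable l Q \<longrightarrow>
            (\<exists>\<mu>. distribution_on_measures_for l \<mu> \<and> Q = tilted_mixture l \<mu>))}"

end

theory Submission
  imports Defs
begin

text \<open>
  Fix a weighted exchangeable distribution \<open>Q\<close> of a sequence \<open>x\<close>, let \<open>w\<close> be the reference weight and
  write \<open>a i = (INF y. l i y / w y)\<close>. The variables \<open>v i = a i * w (x i) / l i (x i)\<close> take values between
  the \<open>i\<close>-th summand \<open>r i\<close> of the divergent series and 1. Keeping each \<open>x i\<close> independently with
  probability \<open>v i\<close> would leave infinitely many points that form an ordinary exchangeable sequence up
  to the common factor \<open>w\<close>. Accordingly, the weighted empirical measures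
  \<open>A m B = (\<Sum>k<m. v k * indicator B (x k)) / (\<Sum>k<m. v k)\<close> should converge, and the limit should
  direct the whole sequence.

  Both statements follow from one symmetry: the measure \<open>v i * v k * Q\<close> is invariant under swapping the
  coordinates \<open>i\<close> and \<open>k\<close> (lemma \<open>swap\<close> and its corollaries). Such a swap changes the total weight by a
  bounded amount, while the total weight is at least \<open>\<Sum>k<m. r k\<close>, which tends to infinity. Hence
  \<open>A m B\<close> is nearly symmetric in the first \<open>m\<close> coordinates and nearly a reverse martingale. Its second
  moments almost decrease, so it is Cauchy in \<open>L\<^sup>2\<close> (lemma \<open>wavg_L1_Cauchy\<close>). The limits form a random set
  function that is additive up to null sets, and on a Polish space it has a version \<open>\<kappa>\<close> that is a
  probability kernel (lemma \<open>random_set_function_kernel\<close>). The kernel \<open>\<kappa>\<close> is almost surely invariant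
  under swapping two coordinates.

  Let \<open>Z\<close> be a function of \<open>\<kappa>\<close> and of the coordinates before \<open>i\<close>. Swapping \<open>x i\<close> with \<open>x k\<close> for \<open>k > i\<close>,
  averaging over \<open>k\<close> and passing to the limit gives, for Borel sets \<open>C\<close> and \<open>D\<close> and \<open>g = l i / w\<close>,
  the identity \<open>E [1\<^sub>C (x i) / g (x i) * \<kappa> D * Z] = E [1\<^sub>D (x i) / g (x i) * \<kappa> C * Z]\<close>. It extends from
  indicators to nonnegative functions, and the functions \<open>1\<^sub>B * g\<close> and \<open>g\<close> turn it into
  \<open>E [1\<^sub>B (x i) * (\<integral>g d\<kappa>) * Z] = E [(\<integral>1\<^sub>B * g d\<kappa>) * Z]\<close>. So, given \<open>\<kappa>\<close> and the earlier coordinates, \<open>x i\<close> has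
  the law \<open>g d\<kappa> / (\<integral>g d\<kappa>)\<close> (lemmas \<open>directing_swap\<close>, \<open>mass_swap\<close> and \<open>factorization\<close>). This is the
  tilt by \<open>l i\<close> of \<open>P = \<kappa> / w\<close>, and the law of \<open>P\<close> is the mixing distribution.
\<close>

section \<open>Convergence in mean\<close>

text \<open>
  Completeness of \<open>L\<^sup>1\<close> for uniformly bounded functions. The limit is kept within \<open>[0, 1]\<close> at every
  point, and a subsequence converging almost everywhere is returned along with it.
\<close>

lemma (in prob_space) L1_Cauchy_limit:
  fixes u :: "nat \<Rightarrow> 'a \<Rightarrow> real"
  assumes u[measurable]: "\<And>n. u n \<in> borel_measurable M"
    and bound: "\<And>n x. 0 \<le> u n x \<and> u n x \<le> 1"
    and Cauchy: "\<And>e. 0 < e \<Longrightarrow> \<exists>N. \<forall>m\<ge>N. \<forall>n\<ge>N. (\<integral>x. \<bar>u m x - u n x\<bar> \<partial>M) \<le> e"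
  shows "\<exists>L s. L \<in> borel_measurable M \<and> (\<forall>x. 0 \<le> L x \<and> L x \<le> 1) \<and> strict_mono (s :: nat \<Rightarrow> nat) \<and>
    (AE x in M. (\<lambda>j. u (s j) x) \<longlonglongrightarrow> L x) \<and> (\<lambda>n. \<integral>x. \<bar>u n x - L x\<bar> \<partial>M) \<longlonglongrightarrow> 0"
proof -
  have "\<forall>j. \<exists>N. \<forall>m\<ge>N. \<forall>n\<ge>N. (\<integral>x. \<bar>u m x - u n x\<bar> \<partial>M) \<le> (1/2)^j"
    by (intro allI Cauchy) simp
  then obtain N where N: "\<And>j m n. m \<ge> N j \<Longrightarrow> n \<ge> N j \<Longrightarrow> (\<integral>x. \<bar>u m x - u n x\<bar> \<partial>M) \<le> (1/2)^j"
    by metis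
  \<comment> \<open>a subsequence along which successive \<open>L\<^sup>1\<close> distances are summable\<close>
  define s where "s j = j + (\<Sum>i\<le>j. N i)" for j
  have s_mono: "strict_mono s"
    by (simp add: strict_mono_Suc_iff s_def)
  have s_ge: "s j \<ge> N j" for j
    using member_le_sum[of j "{..j}" N] by (simp add: s_def)
  have int[simp]: "integrable M (\<lambda>x. \<bar>u m x - f x\<bar>)"
    if [measurable]: "f \<in> borel_measurable M" and "\<And>x. 0 \<le> f x \<and> f x \<le> 1" for m f
    using bound[of m] that(2)
    by (intro integrable_const_bound[where B=1]) (auto simp: abs_le_iff intro!: AE_I2, (smt (verit))+)
  have s_le: "(\<integral>x. \<bar>u (s (Suc j)) x - u (s j) x\<bar> \<partial>M) \<le> (1/2)^j" for j
    using N[of j "s (Suc j)" "s j"] s_ge[of j] strict_monoD[OF s_mono, of j "Suc j"] by linarith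
  have "(\<integral>\<^sup>+x. (\<Sum>j. ennreal \<bar>u (s (Suc j)) x - u (s j) x\<bar>) \<partial>M) =
      (\<Sum>j. \<integral>\<^sup>+x. ennreal \<bar>u (s (Suc j)) x - u (s j) x\<bar> \<partial>M)"
    by (rule nn_integral_suminf) measurable
  also have "\<dots> \<le> (\<Sum>j. ennreal ((1/2)^j))"
    using s_le bound by (intro suminf_le) (auto simp: nn_integral_eq_integral intro!: ennreal_leI)
  also have "\<dots> = ennreal (\<Sum>j. (1/2)^j)"
    by (intro suminf_ennreal2) auto
  finally have "(\<integral>\<^sup>+x. (\<Sum>j. ennreal \<bar>u (s (Suc j)) x - u (s j) x\<bar>) \<partial>M) \<noteq> \<infinity>"
    by (metis ennreal_less_top infinity_ennreal_def leD)
  then have "AE x in M. (\<Sum>j. ennreal \<bar>u (s (Suc j)) x - u (s j) x\<bar>) \<noteq> \<infinity>"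
    by (intro nn_integral_noteq_infinite) auto
  then have conv: "AE x in M. convergent (\<lambda>j. u (s j) x)"
  proof eventually_elim
    case (elim x)
    then have "summable (\<lambda>j. \<bar>u (s (Suc j)) x - u (s j) x\<bar>)"
      by (intro summable_suminf_not_top) auto
    then have "summable (\<lambda>j. u (s (Suc j)) x - u (s j) x)"
      by (rule summable_rabs_cancel)
    then have "convergent (\<lambda>n. \<Sum>j<n. u (s (Suc j)) x - u (s j) x)"
      by (simp add: summable_iff_convergent)
    then have "convergent (\<lambda>n. u (s n) x - u (s 0) x)"
      by (subst (asm) sum_lessThan_telescope)
    then have "convergent (\<lambda>n. (u (s n) x - u (s 0) x) + u (s 0) x)"
      by (intro convergent_add convergent_const)
    then show ?case by simp
  qed
  define L where "L x = (if convergent (\<lambda>j. u (s j) x) then lim (\<lambda>j. u (s j) x) else 0)" for x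
  have L[measurable]: "L \<in> borel_measurable M"
  proof -
    have "{x \<in> space M. Cauchy (\<lambda>j. u (s j) x)} \<in> sets M"
      by (rule sets_Collect_Cauchy) measurable
    then show ?thesis
      unfolding L_def Cauchy_convergent_iff[symmetric] by (intro measurable_If) auto
  qed
  have lim: "(\<lambda>j. u (s j) x) \<longlonglongrightarrow> L x" if "convergent (\<lambda>j. u (s j) x)" for x
    using that by (simp add: L_def convergent_LIMSEQ_iff)
  have L01: "0 \<le> L x \<and> L x \<le> 1" for x
  proof (cases "convergent (\<lambda>j. u (s j) x)")
    case True
    show ?thesis
      using lim[OF True] bound by (auto intro: LIMSEQ_le_const LIMSEQ_le_const2)
  qed (simp add: L_def)
  have limAE: "AE x in M. (\<lambda>j. u (s j) x) \<longlonglongrightarrow> L x"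
    using conv by eventually_elim (rule lim)
  have "(\<lambda>j. \<integral>x. \<bar>u (s j) x - L x\<bar> \<partial>M) \<longlonglongrightarrow> (\<integral>x. 0 \<partial>M)"
  proof (rule integral_dominated_convergence[where w="\<lambda>_. 1"])
    show "AE x in M. (\<lambda>j. \<bar>u (s j) x - L x\<bar>) \<longlonglongrightarrow> 0"
      using limAE by eventually_elim (auto intro!: tendsto_rabs_zero simp: LIM_zero_iff)
    show "AE x in M. norm \<bar>u (s j) x - L x\<bar> \<le> 1" for j
    proof (rule AE_I2)
      fix x show "norm \<bar>u (s j) x - L x\<bar> \<le> 1"
        using bound[of "s j" x] L01[of x] by (auto simp: abs_le_iff)
    qed
  qed auto
  then have lim_s: "(\<lambda>j. \<integral>x. \<bar>u (s j) x - L x\<bar> \<partial>M) \<longlonglongrightarrow> 0" by simp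
  have "(\<lambda>n. \<integral>x. \<bar>u n x - L x\<bar> \<partial>M) \<longlonglongrightarrow> 0"
  proof (rule LIMSEQ_I)
    fix e :: real assume e: "0 < e"
    obtain K where K: "\<And>m n. m \<ge> K \<Longrightarrow> n \<ge> K \<Longrightarrow> (\<integral>x. \<bar>u m x - u n x\<bar> \<partial>M) \<le> e/3"
      using Cauchy[of "e/3"] e by auto
    obtain j0 where j0: "\<And>j. j \<ge> j0 \<Longrightarrow> \<bar>\<integral>x. \<bar>u (s j) x - L x\<bar> \<partial>M\<bar> < e/3"
      using LIMSEQ_D[OF lim_s, of "e/3"] e by auto
    define j where "j = max j0 K"
    have sj: "s j \<ge> K" using strict_mono_imp_increasing[OF s_mono, of j] by (simp add: j_def)
    show "\<exists>no. \<forall>n\<ge>no. norm ((\<integral>x. \<bar>u n x - L x\<bar> \<partial>M) - 0) < e"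
    proof (intro exI[of _ K] allI impI)
      fix n assume n: "n \<ge> K"
      have "(\<integral>x. \<bar>u n x - L x\<bar> \<partial>M) \<le> (\<integral>x. \<bar>u n x - u (s j) x\<bar> + \<bar>u (s j) x - L x\<bar> \<partial>M)"
        using bound L01 by (intro integral_mono Bochner_Integration.integrable_add int) auto
      also have "\<dots> = (\<integral>x. \<bar>u n x - u (s j) x\<bar> \<partial>M) + (\<integral>x. \<bar>u (s j) x - L x\<bar> \<partial>M)"
        using bound L01 by (intro Bochner_Integration.integral_add int) auto
      also have "\<dots> < e"
        using K[OF n sj] j0[of j] e by (auto simp: j_def)
      finally show "norm ((\<integral>x. \<bar>u n x - L x\<bar> \<partial>M) - 0) < e" by simp
    qed
  qed
  with s_mono L01 limAE L show ?thesis by blast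
qed

text \<open>A bounded sequence that decreases up to vanishing errors converges: compare with its upper
  envelope.\<close>

lemma almost_decreasing_convergent:
  fixes e d :: "nat \<Rightarrow> real"
  assumes bound: "\<And>n. 0 \<le> e n" "\<And>n. e n \<le> B"
    and le: "\<And>m n. m \<le> n \<Longrightarrow> N \<le> m \<Longrightarrow> e n \<le> e m + d m" and d: "d \<longlonglongrightarrow> 0"
  shows "convergent e"
proof -
  define u where "u m = (SUP n\<in>{m..}. e n)" for m
  have bdd: "bdd_above (e ` {m..})" for m
    using bound(2) by (intro bdd_aboveI[of _ B]) auto
  have u_ge: "e n \<le> u m" if "m \<le> n" for m n
    unfolding u_def using bdd that by (intro cSUP_upper) auto
  have u_le: "u m \<le> e m + d m" if "N \<le> m" for m
    unfolding u_def using le that by (intro cSUP_least) auto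
  have "decseq u"
    unfolding decseq_def u_def using bdd by (auto intro!: cSUP_subset_mono)
  moreover have "0 \<le> u n" for n
    using bound(1)[of n] u_ge[of n n] by linarith
  ultimately obtain l where l: "u \<longlonglongrightarrow> l"
    using decseq_convergent[of u 0] by blast
  have "(\<lambda>m. u m - d m) \<longlonglongrightarrow> l - 0"
    by (intro tendsto_diff l d)
  then have "e \<longlonglongrightarrow> l"
    using l
    by (intro tendsto_sandwich[of "\<lambda>m. u m - d m" e sequentially u l])
       (auto intro!: eventually_sequentiallyI[of N] u_ge simp: diff_le_eq u_le)
  then show ?thesis by (auto simp: convergent_def)
qed

section \<open>Regular versions of random set functions\<close>

text \<open>
  A random set function assigns to each Borel set a random variable with values in \<open>[0, 1]\<close> that is
  additive only up to null sets depending on the two sets involved, and whose mean is continuous at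
  the empty set. Conditional probabilities given a \<open>\<sigma>\<close>-algebra are the model case.
\<close>

locale random_set_function = prob_space M for M :: "'w measure" +
  fixes L :: "'a::topological_space set \<Rightarrow> 'w \<Rightarrow> real"
  assumes meas[measurable]: "\<And>B. B \<in> sets borel \<Longrightarrow> L B \<in> borel_measurable M"
    and bound: "\<And>B x. 0 \<le> L B x \<and> L B x \<le> 1"
    and add: "\<And>B C. B \<in> sets borel \<Longrightarrow> C \<in> sets borel \<Longrightarrow> B \<inter> C = {} \<Longrightarrow>
      AE x in M. L (B \<union> C) x = L B x + L C x"
    and univ: "AE x in M. L UNIV x = 1"
    and cont: "\<And>B. (\<And>n. B n \<in> sets borel) \<Longrightarrow> decseq B \<Longrightarrow> (\<Inter>n. B n) = {} \<Longrightarrow>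
      (\<lambda>n. \<integral>x. L (B n) x \<partial>M) \<longlonglongrightarrow> 0"
begin

lemma integrable_set_function[simp]: "B \<in> sets borel \<Longrightarrow> integrable M (L B)"
  using bound by (intro integrable_const_bound[where B=1]) auto

lemma L_empty: "AE x in M. L {} x = 0"
  using add[of "{}" "{}"] by simp

lemma L_diff:
  assumes "B \<in> sets borel" "C \<in> sets borel" "B \<subseteq> C"
  shows "AE x in M. L (C - B) x = L C x - L B x"
  using add[of B "C - B"] assms by (auto simp: Un_absorb1 elim!: eventually_mono)

lemma L_mono:
  assumes "B \<in> sets borel" "C \<in> sets borel" "B \<subseteq> C"
  shows "AE x in M. L B x \<le> L C x"
  using L_diff[OF assms]
proof eventually_elim
  case (elim x) then show ?case using bound[of "C - B" x] by linarith
qed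

lemma L_Int_full:
  assumes "B \<in> sets borel" "F \<in> sets borel" "AE x in M. L F x = 1"
  shows "AE x in M. L (B \<inter> F) x = L B x"
proof -
  have "AE x in M. L (B - F) x \<le> L (UNIV - F) x" using assms by (intro L_mono) auto
  moreover have "AE x in M. L (UNIV - F) x = L UNIV x - L F x" using assms by (intro L_diff) auto
  moreover have "AE x in M. L ((B \<inter> F) \<union> (B - F)) x = L (B \<inter> F) x + L (B - F) x"
    using assms by (intro add) auto
  then have "AE x in M. L B x = L (B \<inter> F) x + L (B - F) x"
    by (simp add: Un_Diff_Int Un_commute)
  ultimately show ?thesis
    using assms(3) univ
  proof eventually_elim
    case (elim x) then show ?case using bound[of "B - F" x] by auto
  qed
qed

text \<open>Continuity of the mean at the empty set improves to almost sure continuity, because along a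
  decreasing sequence of sets the values are almost surely monotone.\<close>

lemma L_decseq_empty:
  assumes B: "\<And>n. B n \<in> sets borel" "decseq B" "(\<Inter>n. B n) = {}"
  shows "AE x in M. (\<lambda>n. L (B n) x) \<longlonglongrightarrow> 0"
proof -
  have "AE x in M. \<forall>n. L (B (Suc n)) x \<le> L (B n) x"
    unfolding AE_all_countable using B by (auto intro!: L_mono simp: decseq_Suc_iff)
  then have dec: "AE x in M. decseq (\<lambda>n. L (B n) x)"
    by eventually_elim (simp add: decseq_Suc_iff)
  define I where "I x = (INF n. L (B n) x)" for x
  have bdd: "bdd_below (range (\<lambda>n. L (B n) x))" for x
    using bound by (intro bdd_belowI[of _ 0]) auto
  have [measurable]: "I \<in> borel_measurable M"
    unfolding I_def using B bdd by (intro borel_measurable_cINF) auto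
  have I0: "0 \<le> I x" for x
    unfolding I_def using bound by (intro cINF_greatest) auto
  have I_le: "I x \<le> L (B n) x" for n x
    unfolding I_def using bdd by (intro cINF_lower) auto
  have intI: "integrable M I"
    using I0 I_le bound by (intro integrable_const_bound[where B=1]) (auto intro!: AE_I2 order_trans[OF I_le])
  have "(\<integral>x. I x \<partial>M) \<le> (\<integral>x. L (B n) x \<partial>M)" for n
    using intI B I_le by (intro integral_mono) auto
  then have "(\<integral>x. I x \<partial>M) \<le> 0"
    using LIMSEQ_le_const[OF cont[OF B]] by auto
  moreover have "0 \<le> (\<integral>x. I x \<partial>M)" using I0 by simp
  ultimately have "(\<integral>x. I x \<partial>M) = 0" by simp
  then have "AE x in M. I x = 0"
    using integral_nonneg_eq_0_iff_AE[OF intI] I0 by simp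
  with dec show ?thesis
  proof eventually_elim
    case (elim x)
    have "(\<lambda>n. L (B n) x) \<longlonglongrightarrow> (INF n. L (B n) x)"
      using elim(1) bdd by (intro LIMSEQ_decseq_INF) auto
    with elim(2) show ?case by (simp add: I_def)
  qed
qed

lemma L_decseq:
  assumes B: "\<And>n. B n \<in> sets borel" "decseq B"
  shows "AE x in M. (\<lambda>n. L (B n) x) \<longlonglongrightarrow> L (\<Inter>n. B n) x"
proof -
  let ?C = "\<Inter>n. B n"
  have C: "?C \<in> sets borel" using B by auto
  have "AE x in M. (\<lambda>n. L (B n - ?C) x) \<longlonglongrightarrow> 0"
    using B C by (intro L_decseq_empty) (auto simp: decseq_def)
  moreover have "AE x in M. \<forall>n. L (B n - ?C) x = L (B n) x - L ?C x"
    unfolding AE_all_countable using B C by (intro allI L_diff) auto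
  ultimately show ?thesis
    by eventually_elim (simp add: LIM_zero_iff)
qed

lemma L_disjoint_UN:
  fixes B :: "nat \<Rightarrow> 'a set"
  assumes B: "\<And>n. B n \<in> sets borel" "disjoint_family B"
  shows "AE x in M. (\<lambda>n. L (B n) x) sums L (\<Union>n. B n) x"
proof -
  have fin: "AE x in M. L (\<Union>i<n. B i) x = (\<Sum>i<n. L (B i) x)" for n
  proof (induction n)
    case 0 then show ?case using L_empty by simp
  next
    case (Suc n)
    have "AE x in M. L ((\<Union>i<n. B i) \<union> B n) x = L (\<Union>i<n. B i) x + L (B n) x"
      using B by (intro add) (auto simp: disjoint_family_on_def, metis IntI empty_iff less_irrefl)
    with Suc show ?case
      by eventually_elim (simp add: lessThan_Suc Un_commute)
  qed
  let ?R = "\<lambda>n. (\<Union>i. B i) - (\<Union>i<n. B i)"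
  have "AE x in M. (\<lambda>n. L (?R n) x) \<longlonglongrightarrow> 0"
    using B by (intro L_decseq_empty) (auto simp: decseq_def)
  moreover have "AE x in M. \<forall>n. L (?R n) x = L (\<Union>i. B i) x - L (\<Union>i<n. B i) x"
    unfolding AE_all_countable using B by (intro allI L_diff) auto
  moreover have "AE x in M. \<forall>n. L (\<Union>i<n. B i) x = (\<Sum>i<n. L (B i) x)"
    unfolding AE_all_countable using fin by auto
  ultimately show ?thesis
  proof eventually_elim
    case (elim x)
    then have "(\<lambda>n. L (\<Union>i. B i) x - (\<Sum>i<n. L (B i) x)) \<longlonglongrightarrow> 0" by simp
    from tendsto_diff[OF tendsto_const[of "L (\<Union>i. B i) x"] this]
    show ?case by (simp add: sums_def)
  qed
qed

text \<open>Agreement with a kernel spreads from an intersection-stable generator to all Borel sets.\<close>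

lemma kernel_eqI:
  assumes \<kappa>: "\<kappa> \<in> M \<rightarrow>\<^sub>M prob_algebra borel"
    and G: "sets borel = sigma_sets UNIV G" "Int_stable G"
    and eq: "\<And>B. B \<in> G \<Longrightarrow> AE x in M. measure (\<kappa> x) B = L B x"
    and B: "B \<in> sets borel"
  shows "AE x in M. measure (\<kappa> x) B = L B x"
proof -
  have \<kappa>p: "prob_space (\<kappa> x)" "sets (\<kappa> x) = sets borel" "space (\<kappa> x) = UNIV" if "x \<in> space M" for x
    using measurable_space[OF \<kappa> that] sets_eq_imp_space_eq[of "\<kappa> x" borel]
    by (auto simp: space_prob_algebra)
  have "G \<subseteq> Pow UNIV" by simp
  from G(2) this B[unfolded G(1)] show ?thesis
  proof (induction rule: sigma_sets_induct_disjoint)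
    case (basic A) then show ?case by (rule eq)
  next
    case empty
    show ?case using L_empty by eventually_elim simp
  next
    case (compl A)
    then have A: "A \<in> sets borel" by (simp add: G(1))
    then have "AE x in M. L (UNIV - A) x = L UNIV x - L A x"
      by (intro L_diff) auto
    from compl(2) this univ AE_space[of M] show ?case
    proof eventually_elim
      case (elim x)
      then show ?case
        using prob_space.prob_compl[OF \<kappa>p(1)[of x], of A] \<kappa>p[of x] A by (auto)
    qed
  next
    case (union A)
    then have A: "\<And>i. A i \<in> sets borel" by (metis G(1) range_subsetD)
    have "AE x in M. \<forall>i. measure (\<kappa> x) (A i) = L (A i) x"
      unfolding AE_all_countable using union by auto
    with L_disjoint_UN[OF A union(1)] AE_space[of M] show ?case
    proof eventually_elim
      case (elim x)
      interpret K: prob_space "\<kappa> x" by (rule \<kappa>p) fact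
      have "(\<lambda>i. measure (\<kappa> x) (A i)) sums measure (\<kappa> x) (\<Union>i. A i)"
        using A \<kappa>p[of x] elim union(1) by (intro K.finite_measure_UNION) auto
      with elim show ?case by (auto dest: sums_unique2)
    qed
  qed
qed

end

text \<open>
  On the unit interval the kernel is built from its distribution functions. The infimum over
  rational thresholds \<open>q > t\<close> makes \<open>t \<mapsto> F x t\<close> a distribution function for every \<open>x\<close>, without
  discarding a null set first.
\<close>

lemma random_set_function_real_kernel:
  fixes L :: "real set \<Rightarrow> 'w \<Rightarrow> real"
  assumes "random_set_function M L" and supp: "AE x in M. L {0..1} x = 1"
  shows "\<exists>\<kappa>\<in>M \<rightarrow>\<^sub>M prob_algebra borel. \<forall>B\<in>sets borel. AE x in M. measure (\<kappa> x) B = L B x"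
proof -
  interpret random_set_function M L by fact
  define I where "I x t = (INF q\<in>{q\<in>\<rat>. t < q}. L {..q} x)" for x t
  define F where "F x t = (if t < 0 then 0 else if 1 \<le> t then 1 else I x t)" for x and t :: real
  have bdd: "bdd_below ((\<lambda>q. L {..q} x) ` A)" for x A
    using bound by (intro bdd_belowI[of _ 0]) auto
  have ne: "{q\<in>\<rat>. t < q} \<noteq> {}" for t :: real
    using Rats_dense_in_real[of t "t + 1"] by auto
  have I_ge: "0 \<le> I x t" for x t
    unfolding I_def using ne bound by (intro cINF_greatest) auto
  have I_le: "I x t \<le> L {..q} x" if "q \<in> \<rat>" "t < q" for x t q
    unfolding I_def using that bdd by (intro cINF_lower) auto
  have I_le1: "I x t \<le> 1" for x t
  proof -
    obtain q where "q \<in> \<rat>" "t < q" using ne[of t] by auto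
    with I_le[of q t x] bound[of "{..q}" x] show ?thesis by linarith
  qed
  have I_mono: "I x s \<le> I x t" if "s \<le> t" for x s t
    unfolding I_def using that ne[of t] bdd by (intro cINF_superset_mono) auto
  have F_mono: "F x s \<le> F x t" if "s \<le> t" for x s t
    using that I_ge I_le1 I_mono by (auto simp: F_def)
  have F_cont: "continuous (at_right t) (F x)" for x t
  proof -
    consider "t < 0" | "1 \<le> t" | "0 \<le> t" "t < 1" by linarith
    then have "(F x \<longlongrightarrow> F x t) (at_right t)"
    proof cases
      case 1
      then have "eventually (\<lambda>s. F x s = F x t) (at_right t)"
        unfolding eventually_at_right_field by (intro exI[of _ 0]) (auto simp: F_def)
      then show ?thesis by (rule tendsto_eventually)
    next
      case 2
      then have "eventually (\<lambda>s. F x s = F x t) (at_right t)"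
        unfolding eventually_at_right_field by (intro exI[of _ "t+1"]) (auto simp: F_def)
      then show ?thesis by (rule tendsto_eventually)
    next
      case 3
      show ?thesis
      proof (rule decreasing_tendsto)
        show "eventually (\<lambda>s. F x t \<le> F x s) (at_right t)"
          unfolding eventually_at_right_field by (intro exI[of _ "t+1"]) (auto intro: F_mono)
        fix y assume "F x t < y"
        with 3 have "I x t < y" by (simp add: F_def)
        then obtain q where q: "q \<in> \<rat>" "t < q" "L {..q} x < y"
          unfolding I_def using ne bdd by (subst (asm) cINF_less_iff) auto
        show "eventually (\<lambda>s. F x s < y) (at_right t)"
          unfolding eventually_at_right_field
        proof (intro exI[of _ "min q 1"] conjI allI impI)
          show "t < min q 1" using q 3 by simp
          fix s assume s: "t < s" "s < min q 1"
          then show "F x s < y"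
            using I_le[of q s x] q 3 by (simp add: F_def)
        qed
      qed
    qed
    then show ?thesis by (simp add: continuous_within)
  qed
  have F_bot: "(F x \<longlongrightarrow> 0) at_bot" for x
    by (rule tendsto_eventually) (auto simp: F_def eventually_at_bot_dense intro!: exI[of _ 0])
  have F_top: "(F x \<longlongrightarrow> 1) at_top" for x
    by (rule tendsto_eventually) (auto simp: F_def eventually_at_top_linorder intro!: exI[of _ 1])
  define \<kappa> where "\<kappa> x = interval_measure (F x)" for x
  have \<kappa>p: "prob_space (\<kappa> x)" for x
    using real_distribution_interval_measure[OF F_mono F_cont F_bot F_top]
    by (simp add: \<kappa>_def real_distribution_def)
  have \<kappa>_cdf: "measure (\<kappa> x) {..t} = F x t" for x t
    unfolding \<kappa>_def by (rule measure_interval_measure_Iic[OF F_mono F_cont F_bot])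
  have I_meas[measurable]: "(\<lambda>x. I x t) \<in> borel_measurable M" for t
    unfolding I_def using bdd countable_rat by (intro borel_measurable_cINF) (auto intro: countable_subset)
  have gen: "sets borel = sigma_sets UNIV (range (\<lambda>t::real. {..t}))" "Int_stable (range (\<lambda>t::real. {..t}))"
    by (auto simp: borel_eq_atMost Int_stable_def)
  have \<kappa>: "\<kappa> \<in> M \<rightarrow>\<^sub>M prob_algebra borel"
  proof (rule measurable_prob_algebra_generated[OF gen])
    show "prob_space (\<kappa> x)" "sets (\<kappa> x) = sets borel" for x
      using \<kappa>p by (auto simp: \<kappa>_def)
    fix A assume "A \<in> range (\<lambda>t::real. {..t})"
    then obtain t where A: "A = {..t}" by auto
    have "(\<lambda>x. ennreal (F x t)) \<in> borel_measurable M"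
      unfolding F_def by measurable
    moreover have "emeasure (\<kappa> x) A = ennreal (F x t)" for x
      using \<kappa>p \<kappa>_cdf by (simp add: A finite_measure.emeasure_eq_measure prob_space.finite_measure)
    ultimately show "(\<lambda>x. emeasure (\<kappa> x) A) \<in> borel_measurable M" by simp
  qed simp
  have "AE x in M. measure (\<kappa> x) B = L B x" if "B \<in> range (\<lambda>t::real. {..t})" for B
  proof -
    from that obtain t where B: "B = {..t}" by auto
    consider "t < 0" | "1 \<le> t" | "0 \<le> t" "t < 1" by linarith
    then have "AE x in M. F x t = L {..t} x"
    proof cases
      case 1
      then have "{..t} \<inter> {0..1} = {}" by auto
      with L_Int_full[of "{..t}" "{0..1}"] supp have "AE x in M. L {} x = L {..t} x" by simp
      with L_empty show ?thesis by eventually_elim (use 1 in \<open>simp add: F_def\<close>)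
    next
      case 2
      then have "{..t} \<inter> {0..1} = {0..1}" by auto
      with L_Int_full[of "{..t}" "{0..1}"] supp have "AE x in M. L {0..1} x = L {..t} x" by simp
      with supp show ?thesis by eventually_elim (use 2 in \<open>simp add: F_def\<close>)
    next
      case 3
      have "(\<Inter>n. {..t + 1 / real (Suc n)}) = {..t}"
      proof (intro equalityI subsetI)
        fix y assume "y \<in> (\<Inter>n. {..t + 1 / real (Suc n)})"
        then have "\<forall>n. y \<le> t + 1 / real (Suc n)" by auto
        moreover have "(\<lambda>n. t + 1 / real (Suc n)) \<longlonglongrightarrow> t + 0"
          by (intro tendsto_add tendsto_const LIMSEQ_Suc lim_1_over_n)
        ultimately have "y \<le> t + 0" by (intro LIMSEQ_le_const) auto
        then show "y \<in> {..t}" by simp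
      next
        fix y assume "y \<in> {..t}"
        then show "y \<in> (\<Inter>n. {..t + 1 / real (Suc n)})" by (auto intro!: add_increasing2)
      qed
      with L_decseq[of "\<lambda>n. {..t + 1 / real (Suc n)}"]
      have lim: "AE x in M. (\<lambda>n. L {..t + 1 / real (Suc n)} x) \<longlonglongrightarrow> L {..t} x"
        by (auto simp: decseq_def frac_le intro: order_trans)
      have "\<exists>q\<in>\<rat>. t < q \<and> q < t + 1 / real (Suc n)" for n
        by (rule Rats_dense_in_real) simp
      then obtain q where q: "\<And>n. q n \<in> \<rat>" "\<And>n. t < q n" "\<And>n. q n < t + 1 / real (Suc n)"
        by metis
      have "AE x in M. \<forall>n. L {..q n} x \<le> L {..t + 1 / real (Suc n)} x"
        unfolding AE_all_countable using q(3) by (intro allI L_mono) (auto intro: order_trans less_imp_le)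
      moreover have "AE x in M. \<forall>p\<in>{p\<in>\<rat>. t < p}. L {..t} x \<le> L {..p} x"
        using countable_rat by (subst AE_ball_countable) (auto intro: countable_subset intro!: L_mono)
      ultimately show ?thesis
        using lim
      proof eventually_elim
        case (elim x)
        have "L {..t} x \<le> I x t"
          unfolding I_def using elim(2) ne by (intro cINF_greatest) auto
        moreover have "I x t \<le> L {..t} x"
        proof (rule LIMSEQ_le_const[OF elim(3)], intro exI allI impI)
          fix n show "I x t \<le> L {..t + 1 / real (Suc n)} x"
            using I_le[OF q(1)[of n] q(2)[of n], of x] elim(1) by (meson order_trans)
        qed
        ultimately show ?case using 3 by (simp add: F_def)
      qed
    qed
    then show ?thesis by eventually_elim (simp add: B \<kappa>_cdf)
  qed
  with \<kappa> kernel_eqI[OF \<kappa> gen] show ?thesis by blast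
qed

text \<open>Base 3 with digits 0 and 1 only: the first differing digit outweighs all later ones.\<close>

lemma ternary_digits_inj:
  fixes d e :: "nat \<Rightarrow> real"
  assumes d: "\<And>k. d k \<in> {0, 1}" and e: "\<And>k. e k \<in> {0, 1}"
    and eq: "(\<Sum>k. d k * (1/3)^k) = (\<Sum>k. e k * (1/3)^k)"
  shows "d = e"
proof (rule ccontr)
  assume "d \<noteq> e"
  then have "\<exists>k. d k \<noteq> e k" by auto
  then obtain k where k: "d k \<noteq> e k" and less: "\<And>j. j < k \<Longrightarrow> d j = e j"
    using exists_least_iff[of "\<lambda>k. d k \<noteq> e k"] by auto
  define c where "c j = (d j - e j) * (1/3)^j" for j
  have geo: "summable (\<lambda>j. (1/3::real)^j)" by (simp add: summable_geometric)
  have sd: "summable (\<lambda>j. d j * (1/3)^j)" "summable (\<lambda>j. e j * (1/3)^j)"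
    using d e by (auto intro!: summable_comparison_test[OF _ geo] exI[of _ 0] simp: abs_mult)
      (metis abs_0 abs_1 insert_iff singletonD zero_le_one order_refl mult_left_le_one_le abs_ge_zero zero_le_power divide_nonneg_nonneg zero_le_numeral power_one_over)+
  have c_sum: "summable c"
    using summable_diff[OF sd] by (simp add: c_def[abs_def] left_diff_distrib)
  have "suminf c = 0"
    using suminf_diff[OF sd] eq by (simp add: c_def[abs_def] left_diff_distrib)
  moreover have "suminf c = (\<Sum>n. c (n + Suc k)) + (\<Sum>j<Suc k. c j)"
    by (rule suminf_split_initial_segment[OF c_sum])
  moreover have "(\<Sum>j<Suc k. c j) = c k"
    using less by (simp add: c_def)
  ultimately have ck: "\<bar>c k\<bar> = \<bar>\<Sum>n. c (n + Suc k)\<bar>" by linarith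
  have c_le: "\<bar>c j\<bar> \<le> (1/3)^j" for j
    using d[of j] e[of j] by (auto simp: c_def abs_mult)
  have sums: "(\<lambda>n. (1/3::real)^(n + Suc k)) sums ((1/3)^Suc k * (1 / (1 - 1/3)))"
    using sums_mult[OF geometric_sums[of "1/3::real"], of "(1/3)^Suc k"] by (simp add: power_add mult_ac)
  have sa: "summable (\<lambda>n. \<bar>c (n + Suc k)\<bar>)"
    using c_le[of "_ + Suc k"]
    by (intro summable_comparison_test'[OF sums_summable[OF sums], of 0]) (simp del: add_Suc_right)
  have "\<bar>\<Sum>n. c (n + Suc k)\<bar> \<le> (\<Sum>n. \<bar>c (n + Suc k)\<bar>)"
    by (rule summable_rabs[OF sa])
  also have "\<dots> \<le> (\<Sum>n. (1/3)^(n + Suc k))"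
    using sa sums c_le[of "_ + Suc k"] by (intro suminf_le) (auto simp: sums_iff)
  also have "\<dots> = (1/3)^k / 2"
    using sums by (simp add: sums_iff)
  finally have "\<bar>c k\<bar> \<le> (1/3)^k / 2" using ck by simp
  moreover have "\<bar>c k\<bar> = (1/3)^k"
    using d[of k] e[of k] k by (auto simp: c_def abs_mult)
  ultimately show False by simp
qed

lemma separating_opens:
  obtains U :: "nat \<Rightarrow> 'a::{t1_space, second_countable_topology} set"
  where "\<And>k. open (U k)" "\<And>x y. x \<noteq> y \<Longrightarrow> \<exists>k. x \<in> U k \<and> y \<notin> U k"
proof -
  obtain B :: "'a set set" where B: "countable B" "topological_basis B"
    using ex_countable_basis by auto
  have "\<exists>V\<in>B. x \<in> V \<and> y \<notin> V" if xy: "x \<noteq> y" for x y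
  proof -
    obtain W where W: "open W" "x \<in> W" "y \<notin> W" using t1_space[OF xy] by auto
    obtain V where "V \<in> B" "x \<in> V" "V \<subseteq> W" by (rule topological_basisE[OF B(2) W(1,2)])
    then show ?thesis using W by auto
  qed
  note sep = this
  have ne: "insert UNIV B \<noteq> {}" by simp
  have rng: "range (from_nat_into (insert UNIV B)) = insert UNIV B"
    using B by (intro range_from_nat_into) auto
  show thesis
  proof (rule that[of "from_nat_into (insert UNIV B)"])
    fix k show "open (from_nat_into (insert UNIV B) k)"
      using from_nat_into[OF ne, of k] B(2) by (auto simp: topological_basis_open)
    fix x y :: 'a assume "x \<noteq> y"
    from sep[OF this] obtain V where V: "V \<in> B" "x \<in> V" "y \<notin> V" by auto
    then obtain k where "V = from_nat_into (insert UNIV B) k"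
      using rng by (metis imageE insertI2)
    with V show "\<exists>k. x \<in> from_nat_into (insert UNIV B) k \<and> y \<notin> from_nat_into (insert UNIV B) k"
      by auto
  qed
qed

lemma (in random_set_function) mean_measure:
  "\<exists>N. sets N = sets borel \<and> (\<forall>B\<in>sets borel. emeasure N B = ennreal (\<integral>x. L B x \<partial>M))"
proof -
  let ?m = "\<lambda>B. ennreal (\<integral>x. L B x \<partial>M)"
  define N where "N = measure_of UNIV (sets (borel :: 'a measure)) ?m"
  have "positive (sets borel) ?m"
    using L_empty integral_cong_AE[of "L {}" M "\<lambda>_. 0"] by (simp add: positive_def)
  moreover have "countably_additive (sets borel) ?m"
  proof (rule sets.empty_continuous_imp_countably_additive)
    show "positive (sets borel) ?m" by fact
    show "additive (sets borel) ?m"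
      unfolding additive_def
    proof (intro ballI impI)
      fix B C :: "'a set" assume BC: "B \<in> sets borel" "C \<in> sets borel" "B \<inter> C = {}"
      have "(\<integral>x. L (B \<union> C) x \<partial>M) = (\<integral>x. L B x + L C x \<partial>M)"
        using BC add[OF BC] by (intro integral_cong_AE) auto
      also have "\<dots> = (\<integral>x. L B x \<partial>M) + (\<integral>x. L C x \<partial>M)"
        using BC by simp
      finally show "?m (B \<union> C) = ?m B + ?m C"
        using bound by (simp add: ennreal_plus)
    qed
    fix A :: "nat \<Rightarrow> 'a set" assume "range A \<subseteq> sets borel" "decseq A" "(\<Inter>i. A i) = {}"
    then have "(\<lambda>n. \<integral>x. L (A n) x \<partial>M) \<longlonglongrightarrow> 0" by (intro cont) auto
    then show "(\<lambda>i. ?m (A i)) \<longlonglongrightarrow> 0" using tendsto_ennrealI by fastforce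
  qed simp
  ultimately have "emeasure N B = ?m B" if "B \<in> sets borel" for B
    unfolding N_def using that sets.sigma_algebra_axioms[of "borel :: 'a measure"]
    by (intro emeasure_measure_of_sigma) auto
  moreover have "sets N = sets borel"
    unfolding N_def using sets.sigma_sets_eq[of "borel :: 'a measure"] by simp
  ultimately show ?thesis by blast
qed

text \<open>A form of Lusin's theorem: off a set of small measure, the indicators of countably many open
  sets are simultaneously continuous on a compact set.\<close>

lemma compact_where_opens_are_clopen:
  fixes N :: "'a::polish_space measure" and U :: "nat \<Rightarrow> 'a set"
  assumes N: "sets N = sets borel" "finite_measure N" and U: "\<And>k. open (U k)" and e: "0 < (e::real)"
  shows "\<exists>K. compact K \<and> measure N (- K) \<le> e \<and>
    (\<forall>k. closed (K \<inter> U k) \<and> closed (K - U k))"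
proof -
  interpret finite_measure N by fact
  have spN: "space N = UNIV" using sets_eq_imp_space_eq[OF N(1)] by simp
  have reg: "\<exists>C. compact C \<and> C \<subseteq> B \<and> measure N (B - C) < d" if B: "B \<in> sets borel" and d: "0 < d" for B d
  proof (cases "measure N B < d")
    case True then show ?thesis by (intro exI[of _ "{}"]) auto
  next
    case False
    have "ennreal (measure N B - d) < emeasure N B"
      using d False by (simp add: emeasure_eq_measure ennreal_less_iff)
    also have "emeasure N B = (SUP K \<in> {K. K \<subseteq> B \<and> compact K}. emeasure N K)"
      using N B by (intro inner_regular) auto
    finally obtain C where C: "C \<subseteq> B" "compact C" "ennreal (measure N B - d) < emeasure N C"
      by (auto simp: less_SUP_iff)
    then have "measure N B - d < measure N C"
      using False by (simp add: emeasure_eq_measure ennreal_less_iff)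
    moreover have "measure N (B - C) = measure N B - measure N C"
      using C B N by (intro finite_measure_Diff) (auto simp: borel_compact)
    ultimately show ?thesis using C by auto
  qed
  have "\<exists>C D. compact C \<and> C \<subseteq> U k \<and> compact D \<and> D \<subseteq> - U k \<and>
      measure N (- (C \<union> D)) \<le> e * (1/2)^Suc k" for k
  proof -
    have d: "0 < e * (1/2)^Suc k / 2" using e by simp
    obtain C where C: "compact C" "C \<subseteq> U k" "measure N (U k - C) < e * (1/2)^Suc k / 2"
      using reg[OF _ d, of "U k"] U[of k] by auto
    obtain D where D: "compact D" "D \<subseteq> - U k" "measure N (- U k - D) < e * (1/2)^Suc k / 2"
      using reg[OF _ d, of "- U k"] U[of k] by auto
    have sets: "C \<in> sets N" "D \<in> sets N" "U k \<in> sets N" "- U k \<in> sets N"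
      using C D U[of k] N by (auto simp: borel_compact)
    have "- (C \<union> D) \<subseteq> (U k - C) \<union> (- U k - D)" by auto
    then have "measure N (- (C \<union> D)) \<le> measure N ((U k - C) \<union> (- U k - D))"
      using sets by (intro finite_measure_mono) auto
    also have "\<dots> \<le> measure N (U k - C) + measure N (- U k - D)"
      using sets by (intro measure_Un_le) auto
    finally have "measure N (- (C \<union> D)) \<le> e * (1/2)^Suc k"
      using C(3) D(3) by linarith
    with C D show ?thesis by blast
  qed
  then obtain C D where CD: "\<And>k. compact (C k)" "\<And>k. C k \<subseteq> U k" "\<And>k. compact (D k)" "\<And>k. D k \<subseteq> - U k"
      "\<And>k. measure N (- (C k \<union> D k)) \<le> e * (1/2)^Suc k"
    by metis
  define K where "K = (\<Inter>k. C k \<union> D k)"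
  have clK: "closed K" unfolding K_def using CD by (intro closed_INT ballI closed_Un compact_imp_closed)
  have "compact ((C 0 \<union> D 0) \<inter> K)" using CD clK by (intro compact_Int_closed compact_Un)
  moreover have "(C 0 \<union> D 0) \<inter> K = K" by (auto simp: K_def)
  ultimately have cK: "compact K" by simp
  have half: "(\<lambda>k. e * (1/2)^Suc k) sums e"
    using sums_mult[OF power_half_series, of e] by simp
  have sm: "summable (\<lambda>k. measure N (- (C k \<union> D k)))"
    using CD(5) by (intro summable_comparison_test'[OF sums_summable[OF half], of 0]) auto
  have rng: "range (\<lambda>k. - (C k \<union> D k)) \<subseteq> sets N"
    using CD(1,3) N by (auto simp del: Compl_Un intro!: borel_open open_Compl closed_Un compact_imp_closed)
  have "measure N (- K) = measure N (\<Union>k. - (C k \<union> D k))"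
    by (intro arg_cong[where f="measure N"]) (auto simp: K_def)
  also have "\<dots> \<le> (\<Sum>k. measure N (- (C k \<union> D k)))"
    using rng sm by (rule finite_measure_subadditive_countably)
  also have "\<dots> \<le> (\<Sum>k. e * (1/2)^Suc k)"
    using CD(5) sm half by (intro suminf_le) (auto simp: sums_iff)
  also have "\<dots> = e" using half by (simp add: sums_iff)
  finally have "measure N (- K) \<le> e" .
  moreover have "K \<inter> U k = K \<inter> C k" "K - U k = K \<inter> D k" for k
    using CD(2,4)[of k] by (auto simp: K_def)
  ultimately show ?thesis
    using cK clK CD(1,3) by (intro exI[of _ K]) (auto intro!: closed_Int compact_imp_closed)
qed


text \<open>
  For a Polish space, an injective Borel map \<open>h\<close> into the unit interval transports the problem to the
  real case. To come back, \<open>h\<close> has to be inverted on a Borel set of full mass: it is continuous on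
  compact sets \<open>K j\<close> that exhaust the mean measure, so images of closed subsets of \<open>\<Union>j. K j\<close> are
  \<open>\<sigma>\<close>-compact and the inverse is Borel measurable there.
\<close>

lemma random_set_function_kernel:
  fixes L :: "'a::polish_space set \<Rightarrow> 'w \<Rightarrow> real"
  assumes "random_set_function M L"
  shows "\<exists>\<kappa>\<in>M \<rightarrow>\<^sub>M prob_algebra borel. \<forall>B\<in>sets borel. AE x in M. measure (\<kappa> x) B = L B x"
proof -
  interpret random_set_function M L by fact
  obtain N where N: "sets N = sets borel" "\<And>B. B \<in> sets borel \<Longrightarrow> emeasure N B = ennreal (\<integral>x. L B x \<partial>M)"
    using mean_measure by auto
  have spN: "space N = UNIV" using sets_eq_imp_space_eq[OF N(1)] by simp
  have fin: "finite_measure N"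
    by (rule finite_measureI) (simp add: spN N(2))
  have N': "measure N B = (\<integral>x. L B x \<partial>M)" if "B \<in> sets borel" for B
    using N(2)[OF that] bound by (simp add: measure_def)
  obtain U :: "nat \<Rightarrow> 'a set" where U: "\<And>k. open (U k)" "\<And>x y. x \<noteq> y \<Longrightarrow> \<exists>k. x \<in> U k \<and> y \<notin> U k"
    using separating_opens by blast
  have "\<forall>j. \<exists>K. compact K \<and> measure N (- K) \<le> 1 / real (Suc j) \<and>
    (\<forall>k. closed (K \<inter> U k) \<and> closed (K - U k))"
    by (intro allI compact_where_opens_are_clopen N fin U) simp
  then obtain K where K: "\<And>j. compact (K j)" "\<And>j. measure N (- K j) \<le> 1 / real (Suc j)"
    "\<And>j k. closed (K j \<inter> U k)" "\<And>j k. closed (K j - U k)"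
    by metis
  define X0 where "X0 = (\<Union>j. K j)"
  have K_sets: "K j \<in> sets borel" for j using K(1) by (rule borel_compact)
  have X0[measurable]: "X0 \<in> sets borel" unfolding X0_def using K_sets by auto
  have "measure N (- X0) \<le> 1 / real (Suc j)" for j
  proof -
    interpret finite_measure N by fact
    have "- X0 \<subseteq> - K j" by (auto simp: X0_def)
    then have "measure N (- X0) \<le> measure N (- K j)"
      using N(1) K_sets[of j] by (intro finite_measure_mono) auto
    with K(2)[of j] show ?thesis by linarith
  qed
  then have "measure N (- X0) \<le> 0"
    by (intro LIMSEQ_le_const[OF LIMSEQ_Suc[OF lim_1_over_n]]) auto
  then have "(\<integral>x. L (- X0) x \<partial>M) = 0"
    using N'[of "- X0"] measure_nonneg[of N "- X0"] X0 by auto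
  then have "AE x in M. L (- X0) x = 0"
    using integral_nonneg_eq_0_iff_AE[of M "L (- X0)"] X0 bound by auto
  moreover have "AE x in M. L (UNIV - (- X0)) x = L UNIV x - L (- X0) x"
    using X0 by (intro L_diff) auto
  ultimately have LX0: "AE x in M. L X0 x = 1"
    using univ by eventually_elim (simp add: Diff_eq)

  define h where "h x = (\<Sum>k. indicator (U k) x * (1/3)^k) / (2::real)" for x
  have geo: "(\<lambda>k. (1/3)^k) sums (3/2 :: real)" using geometric_sums[of "1/3::real"] by simp
  have hs: "summable (\<lambda>k. indicator (U k) x * (1/3::real)^k)" for x
    by (intro summable_comparison_test'[OF sums_summable[OF geo], of 0]) (auto simp: indicator_def)
  have h01: "h x \<in> {0..1}" for x
  proof -
    have "(\<Sum>k. indicator (U k) x * (1/3::real)^k) \<le> (\<Sum>k. (1/3::real)^k)"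
      using hs geo by (intro suminf_le) (auto simp: sums_iff indicator_def)
    moreover have "0 \<le> (\<Sum>k. indicator (U k) x * (1/3::real)^k)"
      by (intro suminf_nonneg hs) auto
    ultimately show ?thesis using geo by (simp add: h_def sums_iff)
  qed
  have h_inj: "inj h"
  proof (rule injI, rule ccontr)
    fix x y assume "h x = h y" "x \<noteq> y"
    then have "(\<lambda>k. indicator (U k) x :: real) = (\<lambda>k. indicator (U k) y)"
      by (intro ternary_digits_inj) (auto simp: h_def indicator_def)
    moreover obtain k where "x \<in> U k" "y \<notin> U k" using U(2)[OF \<open>x \<noteq> y\<close>] by auto
    ultimately show False by (auto dest: fun_cong[of _ _ k])
  qed
  have h_meas[measurable]: "h \<in> borel_measurable borel"
  proof -
    have [measurable]: "U k \<in> sets borel" for k using U(1) by (rule borel_open)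
    show ?thesis unfolding h_def by measurable
  qed
  have h_cont: "continuous_on (K j) h" for j
    unfolding h_def
  proof (intro continuous_on_divide continuous_on_const)
    show "continuous_on (K j) (\<lambda>x. \<Sum>k. indicator (U k) x * (1/3::real)^k)"
    proof (rule uniform_limit_theorem[OF always_eventually])
      show "uniform_limit (K j) (\<lambda>n x. \<Sum>k<n. indicator (U k) x * (1/3::real)^k)
          (\<lambda>x. \<Sum>k. indicator (U k) x * (1/3::real)^k) sequentially"
        by (rule Weierstrass_m_test[where M="\<lambda>k. (1/3)^k"])
           (auto simp: indicator_def intro: sums_summable[OF geo])
      have "continuous_on ((K j \<inter> U k) \<union> (K j - U k)) (indicator (U k) :: _ \<Rightarrow> real)" for k
      proof (intro continuous_on_closed_Un K)
        show "continuous_on (K j \<inter> U k) (indicator (U k) :: _ \<Rightarrow> real)"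
          by (rule continuous_on_eq[OF continuous_on_const[of _ 1]]) auto
        show "continuous_on (K j - U k) (indicator (U k) :: _ \<Rightarrow> real)"
          by (rule continuous_on_eq[OF continuous_on_const[of _ 0]]) auto
      qed
      then have "continuous_on (K j) (indicator (U k) :: _ \<Rightarrow> real)" for k
        by (simp add: Int_Diff_Un)
      then show "\<forall>n. continuous_on (K j) (\<lambda>x. \<Sum>k<n. indicator (U k) x * (1/3::real)^k)"
        by (intro allI continuous_intros)
    qed simp
  qed simp
  define s where "s t = (if t \<in> h ` X0 then inv_into X0 h t else undefined)" for t
  have s_h: "s (h x) = x" if "x \<in> X0" for x
    using that h_inj by (auto simp: s_def inj_on_subset)
  have im_sets: "h ` (X0 \<inter> V) \<in> sets borel" if "closed V" for V
  proof -
    have "h ` (X0 \<inter> V) = (\<Union>j. h ` (K j \<inter> V))" by (auto simp: X0_def)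
    moreover have "compact (h ` (K j \<inter> V))" for j
      using K(1) that continuous_on_subset[OF h_cont[of j]]
      by (intro compact_continuous_image) (auto intro: compact_Int_closed)
    then have "h ` (K j \<inter> V) \<in> sets borel" for j by (rule borel_compact)
    ultimately show ?thesis by (auto intro!: sets.countable_UN)
  qed
  have s_vimage: "s -` V = h ` (X0 \<inter> V) \<union> (if undefined \<in> V then - h ` X0 else {})" for V
    using s_h by (auto simp: s_def split: if_splits intro!: imageI)
  have s_meas[measurable]: "s \<in> borel \<rightarrow>\<^sub>M borel"
  proof (rule borel_measurableI)
    fix W :: "'a set" assume "open W"
    then have "s -` (- W) \<in> sets borel"
      unfolding s_vimage using im_sets[of "- W"] im_sets[of UNIV]
      by (auto simp: closed_Compl intro!: sets.Un borel_comp)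
    then have "- (s -` (- W)) \<in> sets borel" by auto
    moreover have "- (s -` (- W)) = s -` W" by auto
    ultimately show "s -` W \<inter> space borel \<in> sets borel" by simp
  qed
  have h_vim: "h -` B \<in> sets borel" if "B \<in> sets borel" for B
    using measurable_sets[OF h_meas that] by simp
  have "random_set_function M (\<lambda>B. L (h -` B))"
  proof (unfold_locales)
    show "L (h -` B) \<in> borel_measurable M" if "B \<in> sets borel" for B
      using h_vim[OF that] by (rule meas)
    show "0 \<le> L (h -` B) x \<and> L (h -` B) x \<le> 1" for B x by (rule bound)
    show "AE x in M. L (h -` (B \<union> C)) x = L (h -` B) x + L (h -` C) x"
      if "B \<in> sets borel" "C \<in> sets borel" "B \<inter> C = {}" for B C
      unfolding vimage_Un
    proof (rule add)
      show "h -` B \<in> sets borel" "h -` C \<in> sets borel" using that h_vim by blast+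
      show "h -` B \<inter> h -` C = {}" using that(3) by blast
    qed
    show "AE x in M. L (h -` UNIV) x = 1" using univ by simp
    show "(\<lambda>n. \<integral>x. L (h -` B n) x \<partial>M) \<longlonglongrightarrow> 0"
      if "\<And>n. B n \<in> sets borel" "decseq B" "(\<Inter>n. B n) = {}" for B
    proof (rule cont)
      show "\<And>n. h -` B n \<in> sets borel" using that(1) by (rule h_vim)
      show "decseq (\<lambda>n. h -` B n)" using that(2) by (simp add: decseq_def vimage_mono)
      show "(\<Inter>n. h -` B n) = {}" using that(3) by auto
    qed
  qed
  moreover have "AE x in M. L (h -` {0..1}) x = 1"
  proof -
    have "h -` {0..1} = UNIV" using h01 by blast
    then show ?thesis using univ by simp
  qed
  ultimately have "\<exists>\<kappa>\<in>M \<rightarrow>\<^sub>M prob_algebra borel. \<forall>B\<in>sets borel. AE x in M. measure (\<kappa> x) B = L (h -` B) x"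
    by (rule random_set_function_real_kernel)
  then obtain \<kappa>' where \<kappa>': "\<kappa>' \<in> M \<rightarrow>\<^sub>M prob_algebra borel"
    "\<And>B. B \<in> sets borel \<Longrightarrow> AE x in M. measure (\<kappa>' x) B = L (h -` B) x"
    by (elim bexE) (rule that, assumption, drule bspec)
  define \<kappa> where "\<kappa> x = distr (\<kappa>' x) borel s" for x
  have "\<kappa> \<in> M \<rightarrow>\<^sub>M prob_algebra borel"
    unfolding \<kappa>_def by (rule measurable_compose[OF \<kappa>'(1) measurable_distr_prob_space[OF s_meas]])
  moreover have "AE x in M. measure (\<kappa> x) B = L B x" if B: "B \<in> sets borel" for B
  proof -
    have sB: "s -` B \<in> sets borel" using measurable_sets[OF s_meas B] by simp
    have "AE x in M. L (h -` (s -` B) \<inter> X0) x = L (h -` (s -` B)) x"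
      by (rule L_Int_full[OF h_vim[OF sB] X0 LX0])
    moreover have "h -` (s -` B) \<inter> X0 = B \<inter> X0" using s_h by (auto simp del: vimage_comp)
    ultimately have 1: "AE x in M. L (B \<inter> X0) x = L (h -` (s -` B)) x" by simp
    have 2: "AE x in M. L (B \<inter> X0) x = L B x"
      by (rule L_Int_full[OF B X0 LX0])
    from 1 2 \<kappa>'(2)[OF sB] AE_space[of M] show ?thesis
    proof eventually_elim
      case (elim x)
      have "sets (\<kappa>' x) = sets borel"
        using measurable_space[OF \<kappa>'(1) elim(4)] by (simp add: space_prob_algebra)
      moreover from this have "space (\<kappa>' x) = UNIV"
        using sets_eq_imp_space_eq[of "\<kappa>' x" borel] by simp
      ultimately have "measure (\<kappa> x) B = measure (\<kappa>' x) (s -` B)"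
        using B by (simp add: \<kappa>_def measure_distr measurable_cong_sets[of "\<kappa>' x" borel])
      with elim show ?case by simp
    qed
  qed
  ultimately show ?thesis by blast
qed

section \<open>Generators and exhausting sequences\<close>

lemma countable_Int_stable_generator:
  "\<exists>G :: 'a::second_countable_topology set set. countable G \<and> Int_stable G \<and> UNIV \<in> G \<and>
    sets borel = sigma_sets UNIV G"
proof -
  obtain B :: "'a set set" where B: "countable B" "topological_basis B"
    using ex_countable_basis by auto
  define G where "G = Inter ` {F. finite F \<and> F \<subseteq> B}"
  have cG: "countable G"
    unfolding G_def using B(1) countable_Collect_finite_subset[of B] by (auto intro!: countable_image)
  have "Inter F1 \<inter> Inter F2 = Inter (F1 \<union> F2)" for F1 F2 :: "'a set set" by auto
  then have "Int_stable G"
    unfolding Int_stable_def G_def by (auto intro!: image_eqI[OF _ CollectI])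
  moreover have "UNIV \<in> G" unfolding G_def by (intro image_eqI[of _ _ "{}"]) auto
  moreover have "sets borel = sigma_sets UNIV G"
  proof
    have "b \<in> G" if "b \<in> B" for b
      unfolding G_def using that by (intro image_eqI[of _ _ "{b}"]) auto
    then have "B \<subseteq> G" by auto
    moreover have "sets (borel :: 'a measure) = sigma_sets UNIV B"
      by (subst borel_eq_countable_basis[OF B]) simp
    ultimately show "sets borel \<subseteq> sigma_sets UNIV G"
      by (simp only: sigma_sets_mono')
    have "g \<in> sets borel" if "g \<in> G" for g
    proof -
      have "\<exists>F. finite F \<and> F \<subseteq> B \<and> g = Inter F" using that by (simp add: G_def image_iff)
      then obtain F where F: "finite F" "F \<subseteq> B" "g = Inter F" by (elim exE conjE)
      have "open g"
        unfolding F(3) using F(1,2) topological_basis_open[OF B(2)] by (intro open_Inter) blast+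
      then show ?thesis by (rule borel_open)
    qed
    then show "sigma_sets UNIV G \<subseteq> sets borel"
      using sets.sigma_sets_subset[of G borel] by (metis space_borel subsetI)
  qed
  ultimately show ?thesis using cG by blast
qed

lemma measure_eqI_incseq_cover:
  assumes "sets M = sets N" and E: "range E \<subseteq> sets M" "incseq E" "(\<Union>j. E j) = space M"
    and eq: "\<And>A j. A \<in> sets M \<Longrightarrow> emeasure M (A \<inter> E j) = emeasure N (A \<inter> E j)"
  shows "M = N"
proof (rule measure_eqI)
  fix A assume A: "A \<in> sets M"
  have un: "(\<Union>j. A \<inter> E j) = A" using E(3) sets.sets_into_space[OF A] by auto
  have inc: "incseq (\<lambda>j. A \<inter> E j)" using E(2) by (auto simp: incseq_def)
  have rng: "range (\<lambda>j. A \<inter> E j) \<subseteq> sets M" using A E(1) by auto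
  have "(\<lambda>j. emeasure M (A \<inter> E j)) \<longlonglongrightarrow> emeasure M A"
    using Lim_emeasure_incseq[OF rng inc] by (simp only: un)
  moreover have "(\<lambda>j. emeasure N (A \<inter> E j)) \<longlonglongrightarrow> emeasure N A"
    using Lim_emeasure_incseq[OF rng[unfolded assms(1)] inc] by (simp only: un)
  ultimately show "emeasure M A = emeasure N A"
    using LIMSEQ_unique eq[OF A] by simp
qed fact

section \<open>Measurability of tilted products and their mixtures\<close>

lemma space_all_measures: "space all_measures = {P. sets P = sets borel}"
  by (auto simp: all_measures_def space_measure_of_conv)

lemma emeasure_all_measures[measurable]:
  assumes A: "A \<in> sets borel"
  shows "(\<lambda>P. emeasure P A) \<in> borel_measurable (all_measures :: 'a::polish_space measure measure)"
proof (rule borel_measurableI_le)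
  let ?G = "{{P. sets P = sets borel \<and> emeasure P A \<le> ennreal t} | A t. A \<in> sets (borel :: 'a measure) \<and> 0 \<le> t}"
  have se: "sets (all_measures :: 'a measure measure) = sigma_sets {P. sets P = sets borel} ?G"
    unfolding all_measures_def by (rule sets_measure_of) auto
  fix y :: ennreal
  show "{P \<in> space all_measures. emeasure P A \<le> y} \<in> sets all_measures"
  proof (cases y rule: ennreal_cases)
    case (real t)
    then have "{P \<in> space all_measures. emeasure P A \<le> y} \<in> ?G"
      using A by (auto simp: space_all_measures)
    then show ?thesis unfolding se by (rule sigma_sets.Basic)
  next
    case top
    then show ?thesis using sets.top[of "all_measures :: 'a measure measure"] by (simp add: space_all_measures)
  qed
qed

lemma nn_integral_all_measures[measurable]:
  assumes f: "f \<in> borel_measurable borel"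
  shows "(\<lambda>P. \<integral>\<^sup>+x. f x \<partial>P) \<in> borel_measurable (all_measures :: 'a::polish_space measure measure)"
  using f
proof induct
  case (cong f g)
  moreover have "(\<lambda>P. \<integral>\<^sup>+x. f x \<partial>P) \<in> borel_measurable all_measures \<longleftrightarrow>
      (\<lambda>P. \<integral>\<^sup>+x. g x \<partial>P) \<in> borel_measurable all_measures"
    using cong by (intro measurable_cong nn_integral_cong) (auto simp: space_all_measures dest!: sets_eq_imp_space_eq)
  ultimately show ?case by simp
next
  case (set B)
  moreover then have "(\<lambda>P. \<integral>\<^sup>+x. indicator B x \<partial>P) \<in> borel_measurable all_measures \<longleftrightarrow>
      (\<lambda>P. emeasure P B) \<in> borel_measurable all_measures"
    by (intro measurable_cong nn_integral_indicator) (simp add: space_all_measures)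
  ultimately show ?case by (simp add: emeasure_all_measures)
next
  case (mult f c)
  then have "(\<lambda>P. \<integral>\<^sup>+x. c * f x \<partial>P) \<in> borel_measurable all_measures \<longleftrightarrow>
      (\<lambda>P. c * \<integral>\<^sup>+x. f x \<partial>P) \<in> borel_measurable all_measures"
    by (intro measurable_cong nn_integral_cmult) (auto simp: space_all_measures cong: measurable_cong_sets)
  with mult show ?case by simp
next
  case (add f g)
  then have "(\<lambda>P. \<integral>\<^sup>+x. f x + g x \<partial>P) \<in> borel_measurable all_measures \<longleftrightarrow>
      (\<lambda>P. (\<integral>\<^sup>+x. f x \<partial>P) + (\<integral>\<^sup>+x. g x \<partial>P)) \<in> borel_measurable all_measures"
    by (intro measurable_cong nn_integral_add) (auto simp: space_all_measures cong: measurable_cong_sets)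
  with add show ?case by (simp add: ac_simps)
next
  case (seq F)
  then have "(\<lambda>P. \<integral>\<^sup>+x. (SUP i. F i) x \<partial>P) \<in> borel_measurable all_measures \<longleftrightarrow>
      (\<lambda>P. SUP i. (\<integral>\<^sup>+x. F i x \<partial>P)) \<in> borel_measurable all_measures"
    unfolding SUP_apply
    by (intro measurable_cong nn_integral_monotone_convergence_SUP) (auto simp: space_all_measures cong: measurable_cong_sets)
  with seq show ?case by (simp add: ac_simps)
qed

context
  fixes l :: "nat \<Rightarrow> 'a::polish_space \<Rightarrow> real"
  assumes l: "\<And>i. l i \<in> weight_functions"
begin

lemma weight_meas: "l i \<in> borel_measurable borel"
  using l[of i] by (simp add: weight_functions_def)

lemma prob_space_tilt:
  assumes P: "P \<in> measures_for l"
  shows "prob_space (tilt P (l i))"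
proof
  have sP: "sets P = sets borel" and I: "0 < (\<integral>\<^sup>+x. ennreal (l i x) \<partial>P)" "(\<integral>\<^sup>+x. ennreal (l i x) \<partial>P) < \<infinity>"
    using P by (auto simp: measures_for_def)
  have m: "l i \<in> borel_measurable P" using weight_meas sP by (simp cong: measurable_cong_sets)
  have "space (tilt P (l i)) = space P" by (simp add: tilt_def)
  then have "emeasure (tilt P (l i)) (space (tilt P (l i))) =
      (\<integral>\<^sup>+x\<in>space P. ennreal (l i x) \<partial>P) / (\<integral>\<^sup>+x. ennreal (l i x) \<partial>P)"
    using emeasure_tilt[OF m sets.top] by simp
  also have "(\<integral>\<^sup>+x\<in>space P. ennreal (l i x) \<partial>P) = (\<integral>\<^sup>+x. ennreal (l i x) \<partial>P)"
    by (intro nn_integral_cong) simp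
  finally show "emeasure (tilt P (l i)) (space (tilt P (l i))) = 1"
    using I by (simp add: ennreal_divide_self)
qed

lemma sets_tilted_product: "P \<in> measures_for l \<Longrightarrow> sets (tilted_product P l) = sets inf_prod"
  unfolding tilted_product_def by (intro sets_PiM_cong) (auto simp: tilt_def measures_for_def)

lemma emeasure_tilted_product:
  assumes P: "P \<in> measures_for l" and J: "finite J" "\<And>j. j \<in> J \<Longrightarrow> A j \<in> sets borel"
  shows "emeasure (tilted_product P l) (prod_emb UNIV (\<lambda>_. borel) J (PiE J A)) =
    (\<Prod>j\<in>J. (\<integral>\<^sup>+x\<in>A j. ennreal (l j x) \<partial>P) / (\<integral>\<^sup>+x. ennreal (l j x) \<partial>P))"
proof -
  interpret product_prob_space "\<lambda>i. tilt P (l i)" UNIV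
    by (intro product_prob_spaceI prob_space_tilt P)
  have sP: "sets P = sets borel" using assms(1) by (simp add: measures_for_def)
  have s: "sets (tilt P (l j)) = sets borel" for j by (simp add: tilt_def sP)
  have sp: "space (tilt P (l j)) = UNIV" for j using sets_eq_imp_space_eq[OF s[of j]] by simp
  have "prod_emb UNIV (\<lambda>_. borel) J (PiE J A) = prod_emb UNIV (\<lambda>i. tilt P (l i)) J (PiE J A)"
    by (simp add: prod_emb_def sp)
  then have "emeasure (tilted_product P l) (prod_emb UNIV (\<lambda>_. borel) J (PiE J A)) =
      (\<Prod>j\<in>J. emeasure (tilt P (l j)) (A j))"
    unfolding tilted_product_def using J by (simp add: emeasure_PiM_emb s)
  also have "\<dots> = (\<Prod>j\<in>J. (\<integral>\<^sup>+x\<in>A j. ennreal (l j x) \<partial>P) / (\<integral>\<^sup>+x. ennreal (l j x) \<partial>P))"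
  proof (intro prod.cong refl emeasure_tilt)
    show "l j \<in> borel_measurable P" for j
      using weight_meas by (simp add: measurable_cong_sets[OF sP refl])
    show "A j \<in> sets P" if "j \<in> J" for j using J(2)[OF that] sP by simp
  qed
  finally show ?thesis .
qed

lemma tilt_factors_measurable:
  assumes "\<And>j. j \<in> J \<Longrightarrow> A j \<in> sets borel"
  shows "(\<lambda>P. \<Prod>j\<in>J. (\<integral>\<^sup>+x\<in>A j. ennreal (l j x) \<partial>P) / (\<integral>\<^sup>+x. ennreal (l j x) \<partial>P))
    \<in> borel_measurable (restrict_space all_measures (measures_for l))"
  using assms weight_meas
  by (intro borel_measurable_prod_ennreal borel_measurable_divide_ennreal measurable_restrict_space1 nn_integral_all_measures) auto

lemma tilted_product_measurable:
  "(\<lambda>P. tilted_product P l) \<in> restrict_space all_measures (measures_for l) \<rightarrow>\<^sub>M prob_algebra inf_prod"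
proof (rule measurable_prob_algebra_generated[where G="prod_algebra (UNIV :: nat set) (\<lambda>_. borel)" and \<Omega>="\<Pi>\<^sub>E i\<in>UNIV. space borel"])
  show "sets inf_prod = sigma_sets (\<Pi>\<^sub>E i\<in>UNIV. space borel) (prod_algebra UNIV (\<lambda>_. borel))"
    by (rule sets_PiM)
  show "Int_stable (prod_algebra UNIV (\<lambda>_. borel))" by (rule Int_stable_prod_algebra)
  show "prod_algebra UNIV (\<lambda>_. borel) \<subseteq> Pow (\<Pi>\<^sub>E i\<in>UNIV. space borel)" by (rule prod_algebra_sets_into_space)
  fix P assume "P \<in> space (restrict_space all_measures (measures_for l))"
  then have P: "P \<in> measures_for l" by (simp add: space_restrict_space)
  show "sets (tilted_product P l) = sets inf_prod" by (rule sets_tilted_product[OF P])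
  show "prob_space (tilted_product P l)"
    unfolding tilted_product_def by (intro prob_space_PiM prob_space_tilt P)
next
  fix A assume "A \<in> prod_algebra (UNIV :: nat set) (\<lambda>_. borel :: 'a measure)"
  then obtain J E where J: "A = prod_emb UNIV (\<lambda>_. borel) J (PiE J E)" "finite J" "\<And>j. j \<in> J \<Longrightarrow> E j \<in> sets borel"
    by (force elim!: prod_algebraE)
  have "(\<lambda>P. \<Prod>j\<in>J. (\<integral>\<^sup>+x\<in>E j. ennreal (l j x) \<partial>P) / (\<integral>\<^sup>+x. ennreal (l j x) \<partial>P))
      \<in> borel_measurable (restrict_space all_measures (measures_for l))"
    using J(3) by (rule tilt_factors_measurable)
  then show "(\<lambda>P. emeasure (tilted_product P l) A) \<in> borel_measurable (restrict_space all_measures (measures_for l))"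
    by (rule measurable_cong[THEN iffD1, rotated]) (auto simp: J space_restrict_space emeasure_tilted_product)
qed

text \<open>Since \<open>P \<mapsto> tilted_product P l\<close> is a probability kernel, the set function that defines the mixture
  is countably additive, and the mixture is determined by its values on cylinders.\<close>

lemma tilted_mixture_eqI:
  assumes \<mu>: "distribution_on_measures_for l \<mu>" and Q: "prob_space Q" "sets Q = sets inf_prod"
    and eq: "\<And>(J :: nat set) A. finite J \<Longrightarrow> (\<And>j. j \<in> J \<Longrightarrow> A j \<in> sets borel) \<Longrightarrow>
      emeasure Q (prod_emb UNIV (\<lambda>_. borel) J (PiE J A)) =
      (\<integral>\<^sup>+P. (\<Prod>j\<in>J. (\<integral>\<^sup>+x\<in>A j. ennreal (l j x) \<partial>P) / (\<integral>\<^sup>+x. ennreal (l j x) \<partial>P)) \<partial>\<mu>)"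
  shows "Q = tilted_mixture l \<mu>"
proof -
  let ?K = "\<lambda>P. tilted_product P l"
  interpret mu: prob_space \<mu> using \<mu> by (simp add: distribution_on_measures_for_def)
  have s\<mu>: "sets \<mu> = sets (restrict_space all_measures (measures_for l))"
    using \<mu> by (simp add: distribution_on_measures_for_def)
  have in_for: "P \<in> measures_for l" if "P \<in> space \<mu>" for P
    using that sets_eq_imp_space_eq[OF s\<mu>] by (simp add: space_restrict_space)
  have K: "?K \<in> \<mu> \<rightarrow>\<^sub>M subprob_algebra inf_prod"
    using tilted_product_measurable by (intro measurable_prob_algebraD) (simp cong: measurable_cong_sets add: s\<mu>)
  define N where "N = \<mu> \<bind> ?K"
  have sN: "sets N = sets inf_prod"
    unfolding N_def by (rule sets_bind[OF sets_tilted_product]) (auto simp: in_for mu.not_empty)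
  have eN: "emeasure N A = (\<integral>\<^sup>+P. emeasure (?K P) A \<partial>\<mu>)" if "A \<in> sets inf_prod" for A
    unfolding N_def by (rule emeasure_bind[OF mu.not_empty K that])
  have "Q = N"
  proof (rule measure_eqI_PiM_infinite[where I=UNIV and M="\<lambda>_. borel"])
    show "finite_measure Q" using Q(1) by (rule prob_space.finite_measure)
    fix A :: "nat \<Rightarrow> 'a set" and J assume J: "finite J" "J \<subseteq> UNIV" "\<And>j. j \<in> J \<Longrightarrow> A j \<in> sets borel"
    have "emeasure N (prod_emb UNIV (\<lambda>_. borel) J (PiE J A)) =
        (\<integral>\<^sup>+P. emeasure (?K P) (prod_emb UNIV (\<lambda>_. borel) J (PiE J A)) \<partial>\<mu>)"
      using J by (intro eN sets_PiM_I) auto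
    also have "\<dots> = (\<integral>\<^sup>+P. (\<Prod>j\<in>J. (\<integral>\<^sup>+x\<in>A j. ennreal (l j x) \<partial>P) / (\<integral>\<^sup>+x. ennreal (l j x) \<partial>P)) \<partial>\<mu>)"
      using J in_for by (intro nn_integral_cong emeasure_tilted_product) auto
    finally show "emeasure Q (prod_emb UNIV (\<lambda>_. borel) J (PiE J A)) = emeasure N (prod_emb UNIV (\<lambda>_. borel) J (PiE J A))"
      using eq[OF J(1,3)] by simp
  qed (use Q sN in auto)
  moreover have "tilted_mixture l \<mu> = N"
  proof -
    have "tilted_mixture l \<mu> = measure_of (space N) (sets N) (\<lambda>A. \<integral>\<^sup>+P. emeasure (?K P) A \<partial>\<mu>)"
      unfolding tilted_mixture_def using sN sets_eq_imp_space_eq[OF sN] by simp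
    also have "\<dots> = measure_of (space N) (sets N) (emeasure N)"
    proof (rule measure_of_eq[OF sets.space_closed])
      fix A assume "A \<in> sigma_sets (space N) (sets N)"
      then have "A \<in> sets N" by (simp only: sets.sigma_sets_eq)
      then have "A \<in> sets inf_prod" by (simp only: sN)
      then show "(\<integral>\<^sup>+P. emeasure (?K P) A \<partial>\<mu>) = emeasure N A" by (rule eN[symmetric])
    qed
    also have "\<dots> = N" by (rule measure_of_of_measure)
    finally show ?thesis .
  qed
  ultimately show ?thesis by simp
qed

end

section \<open>Swapping two coordinates of a weighted exchangeable sequence\<close>

locale weighted_exchangeable_process = prob_space Q
  for Q :: "(nat \<Rightarrow> 'a::polish_space) measure" +
  fixes l :: "nat \<Rightarrow> 'a \<Rightarrow> real"
  assumes l_weight: "\<And>i. l i \<in> weight_functions"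
    and exch: "weighted_exchangeable l Q"
begin

lemma l_meas[measurable]: "l i \<in> borel_measurable borel"
  using l_weight[of i] by (simp add: weight_functions_def)

lemma l_pos: "0 < l i x"
  using l_weight[of i] by (simp add: weight_functions_def)

lemma l_nonneg[simp]: "0 \<le> l i x" "l i x \<noteq> 0"
  using l_pos[of i x] by simp_all

lemma sets_Q[simp, measurable_cong]: "sets Q = sets inf_prod"
  using exch by (simp add: weighted_exchangeable_def)

lemma space_Q[simp]: "space Q = UNIV"
  using sets_eq_imp_space_eq[OF sets_Q] by (simp add: space_PiM)

text \<open>\<open>marginal n\<close> is the law of the first \<open>n\<close> coordinates, and \<open>unweighted n\<close> is that law divided by
  its weights, an exchangeable measure that may be infinite.\<close>

definition marginal :: "nat \<Rightarrow> (nat \<Rightarrow> 'a) measure" where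
  "marginal n = distr Q (fin_prod n) (\<lambda>x. restrict x {..<n})"

definition unweighted :: "nat \<Rightarrow> (nat \<Rightarrow> 'a) measure" where
  "unweighted n = density (marginal n) (\<lambda>x. ennreal (1 / (\<Prod>i<n. l i (x i))))"

lemma sets_marginal[simp, measurable_cong]: "sets (marginal n) = sets (fin_prod n)"
  by (simp add: marginal_def)

lemma sets_unweighted[simp, measurable_cong]: "sets (unweighted n) = sets (fin_prod n)"
  by (simp add: unweighted_def)

lemma exchangeable_unweighted: "1 \<le> n \<Longrightarrow> exchangeable n (unweighted n)"
  using exch
  by (simp add: weighted_exchangeable_def weighted_exchangeable_fin_def unweighted_def marginal_def)

text \<open>Exchangeability is postulated on boxes only. It extends to all measurable sets since the boxes
  on which every weight is at least \<open>1 / Suc j\<close> have finite mass and exhaust the space.\<close>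

lemma unweighted_permute:
  assumes n: "1 \<le> n" and \<sigma>: "\<sigma> permutes {..<n}"
  shows "distr (unweighted n) (fin_prod n) (\<lambda>x. \<lambda>i\<in>{..<n}. x (\<sigma> i)) = unweighted n"
proof (rule measure_eqI_PiM_finite[of "{..<n}" _ "\<lambda>_. borel", symmetric])
  have \<sigma>_less: "i < n \<Longrightarrow> \<sigma> i < n" for i
    using permutes_in_image[OF \<sigma>, of i] by simp
  have perm_meas: "(\<lambda>x. \<lambda>i\<in>{..<n}. x (\<sigma> i)) \<in> fin_prod n \<rightarrow>\<^sub>M (fin_prod n :: (nat \<Rightarrow> 'a) measure)"
    using \<sigma>_less by (intro measurable_restrict measurable_component_singleton) auto
  fix A :: "nat \<Rightarrow> 'a set" assume A: "\<And>i. i \<in> {..<n} \<Longrightarrow> A i \<in> sets borel"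
  have "(\<lambda>x. \<lambda>i\<in>{..<n}. x (\<sigma> i)) -` (PiE {..<n} A) \<inter> space (unweighted n) =
      PiE {..<n} (\<lambda>i. A (inv \<sigma> i))" (is "?L = ?R")
  proof (intro equalityI subsetI)
    fix x assume "x \<in> ?L"
    then have x: "x \<in> extensional {..<n}" "\<And>i. i < n \<Longrightarrow> x (\<sigma> i) \<in> A i"
      by (auto simp: unweighted_def marginal_def space_PiM PiE_iff)
    show "x \<in> ?R"
      using x(1) x(2)[of "inv \<sigma> _"] permutes_inverses(1)[OF \<sigma>] permutes_in_image[OF permutes_inv[OF \<sigma>]]
      by (auto simp: PiE_iff)
  next
    fix x assume "x \<in> ?R"
    then have x: "x \<in> extensional {..<n}" "\<And>i. i < n \<Longrightarrow> x i \<in> A (inv \<sigma> i)"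
      by (auto simp: PiE_iff)
    show "x \<in> ?L"
      using x(1) x(2)[of "\<sigma> _"] permutes_inverses(2)[OF \<sigma>] \<sigma>_less
      by (auto simp: PiE_iff unweighted_def marginal_def space_PiM)
  qed
  moreover have "PiE {..<n} A \<in> sets (fin_prod n)"
    using A by (intro sets_PiM_I_finite) auto
  ultimately have "emeasure (distr (unweighted n) (fin_prod n) (\<lambda>x. \<lambda>i\<in>{..<n}. x (\<sigma> i))) (PiE {..<n} A) =
      emeasure (unweighted n) (PiE {..<n} (\<lambda>i. A (inv \<sigma> i)))"
    using perm_meas by (subst emeasure_distr) (simp_all add: measurable_cong_sets[OF sets_unweighted refl])
  also have "\<dots> = emeasure (unweighted n) (PiE {..<n} A)"
    using exchangeable_unweighted[OF n] permutes_inv[OF \<sigma>] A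
    by (auto simp: exchangeable_def)
  finally show "emeasure (unweighted n) (PiE {..<n} A) =
     emeasure (distr (unweighted n) (fin_prod n) (\<lambda>x. \<lambda>i\<in>{..<n}. x (\<sigma> i))) (PiE {..<n} A)" ..
next
  let ?A = "\<lambda>j::nat. PiE {..<n} (\<lambda>i. {y. 1 / real (Suc j) \<le> l i y})"
  show "range ?A \<subseteq> prod_algebra {..<n} (\<lambda>_. borel)"
    by (auto intro!: prod_algebraI_finite)
  show "(\<Union>j. ?A j) = space (fin_prod n)"
  proof (intro equalityI subsetI)
    fix x :: "nat \<Rightarrow> 'a" assume x: "x \<in> space (fin_prod n)"
    have "\<exists>j. \<forall>i<n. 1 / real (Suc j) \<le> l i (x i)"
    proof -
      have "\<forall>i. \<exists>j. 1 / real (Suc j) < l i (x i)"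
        using l_pos nat_approx_posE by metis
      then obtain J where J: "\<And>i. 1 / real (Suc (J i)) < l i (x i)" by metis
      have "1 / real (Suc (\<Sum>i<n. J i)) \<le> l i (x i)" if "i < n" for i
      proof -
        have "J i \<le> (\<Sum>i<n. J i)" using that by (intro member_le_sum) auto
        then have "1 / real (Suc (\<Sum>i<n. J i)) \<le> 1 / real (Suc (J i))"
          by (intro frac_le) (simp_all del: of_nat_sum)
        with J[of i] show ?thesis by linarith
      qed
      then show ?thesis by blast
    qed
    with x show "x \<in> (\<Union>j. ?A j)" by (auto simp: space_PiM PiE_iff)
  qed (auto simp: space_PiM PiE_iff)
  fix j
  interpret m: prob_space "marginal n"
    unfolding marginal_def by (rule prob_space_distr) measurable
  have "emeasure (unweighted n) (?A j) =
      (\<integral>\<^sup>+x. ennreal (1 / (\<Prod>i<n. l i (x i))) * indicator (?A j) x \<partial>marginal n)"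
    unfolding unweighted_def by (intro emeasure_density) (auto intro!: sets_PiM_I_finite)
  also have "\<dots> \<le> (\<integral>\<^sup>+x. ennreal (real (Suc j) ^ n) \<partial>marginal n)"
  proof (rule nn_integral_mono)
    fix x
    have "1 / (\<Prod>i<n. l i (x i)) \<le> real (Suc j) ^ n" if x: "x \<in> ?A j"
    proof -
      have "(\<Prod>i<n. 1 / l i (x i)) \<le> (\<Prod>i<n. real (Suc j))"
      proof (intro prod_mono conjI)
        fix i assume "i \<in> {..<n}"
        then have "1 / real (Suc j) \<le> l i (x i)" using x by (auto simp: PiE_iff)
        then show "1 / l i (x i) \<le> real (Suc j)"
          using l_pos[of i "x i"] by (simp add: field_simps)
      qed simp
      then show ?thesis by (simp add: prod_dividef)
    qed
    then show "ennreal (1 / (\<Prod>i<n. l i (x i))) * indicator (?A j) x \<le> ennreal (real (Suc j) ^ n)"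
      by (auto simp: indicator_def intro!: ennreal_leI)
  qed
  also have "\<dots> < \<infinity>" by (simp add: m.emeasure_space_1 ennreal_mult_less_top del: of_nat_Suc)
  finally show "emeasure (unweighted n) (?A j) \<noteq> \<infinity>" by simp
qed auto

text \<open>Reinstating all weights except the \<open>i\<close>-th and the \<open>k\<close>-th.\<close>

lemma nn_integral_unweighted:
  assumes [measurable]: "G \<in> borel_measurable (fin_prod n)" and ik: "i < n" "k < n" "i \<noteq> k"
  shows "(\<integral>\<^sup>+x. G (restrict x {..<n}) * ennreal (1 / (l i (x i) * l k (x k))) \<partial>Q) =
    (\<integral>\<^sup>+y. G y * ennreal (\<Prod>j\<in>{..<n}-{i,k}. l j (y j)) \<partial>unweighted n)"
proof -
  have "(\<integral>\<^sup>+y. G y * ennreal (\<Prod>j\<in>{..<n}-{i,k}. l j (y j)) \<partial>unweighted n) =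
      (\<integral>\<^sup>+y. ennreal (1 / (\<Prod>j<n. l j (y j))) * (G y * ennreal (\<Prod>j\<in>{..<n}-{i,k}. l j (y j))) \<partial>marginal n)"
    unfolding unweighted_def by (intro nn_integral_density) measurable
  also have "\<dots> = (\<integral>\<^sup>+y. G y * ennreal (1 / (l i (y i) * l k (y k))) \<partial>marginal n)"
  proof (intro nn_integral_cong)
    fix y
    have "{..<n} = insert i (insert k ({..<n}-{i,k}))" using ik by auto
    then have "(\<Prod>j<n. l j (y j)) = (\<Prod>j\<in>insert i (insert k ({..<n}-{i,k})). l j (y j))" by simp
    also have "\<dots> = l i (y i) * l k (y k) * (\<Prod>j\<in>{..<n}-{i,k}. l j (y j))"
      using ik(3) by simp
    finally have "(\<Prod>j<n. l j (y j)) = l i (y i) * l k (y k) * (\<Prod>j\<in>{..<n}-{i,k}. l j (y j))" .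
    moreover have "(\<Prod>j\<in>{..<n}-{i,k}. l j (y j)) \<noteq> 0" by simp
    ultimately have eq: "1 / (\<Prod>j<n. l j (y j)) * (\<Prod>j\<in>{..<n}-{i,k}. l j (y j)) = 1 / (l i (y i) * l k (y k))"
      by simp
    have "ennreal (1 / (\<Prod>j<n. l j (y j))) * ennreal (\<Prod>j\<in>{..<n}-{i,k}. l j (y j)) =
        ennreal (1 / (l i (y i) * l k (y k)))"
      unfolding eq[symmetric] by (rule ennreal_mult[symmetric]) (auto intro!: prod_nonneg)
    then show "ennreal (1 / (\<Prod>j<n. l j (y j))) * (G y * ennreal (\<Prod>j\<in>{..<n}-{i,k}. l j (y j))) =
        G y * ennreal (1 / (l i (y i) * l k (y k)))"
      by (simp only: mult.left_commute)
  qed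
  also have "\<dots> = (\<integral>\<^sup>+x. G (restrict x {..<n}) * ennreal (1 / (l i (x i) * l k (x k))) \<partial>Q)"
    unfolding marginal_def using ik by (subst nn_integral_distr) auto
  finally show ?thesis ..
qed

lemma swap_cylinder:
  assumes [measurable]: "G \<in> borel_measurable (fin_prod n)" and ik: "i < n" "k < n" "i \<noteq> k"
  shows "(\<integral>\<^sup>+x. G (restrict (x \<circ> Transposition.transpose i k) {..<n}) * ennreal (1 / (l i (x i) * l k (x k))) \<partial>Q) =
    (\<integral>\<^sup>+x. G (restrict x {..<n}) * ennreal (1 / (l i (x i) * l k (x k))) \<partial>Q)"
proof -
  let ?t = "\<lambda>x::nat \<Rightarrow> 'a. \<lambda>j\<in>{..<n}. x (Transposition.transpose i k j)"
  let ?H = "\<lambda>y. ennreal (\<Prod>j\<in>{..<n}-{i,k}. l j (y j))"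
  have perm: "Transposition.transpose i k permutes {..<n}" using ik by (intro permutes_swap_id) auto
  have less: "j < n \<Longrightarrow> Transposition.transpose i k j < n" for j
    using permutes_in_image[OF perm, of j] by simp
  have t_meas[measurable]: "?t \<in> fin_prod n \<rightarrow>\<^sub>M fin_prod n"
    using less by (intro measurable_restrict measurable_component_singleton) auto
  have eq: "restrict (x \<circ> Transposition.transpose i k) {..<n} = ?t (restrict x {..<n})" for x
    using less by (auto simp: fun_eq_iff)
  have H: "?H (?t y) = ?H y" for y
    by (intro arg_cong[where f=ennreal] prod.cong) (auto simp: Transposition.transpose_def)
  have "(\<integral>\<^sup>+x. G (restrict (x \<circ> Transposition.transpose i k) {..<n}) * ennreal (1 / (l i (x i) * l k (x k))) \<partial>Q) =
      (\<integral>\<^sup>+y. G (?t y) * ?H y \<partial>unweighted n)"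
    unfolding eq by (rule nn_integral_unweighted[OF _ ik]) measurable
  also have "\<dots> = (\<integral>\<^sup>+y. G (?t y) * ?H (?t y) \<partial>unweighted n)"
    unfolding H ..
  also have "\<dots> = (\<integral>\<^sup>+y. G y * ?H y \<partial>distr (unweighted n) (fin_prod n) ?t)"
    by (subst nn_integral_distr) measurable
  also have "\<dots> = (\<integral>\<^sup>+x. G (restrict x {..<n}) * ennreal (1 / (l i (x i) * l k (x k))) \<partial>Q)"
    using ik perm by (subst unweighted_permute) (auto simp: nn_integral_unweighted)
  finally show ?thesis .
qed

lemma transpose_meas[measurable]: "(\<lambda>x. x \<circ> Transposition.transpose i k) \<in> inf_prod \<rightarrow>\<^sub>M (inf_prod :: (nat \<Rightarrow> 'a) measure)"
  unfolding comp_def by (rule measurable_PiM_single') (auto simp: space_PiM)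

text \<open>
  The only consequence of weighted exchangeability that is used below: after division by the
  \<open>i\<close>-th and the \<open>k\<close>-th weight, \<open>Q\<close> is invariant under swapping the coordinates \<open>i\<close> and \<open>k\<close>.
\<close>

lemma swap:
  assumes G[measurable]: "G \<in> borel_measurable inf_prod"
  shows "(\<integral>\<^sup>+x. G (x \<circ> Transposition.transpose i k) * ennreal (1 / (l i (x i) * l k (x k))) \<partial>Q) =
    (\<integral>\<^sup>+x. G x * ennreal (1 / (l i (x i) * l k (x k))) \<partial>Q)"
proof (cases "i = k")
  case True then show ?thesis by simp
next
  case False
  \<comment> \<open>multiplying by the symmetric factor \<open>p (x i) * p (x k)\<close> makes the measure finite, so that it is
    determined by its values on cylinders\<close>
  define p where "p y = min 1 (min (l i y) (l k y))" for y
  have [measurable]: "p \<in> borel_measurable borel" unfolding p_def by measurable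
  have p: "0 < p y" "p y \<le> 1" "p y \<le> l i y" "p y \<le> l k y" for y
    using l_pos by (auto simp: p_def)
  define D where "D x = p (x i) * p (x k) * (1 / (l i (x i) * l k (x k)))" for x
  have [measurable]: "D \<in> borel_measurable inf_prod" unfolding D_def by measurable
  have D: "0 \<le> D x" "D x \<le> 1" for x
  proof -
    have "p (x i) * p (x k) \<le> l i (x i) * l k (x k)"
      using p[of "x i"] p[of "x k"] by (intro mult_mono) auto
    then show "D x \<le> 1" using l_pos[of i "x i"] l_pos[of k "x k"] by (simp add: D_def)
    show "0 \<le> D x" using p(1)[of "x i"] p(1)[of "x k"] by (simp add: D_def)
  qed
  define N where "N = density Q (\<lambda>x. ennreal (D x))"
  have sN[simp, measurable_cong]: "sets N = sets inf_prod" by (simp add: N_def)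
  have N_eq: "(\<integral>\<^sup>+x. F x \<partial>N) = (\<integral>\<^sup>+x. (F x * ennreal (p (x i) * p (x k))) * ennreal (1 / (l i (x i) * l k (x k))) \<partial>Q)"
    if [measurable]: "F \<in> borel_measurable inf_prod" for F
  proof -
    have "(\<integral>\<^sup>+x. F x \<partial>N) = (\<integral>\<^sup>+x. ennreal (D x) * F x \<partial>Q)"
      unfolding N_def by (rule nn_integral_density) measurable
    also have "\<dots> = (\<integral>\<^sup>+x. (F x * ennreal (p (x i) * p (x k))) * ennreal (1 / (l i (x i) * l k (x k))) \<partial>Q)"
    proof (intro nn_integral_cong)
      fix x
      have "ennreal (D x) = ennreal (p (x i) * p (x k)) * ennreal (1 / (l i (x i) * l k (x k)))"
        unfolding D_def using p(1)[of "x i"] p(1)[of "x k"] by (intro ennreal_mult) auto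
      then show "ennreal (D x) * F x =
          (F x * ennreal (p (x i) * p (x k))) * ennreal (1 / (l i (x i) * l k (x k)))"
        by (simp only: mult_ac)
    qed
    finally show ?thesis .
  qed
  have "N = distr N inf_prod (\<lambda>x. x \<circ> Transposition.transpose i k)"
  proof (rule measure_eqI_PiM_infinite[where I=UNIV and M="\<lambda>_. borel"])
    show "finite_measure N"
    proof (rule finite_measureI)
      have "emeasure N (space N) = (\<integral>\<^sup>+x. ennreal (D x) \<partial>Q)"
        unfolding N_def using sets.top[of Q] by (subst emeasure_density) auto
      also have "\<dots> \<le> (\<integral>\<^sup>+x. 1 \<partial>Q)"
        using D by (intro nn_integral_mono) simp
      finally show "emeasure N (space N) \<noteq> \<infinity>"
        by (auto simp: emeasure_space_1 top_unique)
    qed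
    fix A :: "nat \<Rightarrow> 'a set" and J assume J: "finite J" "J \<subseteq> UNIV" "\<And>j. j \<in> J \<Longrightarrow> A j \<in> sets borel"
    let ?E = "prod_emb UNIV (\<lambda>_. borel) J (PiE J A)"
    have E_sets[measurable]: "?E \<in> sets inf_prod" using J by (intro sets_PiM_I) auto
    define n where "n = Suc (Max (insert i (insert k J)))"
    have n: "i < n" "k < n" "\<And>j. j \<in> J \<Longrightarrow> j < n"
      using J(1) unfolding n_def less_Suc_eq_le by (auto simp del: Max_insert intro!: Max_ge)
    let ?C = "{y \<in> space (fin_prod n). \<forall>j\<in>J. y j \<in> A j}"
    have C: "?C \<in> sets (fin_prod n)"
      using J n by (intro sets.sets_Collect_finite_All) (auto intro!: measurable_sets_Collect[OF measurable_component_singleton])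
    define G' where "G' y = indicator ?C y * ennreal (p (y i) * p (y k))" for y
    have [measurable]: "i \<in> {..<n}" "k \<in> {..<n}" using n by auto
    have [measurable]: "G' \<in> borel_measurable (fin_prod n)"
      unfolding G'_def using C n by measurable
    have G': "G' (restrict x {..<n}) = indicator ?E x * ennreal (p (x i) * p (x k))" for x
      using n by (auto simp: G'_def prod_emb_iff indicator_def space_PiM PiE_iff)
    have "emeasure (distr N inf_prod (\<lambda>x. x \<circ> Transposition.transpose i k)) ?E =
        (\<integral>\<^sup>+x. indicator ?E x \<partial>distr N inf_prod (\<lambda>x. x \<circ> Transposition.transpose i k))"
      by (subst nn_integral_indicator) auto
    also have "\<dots> = (\<integral>\<^sup>+x. indicator ?E (x \<circ> Transposition.transpose i k) \<partial>N)"
      by (subst nn_integral_distr) auto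
    also have "\<dots> = (\<integral>\<^sup>+x. (indicator ?E (x \<circ> Transposition.transpose i k) * ennreal (p (x i) * p (x k))) *
        ennreal (1 / (l i (x i) * l k (x k))) \<partial>Q)"
      by (rule N_eq) measurable
    also have "\<dots> = (\<integral>\<^sup>+x. G' (restrict (x \<circ> Transposition.transpose i k) {..<n}) * ennreal (1 / (l i (x i) * l k (x k))) \<partial>Q)"
      unfolding G' by (simp add: mult_ac)
    also have "\<dots> = (\<integral>\<^sup>+x. G' (restrict x {..<n}) * ennreal (1 / (l i (x i) * l k (x k))) \<partial>Q)"
      using n False by (intro swap_cylinder) auto
    also have "\<dots> = (\<integral>\<^sup>+x. indicator ?E x \<partial>N)"
      unfolding G' by (rule N_eq[symmetric]) measurable
    also have "\<dots> = emeasure N ?E"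
      by (subst nn_integral_indicator) auto
    finally show "emeasure N ?E = emeasure (distr N inf_prod (\<lambda>x. x \<circ> Transposition.transpose i k)) ?E" ..
  qed auto
  note N_inv = this
  let ?F = "\<lambda>x. G x * ennreal (1 / (p (x i) * p (x k)))"
  have F: "?F x * ennreal (p (x i) * p (x k)) = G x" for x
  proof -
    have "ennreal (1 / (p (x i) * p (x k))) * ennreal (p (x i) * p (x k)) = 1"
      using p(1)[of "x i"] p(1)[of "x k"] by (simp flip: ennreal_mult')
    then show ?thesis by (simp add: mult.assoc)
  qed
  have F': "?F (x \<circ> Transposition.transpose i k) * ennreal (p (x i) * p (x k)) = G (x \<circ> Transposition.transpose i k)" for x
    using F[of "x \<circ> Transposition.transpose i k"] by (simp add: mult.commute)
  have "(\<integral>\<^sup>+x. G (x \<circ> Transposition.transpose i k) * ennreal (1 / (l i (x i) * l k (x k))) \<partial>Q) =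
      (\<integral>\<^sup>+x. ?F (x \<circ> Transposition.transpose i k) \<partial>N)"
    by (subst N_eq) (auto simp only: F', measurable)
  also have "\<dots> = (\<integral>\<^sup>+x. ?F x \<partial>distr N inf_prod (\<lambda>x. x \<circ> Transposition.transpose i k))"
    by (subst nn_integral_distr) auto
  also have "\<dots> = (\<integral>\<^sup>+x. ?F x \<partial>N)" unfolding N_inv[symmetric] ..
  also have "\<dots> = (\<integral>\<^sup>+x. G x * ennreal (1 / (l i (x i) * l k (x k))) \<partial>Q)"
    by (subst N_eq) (auto simp only: F, measurable)
  finally show ?thesis .
qed

end

section \<open>Weighted averages\<close>

text \<open>
  In the intended instance \<open>a i\<close> is the infimum of \<open>l i / w\<close>, \<open>r i\<close> is the quotient of this infimum by
  the supremum, and \<open>v i = a i * w / l i\<close> takes values in \<open>[r i, 1]\<close>. If each coordinate \<open>x i\<close> were kept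
  with probability \<open>v i (x i)\<close>, the kept coordinates would all carry the common weight \<open>w\<close>, and by
  divergence there would be infinitely many of them. Instead of randomizing, the coordinates are
  averaged with the weights \<open>v i (x i)\<close>.
\<close>

locale divergent_process = weighted_exchangeable_process Q l
  for Q :: "(nat \<Rightarrow> 'a::polish_space) measure" and l +
  fixes w :: "'a \<Rightarrow> real" and a r :: "nat \<Rightarrow> real" and v :: "nat \<Rightarrow> 'a \<Rightarrow> real"
  assumes w_weight: "w \<in> weight_functions"
    and a_nonneg: "\<And>i. 0 \<le> a i"
    and v_eq: "\<And>i y. v i y = a i * w y / l i y"
    and r_nonneg: "\<And>i. 0 \<le> r i"
    and r_le_v: "\<And>i y. r i \<le> v i y"
    and v_le_1: "\<And>i y. v i y \<le> 1"
    and diverges: "filterlim (\<lambda>m. \<Sum>k<m. r k) at_top sequentially"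
begin

lemma w_meas[measurable]: "w \<in> borel_measurable borel"
  using w_weight by (simp add: weight_functions_def)

lemma w_pos: "0 < w x"
  using w_weight by (simp add: weight_functions_def)

lemma v_meas[measurable]: "v i \<in> borel_measurable borel"
  unfolding v_eq[abs_def] by measurable

lemma v_nonneg: "0 \<le> v i y"
  using r_nonneg[of i] r_le_v[of i y] by linarith

text \<open>Partial sums of the divergent series, a lower bound for the total averaging weight.\<close>

definition \<rho> :: "nat \<Rightarrow> real" where "\<rho> m = (\<Sum>k<m. r k)"

text \<open>Weighted sums and weighted averages of \<open>f\<close> over the first \<open>m\<close> coordinates. The total weight is at
  least the deterministic number \<open>\<rho> m\<close>; where it is zero, the average is zero by convention.\<close>

definition wsum :: "nat \<Rightarrow> ('a \<Rightarrow> real) \<Rightarrow> (nat \<Rightarrow> 'a) \<Rightarrow> real" where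
  "wsum m f x = (\<Sum>k<m. v k (x k) * f (x k))"

abbreviation wtot :: "nat \<Rightarrow> (nat \<Rightarrow> 'a) \<Rightarrow> real" where
  "wtot m \<equiv> wsum m (\<lambda>_. 1)"

definition wavg :: "nat \<Rightarrow> ('a \<Rightarrow> real) \<Rightarrow> (nat \<Rightarrow> 'a) \<Rightarrow> real" where
  "wavg m f x = wsum m f x / wtot m x"

abbreviation tr :: "nat \<Rightarrow> nat \<Rightarrow> (nat \<Rightarrow> 'a) \<Rightarrow> nat \<Rightarrow> 'a" where
  "tr i k x \<equiv> x \<circ> Transposition.transpose i k"

lemma \<rho>_mono: "m \<le> n \<Longrightarrow> \<rho> m \<le> \<rho> n"
  unfolding \<rho>_def using r_nonneg by (intro sum_mono2) auto

lemma \<rho>_at_top: "filterlim \<rho> at_top sequentially"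
  using diverges by (simp add: \<rho>_def[abs_def])

lemma wsum_meas[measurable]:
  assumes [measurable]: "f \<in> borel_measurable borel"
  shows "wsum m f \<in> borel_measurable inf_prod"
  unfolding wsum_def[abs_def] by measurable

lemma wavg_meas[measurable]:
  assumes [measurable]: "f \<in> borel_measurable borel"
  shows "wavg m f \<in> borel_measurable inf_prod"
  unfolding wavg_def[abs_def] by measurable

lemma wsum_nonneg: "(\<And>y. 0 \<le> f y) \<Longrightarrow> 0 \<le> wsum m f x"
  unfolding wsum_def using v_nonneg by (intro sum_nonneg) auto

lemma wsum_mono: "(\<And>y. f y \<le> g y) \<Longrightarrow> wsum m f x \<le> wsum m g x"
  unfolding wsum_def using v_nonneg by (intro sum_mono mult_left_mono) auto

lemma wtot_ge: "\<rho> m \<le> wtot m x"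
  unfolding \<rho>_def wsum_def using r_le_v by (intro sum_mono) auto

lemma wsum_ge: "(\<And>y. 1 \<le> f y) \<Longrightarrow> \<rho> m \<le> wsum m f x"
  by (rule order_trans[OF wtot_ge wsum_mono])

lemma wavg_bounds: "(\<And>y. 0 \<le> f y \<and> f y \<le> 1) \<Longrightarrow> 0 \<le> wavg m f x \<and> wavg m f x \<le> 1"
  unfolding wavg_def using wsum_nonneg[of f m x] wsum_mono[of f "\<lambda>_. 1" m x]
  by (auto simp: divide_simps intro!: divide_nonneg_nonneg wsum_nonneg)

lemma wsum_add: "wsum m (\<lambda>y. f y + g y) x = wsum m f x + wsum m g x"
  by (simp add: wsum_def distrib_left sum.distrib)

lemma wsum_tr_le:
  assumes f: "\<And>y. 0 \<le> f y \<and> f y \<le> 2"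
  shows "wsum m f (tr i k x) \<le> wsum m f x + 4"
proof -
  let ?t = "\<lambda>x j. v j (x j) * f (x j)"
  have t: "0 \<le> ?t x j" "?t x j \<le> 2" for x j
    using v_nonneg[of j "x j"] v_le_1[of j "x j"] f[of "x j"] mult_mono[of "v j (x j)" 1 "f (x j)" 2] by auto
  have split: "wsum m f x = sum (?t x) ({..<m} - {i,k}) + sum (?t x) ({..<m} \<inter> {i,k})" for x
    unfolding wsum_def using sum.Int_Diff[of "{..<m}" "?t x" "{i,k}"] by simp
  have "sum (?t (tr i k x)) ({..<m} - {i,k}) = sum (?t x) ({..<m} - {i,k})"
    by (intro sum.cong) (auto simp: Transposition.transpose_def)
  moreover have "sum (?t (tr i k x)) ({..<m} \<inter> {i,k}) \<le> 4"
  proof -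
    have "sum (?t (tr i k x)) ({..<m} \<inter> {i,k}) \<le> (\<Sum>j\<in>{..<m} \<inter> {i,k}. 2)"
      by (intro sum_mono t)
    also have "\<dots> = 2 * real (card ({..<m} \<inter> {i,k}))" by simp
    also have "card ({..<m} \<inter> {i,k}) \<le> card {i,k}" by (intro card_mono) auto
    also have "card {i,k} \<le> 2" by (simp add: card_insert_if)
    finally show ?thesis by simp
  qed
  moreover have "0 \<le> sum (?t x) ({..<m} \<inter> {i,k})" by (intro sum_nonneg t)
  ultimately show ?thesis using split[of "tr i k x"] split[of x] by linarith
qed

text \<open>The factor by which a swap of two coordinates can change a weighted sum of a function with
  values in \<open>[1, 2]\<close>; it tends to 1.\<close>

definition c :: "nat \<Rightarrow> real" where "c m = 1 + 4 / \<rho> m"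

lemma tr_tr[simp]: "tr i k (tr i k x) = x"
  by (simp add: comp_assoc)

lemma c_ge_1: "0 < \<rho> m \<Longrightarrow> 1 \<le> c m"
  by (simp add: c_def)

lemma wsum_tr_mult:
  assumes f: "\<And>y. 1 \<le> f y \<and> f y \<le> 2" and \<rho>: "0 < \<rho> m" "m \<le> n"
  shows "wsum n f (tr i k x) \<le> c m * wsum n f x" "wsum n f x \<le> c m * wsum n f (tr i k x)"
proof -
  have *: "wsum n f (tr i k x) \<le> c m * wsum n f x" for x
  proof -
    have "\<rho> m \<le> wsum n f x"
      using wsum_ge[of f n x] f \<rho>_mono[OF \<rho>(2)] by fastforce
    then have "4 \<le> 4 / \<rho> m * wsum n f x"
      using \<rho> by (simp add: field_simps)
    moreover have "wsum n f (tr i k x) \<le> wsum n f x + 4"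
      using f by (intro wsum_tr_le) (meson order_trans zero_le_one)
    ultimately show ?thesis by (simp add: c_def distrib_right)
  qed
  show "wsum n f (tr i k x) \<le> c m * wsum n f x" by (rule *)
  show "wsum n f x \<le> c m * wsum n f (tr i k x)" using *[of "tr i k x"] by simp
qed

lemma inv_wtot_tr:
  assumes \<rho>: "0 < \<rho> m" "m \<le> n"
  shows "1 / wtot n (tr i k x) \<le> c m * (1 / wtot n x)"
proof -
  have "0 < wtot n y" for y using wtot_ge[of n y] \<rho>_mono[OF \<rho>(2)] \<rho>(1) by linarith
  with wsum_tr_mult(2)[of "\<lambda>_. 1" m n x i k] \<rho> show ?thesis by (simp add: field_simps)
qed

lemma c_tendsto: "c \<longlonglongrightarrow> 1"
proof -
  have "(\<lambda>m. 1 + 4 / \<rho> m) \<longlonglongrightarrow> 1 + 0"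
    by (intro tendsto_add tendsto_const tendsto_divide_0[OF tendsto_const] filterlim_at_top_imp_at_infinity \<rho>_at_top)
  then show ?thesis by (simp add: c_def[abs_def])
qed

text \<open>Up to the constant \<open>a i\<close> these are the averaging weights \<open>v i\<close>; they never vanish.\<close>

definition u :: "nat \<Rightarrow> 'a \<Rightarrow> real" where "u i y = w y / l i y"

lemma u_meas[measurable]: "u i \<in> borel_measurable borel"
  unfolding u_def[abs_def] by measurable

lemma u_pos: "0 < u i y"
  using w_pos l_pos by (simp add: u_def)

lemma v_eq_u: "v i y = a i * u i y"
  by (simp add: v_eq u_def)

lemma swap_u:
  assumes [measurable]: "G \<in> borel_measurable inf_prod"
  shows "(\<integral>\<^sup>+x. ennreal (u i (x i) * u k (x k)) * G (tr i k x) \<partial>Q) =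
    (\<integral>\<^sup>+x. ennreal (u i (x i) * u k (x k)) * G x \<partial>Q)"
proof -
  have eq: "ennreal (u i (x i) * u k (x k)) =
      ennreal (w (x i) * w (x k)) * ennreal (1 / (l i (x i) * l k (x k)))" for x
    by (subst ennreal_mult[symmetric])
       (use w_pos in \<open>auto simp: u_def less_imp_le intro!: mult_nonneg_nonneg\<close>)
  let ?G = "\<lambda>x. G x * ennreal (w (x i) * w (x k))"
  have "(\<integral>\<^sup>+x. ennreal (u i (x i) * u k (x k)) * G (tr i k x) \<partial>Q) =
      (\<integral>\<^sup>+x. ?G (tr i k x) * ennreal (1 / (l i (x i) * l k (x k))) \<partial>Q)"
    unfolding eq by (simp add: mult_ac)
  also have "\<dots> = (\<integral>\<^sup>+x. ?G x * ennreal (1 / (l i (x i) * l k (x k))) \<partial>Q)"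
    by (rule swap) measurable
  also have "\<dots> = (\<integral>\<^sup>+x. ennreal (u i (x i) * u k (x k)) * G x \<partial>Q)"
    unfolding eq by (simp add: mult_ac)
  finally show ?thesis .
qed

lemma swap_v:
  assumes [measurable]: "G \<in> borel_measurable inf_prod"
  shows "(\<integral>\<^sup>+x. ennreal (v i (x i) * v k (x k)) * G (tr i k x) \<partial>Q) =
    (\<integral>\<^sup>+x. ennreal (v i (x i) * v k (x k)) * G x \<partial>Q)"
proof -
  have "ennreal (v i (x i) * v k (x k)) * g = ennreal (u i (x i) * u k (x k)) * (ennreal (a i * a k) * g)" for x g
  proof -
    have "v i (x i) * v k (x k) = (u i (x i) * u k (x k)) * (a i * a k)"
      by (simp add: v_eq_u)
    moreover have "0 \<le> u i (x i) * u k (x k)"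
      using u_pos[of i "x i"] u_pos[of k "x k"] by simp
    ultimately have "ennreal (v i (x i) * v k (x k)) = ennreal (u i (x i) * u k (x k)) * ennreal (a i * a k)"
      using a_nonneg by (simp only:, intro ennreal_mult) auto
    then show ?thesis by (simp add: mult.assoc)
  qed
  then show ?thesis
    using swap_u[of "\<lambda>x. ennreal (a i * a k) * G x" i k] by simp
qed

text \<open>
  In the integral of a product of two weighted sums, the two functions may be interchanged if the
  remaining factor \<open>U\<close> is nearly invariant under swaps: expand the product and swap coordinates \<open>i\<close>
  and \<open>k\<close> in each summand.
\<close>

lemma swap_sums:
  assumes [measurable]: "f1 \<in> borel_measurable borel" "f2 \<in> borel_measurable borel" "U \<in> borel_measurable inf_prod"
    and f: "\<And>y. 0 \<le> f1 y" "\<And>y. 0 \<le> f2 y" and U_nonneg: "\<And>x. 0 \<le> U x" and d: "0 \<le> d"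
    and U: "\<And>i k x. i < m \<Longrightarrow> k < n \<Longrightarrow> U (tr i k x) \<le> d * U x"
  shows "(\<integral>\<^sup>+x. ennreal (wsum m f1 x * wsum n f2 x * U x) \<partial>Q) \<le>
    ennreal d * (\<integral>\<^sup>+x. ennreal (wsum m f2 x * wsum n f1 x * U x) \<partial>Q)"
proof -
  have expand: "(\<integral>\<^sup>+x. ennreal (wsum m f x * wsum n g x * U x) \<partial>Q) =
      (\<Sum>i<m. \<Sum>k<n. \<integral>\<^sup>+x. ennreal (v i (x i) * v k (x k)) * ennreal (f (x i) * g (x k) * U x) \<partial>Q)"
    if [measurable]: "f \<in> borel_measurable borel" "g \<in> borel_measurable borel"
      and fg: "\<And>y. 0 \<le> f y" "\<And>y. 0 \<le> g y" for f g
  proof -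
    have "ennreal (wsum m f x * wsum n g x * U x) =
      (\<Sum>i<m. \<Sum>k<n. ennreal (v i (x i) * v k (x k)) * ennreal (f (x i) * g (x k) * U x))" for x
    proof -
      have "wsum m f x * wsum n g x * U x = (\<Sum>i<m. \<Sum>k<n. (v i (x i) * v k (x k)) * (f (x i) * g (x k) * U x))"
        unfolding wsum_def by (simp only: sum_product, simp only: sum_distrib_right)
          (intro sum.cong refl, simp add: mult_ac)
      then show ?thesis
        using v_nonneg fg U_nonneg
        by (simp add: sum_nonneg ennreal_mult' flip: sum_ennreal)
    qed
    then show ?thesis by (simp add: nn_integral_sum)
  qed
  have "(\<integral>\<^sup>+x. ennreal (v i (x i) * v k (x k)) * ennreal (f1 (x i) * f2 (x k) * U x) \<partial>Q) \<le>
      ennreal d * (\<integral>\<^sup>+x. ennreal (v i (x i) * v k (x k)) * ennreal (f2 (x i) * f1 (x k) * U x) \<partial>Q)"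
    if ik: "i < m" "k < n" for i k
  proof -
    have "(\<integral>\<^sup>+x. ennreal (v i (x i) * v k (x k)) * ennreal (f1 (x i) * f2 (x k) * U x) \<partial>Q) =
        (\<integral>\<^sup>+x. ennreal (v i (x i) * v k (x k)) * ennreal (f1 (tr i k x i) * f2 (tr i k x k) * U (tr i k x)) \<partial>Q)"
      by (rule swap_v[symmetric]) measurable
    also have "\<dots> = (\<integral>\<^sup>+x. ennreal (v i (x i) * v k (x k)) * ennreal (f2 (x i) * f1 (x k) * U (tr i k x)) \<partial>Q)"
      by (simp add: mult_ac)
    also have "\<dots> \<le> (\<integral>\<^sup>+x. ennreal d * (ennreal (v i (x i) * v k (x k)) * ennreal (f2 (x i) * f1 (x k) * U x)) \<partial>Q)"
    proof (rule nn_integral_mono)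
      fix x
      have "f2 (x i) * f1 (x k) * U (tr i k x) \<le> f2 (x i) * f1 (x k) * (d * U x)"
        using U[OF ik] f by (intro mult_left_mono) auto
      then have "ennreal (f2 (x i) * f1 (x k) * U (tr i k x)) \<le> ennreal d * ennreal (f2 (x i) * f1 (x k) * U x)"
        using d by (simp flip: ennreal_mult' add: ennreal_leI mult_ac)
      then show "ennreal (v i (x i) * v k (x k)) * ennreal (f2 (x i) * f1 (x k) * U (tr i k x)) \<le>
         ennreal d * (ennreal (v i (x i) * v k (x k)) * ennreal (f2 (x i) * f1 (x k) * U x))"
        by (simp only: mult.left_commute[of "ennreal d"]) (rule mult_left_mono, auto)
    qed
    also have "\<dots> = ennreal d * (\<integral>\<^sup>+x. ennreal (v i (x i) * v k (x k)) * ennreal (f2 (x i) * f1 (x k) * U x) \<partial>Q)"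
      by (rule nn_integral_cmult) measurable
    finally show ?thesis .
  qed
  then show ?thesis
    using f by (auto simp: expand sum_distrib_left intro!: sum_mono)
qed

end

section \<open>Convergence of the weighted averages\<close>

context divergent_process begin

lemma integrable_bounded:
  fixes g :: "(nat \<Rightarrow> 'a) \<Rightarrow> real"
  assumes "g \<in> borel_measurable inf_prod" "\<And>x. 0 \<le> g x \<and> g x \<le> b"
  shows "integrable Q g"
  using assms by (intro integrable_const_bound[where B=b]) auto

lemma integral_le_of_nn_integral_le:
  fixes g h :: "(nat \<Rightarrow> 'a) \<Rightarrow> real"
  assumes "g \<in> borel_measurable inf_prod" "h \<in> borel_measurable inf_prod"
    and "\<And>x. 0 \<le> g x \<and> g x \<le> b" "\<And>x. 0 \<le> h x \<and> h x \<le> b'" and d: "0 \<le> d"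
    and le: "(\<integral>\<^sup>+x. ennreal (g x) \<partial>Q) \<le> ennreal d * (\<integral>\<^sup>+x. ennreal (h x) \<partial>Q)"
  shows "(\<integral>x. g x \<partial>Q) \<le> d * (\<integral>x. h x \<partial>Q)"
proof -
  have "integrable Q g" "integrable Q h" using assms integrable_bounded by blast+
  with le show ?thesis
    using assms by (simp add: nn_integral_eq_integral ennreal_mult'[symmetric])
qed

lemma pos_mult_le_4:
  fixes c :: real
  assumes "0 \<le> x'" "0 \<le> y'" "0 \<le> z'" "0 \<le> t'" "0 \<le> c" "0 \<le> x" "0 \<le> y" "0 \<le> z" "0 \<le> t"
    "x' \<le> c * x" "y' \<le> c * y" "z' \<le> c * z" "t' \<le> c * t"
  shows "x' * y' * z' * t' \<le> c^4 * (x * y * z * t)"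
proof -
  have "x' * y' * z' * t' \<le> (c * x) * (c * y) * (c * z) * (c * t)"
    using assms by (intro mult_mono mult_nonneg_nonneg) auto
  also have "\<dots> = c^4 * (x * y * z * t)" by (simp add: power4_eq_xxxx)
  finally show ?thesis .
qed

lemma wavg_bounds_2:
  assumes f: "\<And>y. 1 \<le> f y \<and> f y \<le> 2" and \<rho>: "0 < \<rho> k"
  shows "0 \<le> wavg k f x \<and> wavg k f x \<le> 2"
proof -
  have "0 < wtot k x" using wtot_ge[of k x] \<rho> by linarith
  moreover have "wsum k f x \<le> wsum k (\<lambda>_. 1 + 1) x" using f by (intro wsum_mono) auto
  moreover have "\<rho> k \<le> wsum k f x" using f by (intro wsum_ge) auto
  ultimately show ?thesis using \<rho> unfolding wsum_add by (auto simp: wavg_def field_simps)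
qed

text \<open>
  The average over the first \<open>m\<close> coordinates behaves approximately like a reverse martingale: tested
  against the average over the first \<open>n \<ge> m\<close> coordinates, which is nearly symmetric in them, it may be
  replaced by that average. Values in \<open>[1, 2]\<close> allow all errors to be multiplicative.
\<close>

lemma wavg_times_swap:
  assumes f_meas[measurable]: "f \<in> borel_measurable borel" and f: "\<And>y. 1 \<le> f y \<and> f y \<le> 2"
    and mn: "0 < \<rho> m" "m \<le> n"
  shows "(\<integral>x. wavg m f x * wavg n f x \<partial>Q) \<le> c m ^ 4 * (\<integral>x. (wavg n f x)\<^sup>2 \<partial>Q)"
    and "(\<integral>x. (wavg n f x)\<^sup>2 \<partial>Q) \<le> c m ^ 4 * (\<integral>x. wavg m f x * wavg n f x \<partial>Q)"
proof -
  define U where "U x = wsum n f x * (1 / wtot m x) * (1 / wtot n x) * (1 / wtot n x)" for x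
  have U_meas[measurable]: "U \<in> borel_measurable inf_prod" unfolding U_def by measurable
  have f0: "0 \<le> f y" for y using f[of y] by linarith
  have pos: "0 < wtot m x" "0 < wtot n x" for x
    using wtot_ge[of m x] wtot_ge[of n x] \<rho>_mono[OF mn(2)] mn(1) by linarith+
  have S0: "0 \<le> wsum j f x" for j x by (intro wsum_nonneg f0)
  have U0: "0 \<le> U x" for x using pos[of x] S0[of n x] by (simp add: U_def)
  have c0: "0 \<le> c m" using c_ge_1[OF mn(1)] by simp
  have U: "U (tr i k x) \<le> c m ^ 4 * U x" for i k x
    unfolding U_def using pos S0 c0 wsum_tr_mult(1)[of f m n x i k] f mn
      inv_wtot_tr[of m n x i k] inv_wtot_tr[of m m x i k]
    by (intro pos_mult_le_4) (auto simp: less_imp_le)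
  have avg: "0 \<le> wavg k f x \<and> wavg k f x \<le> 2" if "0 < \<rho> k" for k x
    using that f by (intro wavg_bounds_2) auto
  have \<rho>n: "0 < \<rho> n" using \<rho>_mono[OF mn(2)] mn(1) by linarith
  have b1: "0 \<le> wavg m f x * wavg n f x \<and> wavg m f x * wavg n f x \<le> 2 * 2" for x
    using avg[OF mn(1), of x] avg[OF \<rho>n, of x] by (intro conjI mult_mono mult_nonneg_nonneg) auto
  have b2: "0 \<le> (wavg n f x)\<^sup>2 \<and> (wavg n f x)\<^sup>2 \<le> 2 * 2" for x
    unfolding power2_eq_square
    using avg[OF \<rho>n, of x] by (intro conjI mult_mono mult_nonneg_nonneg) auto
  have e1: "wsum m f x * wsum n (\<lambda>_. 1) x * U x = wavg m f x * wavg n f x" for x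
    using pos[of x] by (simp add: U_def wavg_def)
  have e2: "wsum m (\<lambda>_. 1) x * wsum n f x * U x = (wavg n f x)\<^sup>2" for x
    using pos[of x] by (simp add: U_def wavg_def power2_eq_square)
  have c4: "0 \<le> c m ^ 4" using c0 by simp
  show "(\<integral>x. wavg m f x * wavg n f x \<partial>Q) \<le> c m ^ 4 * (\<integral>x. (wavg n f x)\<^sup>2 \<partial>Q)"
    using swap_sums[of f "\<lambda>_. 1" U "c m ^ 4" m n] f0 U0 U c4 unfolding e1 e2
    by (intro integral_le_of_nn_integral_le[OF _ _ b1 b2 c4]) auto
  show "(\<integral>x. (wavg n f x)\<^sup>2 \<partial>Q) \<le> c m ^ 4 * (\<integral>x. wavg m f x * wavg n f x \<partial>Q)"
    using swap_sums[of "\<lambda>_. 1" f U "c m ^ 4" m n] f0 U0 U c4 unfolding e1 e2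
    by (intro integral_le_of_nn_integral_le[OF _ _ b2 b1 c4]) auto
qed

lemma wavg_mean_le:
  assumes [measurable]: "f \<in> borel_measurable borel" and f: "\<And>y. 0 \<le> f y \<and> f y \<le> 1"
    and mn: "0 < \<rho> m" "m \<le> n"
  shows "(\<integral>x. wavg n f x \<partial>Q) \<le> c m ^ 2 * (\<integral>x. wavg m f x \<partial>Q)"
proof -
  define U where "U x = (1 / wtot m x) * (1 / wtot n x)" for x
  have U_meas[measurable]: "U \<in> borel_measurable inf_prod" unfolding U_def by measurable
  have pos: "0 < wtot m x" "0 < wtot n x" for x
    using wtot_ge[of m x] wtot_ge[of n x] \<rho>_mono[OF mn(2)] mn(1) by linarith+
  have U0: "0 \<le> U x" for x using pos[of x] by (simp add: U_def)
  have c0: "0 \<le> c m" using c_ge_1[OF mn(1)] by simp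
  have U: "U (tr i k x) \<le> c m ^ 2 * U x" for i k x
  proof -
    have "U (tr i k x) \<le> (c m * (1 / wtot m x)) * (c m * (1 / wtot n x))"
      unfolding U_def using pos c0 inv_wtot_tr[of m n x i k] inv_wtot_tr[of m m x i k] mn
      by (intro mult_mono) (auto simp: less_imp_le)
    then show ?thesis by (simp add: U_def power2_eq_square)
  qed
  have avg01: "0 \<le> wavg k f x \<and> wavg k f x \<le> 1" for k x
    by (rule wavg_bounds) (rule f)
  have e1: "wsum m (\<lambda>_. 1) x * wsum n f x * U x = wavg n f x" for x
    using pos[of x] by (simp add: U_def wavg_def)
  have e2: "wsum m f x * wsum n (\<lambda>_. 1) x * U x = wavg m f x" for x
    using pos[of x] by (simp add: U_def wavg_def)
  show ?thesis
    using swap_sums[of "\<lambda>_. 1" f U "c m ^ 2" m n] f U0 U c0 unfolding e1 e2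
    by (intro integral_le_of_nn_integral_le[OF _ _ avg01 avg01]) auto
qed

lemma eventually_\<rho>_pos: "\<exists>M. \<forall>m\<ge>M. 0 < \<rho> m"
  using filterlim_at_top_dense[THEN iffD1, OF \<rho>_at_top, rule_format, of 0]
  by (simp add: eventually_sequentially)

lemma wavg_add: "wavg m (\<lambda>y. f y + g y) x = wavg m f x + wavg m g x"
  by (simp add: wavg_def wsum_add add_divide_distrib)

lemma wavg_1: "0 < \<rho> m \<Longrightarrow> wavg m (\<lambda>_. 1) x = 1"
  using wtot_ge[of m x] by (simp add: wavg_def)

text \<open>The second moments of the averages are decreasing up to the error \<open>d m\<close>, hence converge, and
  their increments dominate the squared \<open>L\<^sup>2\<close> distances of the averages.\<close>

lemma wavg_L1_Cauchy:
  assumes B[measurable]: "B \<in> sets borel" and e: "0 < (\<epsilon>::real)"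
  shows "\<exists>N. \<forall>m\<ge>N. \<forall>n\<ge>N. (\<integral>x. \<bar>wavg m (indicator B) x - wavg n (indicator B) x\<bar> \<partial>Q) \<le> \<epsilon>"
proof -
  obtain M where M: "\<And>m. m \<ge> M \<Longrightarrow> 0 < \<rho> m" using eventually_\<rho>_pos by auto
  \<comment> \<open>the shift by 1 moves the values into \<open>[1, 2]\<close> and cancels in differences of averages\<close>
  define f where "f y = (1 + indicator B y :: real)" for y
  have [measurable]: "f \<in> borel_measurable borel" unfolding f_def by measurable
  have f: "1 \<le> f y \<and> f y \<le> (2::real)" for y by (auto simp: f_def indicator_def)
  note avg = wavg_times_swap[OF \<open>f \<in> borel_measurable borel\<close> f]
  define e where "e n = (if n \<ge> M then (\<integral>x. (wavg n f x)\<^sup>2 \<partial>Q) else 0)" for n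
  define d where "d m = 8 * (1 - 1 / c m ^ 4)" for m
  have d: "d \<longlonglongrightarrow> 0"
  proof -
    have "(\<lambda>m. 8 * (1 - 1 / c m ^ 4)) \<longlonglongrightarrow> 8 * (1 - 1 / 1 ^ 4)"
      by (intro tendsto_intros c_tendsto) simp
    then show ?thesis by (simp add: d_def[abs_def])
  qed
  have b: "0 \<le> wavg n f x" "wavg n f x \<le> 2" if "n \<ge> M" for n x
    using wavg_bounds_2[of f n x, OF _ M[OF that]] f by blast+
  have bb: "wavg m f x * wavg n f x \<le> 2 * 2" "0 \<le> wavg m f x * wavg n f x" if "m \<ge> M" "n \<ge> M" for m n x
    using b[OF that(1), of x] b[OF that(2), of x] by (intro mult_mono mult_nonneg_nonneg; simp)+
  have int[simp]: "integrable Q (\<lambda>x. wavg m f x * wavg n f x)" if "m \<ge> M" "n \<ge> M" for m n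
    using bb[OF that] by (intro integrable_bounded[where b="2*2"]) auto
  have int2[simp]: "integrable Q (\<lambda>x. (wavg n f x)\<^sup>2)" if "n \<ge> M" for n
    using int[OF that that] by (simp add: power2_eq_square)
  have e0: "0 \<le> e n" for n by (simp add: e_def)
  have e4: "e n \<le> 4" for n
  proof (cases "n \<ge> M")
    case True
    have "(\<integral>x. (wavg n f x)\<^sup>2 \<partial>Q) \<le> (\<integral>x. 4 \<partial>Q)"
      using bb(1)[OF True True] int2[OF True] by (intro integral_mono) (auto simp: power2_eq_square)
    then show ?thesis using True by (simp add: e_def prob_space[simplified])
  qed (simp add: e_def)
  have D: "(\<integral>x. (wavg m f x - wavg n f x)\<^sup>2 \<partial>Q) \<le> e m - e n + d m" if mn: "M \<le> m" "m \<le> n" for m n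
  proof -
    have n: "M \<le> n" using mn by simp
    have "(\<integral>x. (wavg m f x - wavg n f x)\<^sup>2 \<partial>Q) =
        (\<integral>x. (wavg m f x)\<^sup>2 + (wavg n f x)\<^sup>2 - 2 * (wavg m f x * wavg n f x) \<partial>Q)"
      by (intro Bochner_Integration.integral_cong refl) (simp add: power2_diff)
    also have "\<dots> = e m + e n - 2 * (\<integral>x. wavg m f x * wavg n f x \<partial>Q)"
      using mn n by (simp add: e_def)
    also have "\<dots> \<le> e m + e n - 2 * (e n / c m ^ 4)"
    proof -
      have "0 < c m ^ 4" using c_ge_1[OF M[OF mn(1)]] by simp
      then have "e n / c m ^ 4 \<le> (\<integral>x. wavg m f x * wavg n f x \<partial>Q)"
        using avg(2)[OF M[OF mn(1)] mn(2)] n by (simp add: e_def field_simps)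
      then show ?thesis by linarith
    qed
    also have "\<dots> = e m - e n + 2 * (1 - 1 / c m ^ 4) * e n"
      by (simp add: algebra_simps)
    also have "2 * (1 - 1 / c m ^ 4) * e n \<le> 2 * (1 - 1 / c m ^ 4) * 4"
    proof -
      have "1 \<le> c m ^ 4" using c_ge_1[OF M[OF mn(1)]] by simp
      then have "1 / c m ^ 4 \<le> 1" by (subst divide_le_eq_1_pos) linarith+
      then show ?thesis using e4[of n] by (intro mult_left_mono) simp_all
    qed
    finally show ?thesis by (simp add: d_def)
  qed
  have "e n \<le> e m + d m" if "m \<le> n" "M \<le> m" for m n
  proof -
    have "0 \<le> (\<integral>x. (wavg m f x - wavg n f x)\<^sup>2 \<partial>Q)" by simp
    then show ?thesis using D[OF that(2,1)] by linarith
  qed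
  then have "convergent e"
    by (intro almost_decreasing_convergent[OF e0 e4 _ d, of M]) auto
  then have "Cauchy e" by (simp add: Cauchy_convergent_iff)
  then obtain N1 where N1: "\<And>m n. m \<ge> N1 \<Longrightarrow> n \<ge> N1 \<Longrightarrow> \<bar>e m - e n\<bar> < \<epsilon>\<^sup>2 / 2"
    using CauchyD[of e "\<epsilon>\<^sup>2 / 2"] e by fastforce
  obtain N2 where N2: "\<And>m. m \<ge> N2 \<Longrightarrow> \<bar>d m\<bar> < \<epsilon>\<^sup>2 / 2"
    using LIMSEQ_D[OF d, of "\<epsilon>\<^sup>2 / 2"] e by fastforce
  define N where "N = max M (max N1 N2)"
  have main: "(\<integral>x. \<bar>wavg m (indicator B) x - wavg n (indicator B) x\<bar> \<partial>Q) \<le> \<epsilon>"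
    if mn: "m \<ge> N" "m \<le> n" for m n
  proof -
    have ge: "M \<le> m" "M \<le> n" "N1 \<le> m" "N1 \<le> n" "N2 \<le> m" using mn by (auto simp: N_def)
    let ?X = "\<lambda>x. \<bar>wavg m f x - wavg n f x\<bar>"
    have eq: "\<bar>wavg m (indicator B) x - wavg n (indicator B) x\<bar> = ?X x" for x
      using M[OF ge(1)] M[OF ge(2)] by (simp add: f_def[abs_def] wavg_add wavg_1)
    have X2: "0 \<le> ?X x \<and> ?X x \<le> 2" for x
      using b[OF ge(1), of x] b[OF ge(2), of x] by auto
    have "(?X x)\<^sup>2 \<le> 2\<^sup>2" for x using X2[of x] by (intro power_mono) auto
    then have "integrable Q (\<lambda>x. (?X x)\<^sup>2)"
      by (intro integrable_bounded[where b="2\<^sup>2"]) auto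
    moreover have "integrable Q ?X" by (rule integrable_bounded[OF _ X2]) measurable
    ultimately have "(\<integral>x. ?X x \<partial>Q)\<^sup>2 \<le> (\<integral>x. (?X x)\<^sup>2 \<partial>Q)"
      using variance_eq[of ?X] variance_positive[of ?X] by simp
    also have "\<dots> \<le> e m - e n + d m" using D[OF ge(1) mn(2)] by simp
    also have "\<dots> \<le> \<epsilon>\<^sup>2" using N1[OF ge(3,4)] N2[OF ge(5)] by linarith
    finally have "(\<integral>x. ?X x \<partial>Q) \<le> \<epsilon>" using e by (meson less_imp_le power2_le_imp_le)
    then show ?thesis unfolding eq .
  qed
  show ?thesis
  proof (intro exI[of _ N] allI impI)
    fix m n assume "N \<le> m" "N \<le> n"
    then show "(\<integral>x. \<bar>wavg m (indicator B) x - wavg n (indicator B) x\<bar> \<partial>Q) \<le> \<epsilon>"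
      using main[of m n] main[of n m] by (cases "m \<le> n") (simp_all add: abs_minus_commute)
  qed
qed


lemma ind_bounds: "0 \<le> (indicator B y :: real) \<and> (indicator B y :: real) \<le> 1"
  by (simp add: indicator_def)

lemma wavg_ind_bounds: "0 \<le> wavg m (indicator B) x \<and> wavg m (indicator B) x \<le> 1"
  by (rule wavg_bounds) (rule ind_bounds)

lemma wavg_limit_exists:
  assumes B: "B \<in> sets borel"
  shows "\<exists>L s. L \<in> borel_measurable Q \<and> (\<forall>x. 0 \<le> L x \<and> L x \<le> 1) \<and> strict_mono (s :: nat \<Rightarrow> nat) \<and>
    (AE x in Q. (\<lambda>j. wavg (s j) (indicator B) x) \<longlonglongrightarrow> L x) \<and>
    (\<lambda>n. \<integral>x. \<bar>wavg n (indicator B) x - L x\<bar> \<partial>Q) \<longlonglongrightarrow> 0"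
  using B wavg_ind_bounds wavg_L1_Cauchy[OF B] by (intro L1_Cauchy_limit) auto

text \<open>The limiting weighted frequency of a Borel set: an \<open>L\<^sup>1\<close> limit of the weighted averages of its
  indicator, and an almost sure limit along a subsequence that may depend on the set. It is set to
  zero for sets that are not Borel.\<close>

definition lim_avg :: "'a set \<Rightarrow> (nat \<Rightarrow> 'a) \<Rightarrow> real" where
  "lim_avg B = (if B \<in> sets borel then (SOME L. L \<in> borel_measurable Q \<and> (\<forall>x. 0 \<le> L x \<and> L x \<le> 1) \<and>
    (\<exists>s :: nat \<Rightarrow> nat. strict_mono s \<and> (AE x in Q. (\<lambda>j. wavg (s j) (indicator B) x) \<longlonglongrightarrow> L x)) \<and>
    (\<lambda>n. \<integral>x. \<bar>wavg n (indicator B) x - L x\<bar> \<partial>Q) \<longlonglongrightarrow> 0) else (\<lambda>_. 0))"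

lemma lim_avg_props:
  assumes B: "B \<in> sets borel"
  shows "lim_avg B \<in> borel_measurable Q" "\<exists>s :: nat \<Rightarrow> nat. strict_mono s \<and> (AE x in Q. (\<lambda>j. wavg (s j) (indicator B) x) \<longlonglongrightarrow> lim_avg B x)"
    "(\<lambda>n. \<integral>x. \<bar>wavg n (indicator B) x - lim_avg B x\<bar> \<partial>Q) \<longlonglongrightarrow> 0"
    "\<forall>x. 0 \<le> lim_avg B x \<and> lim_avg B x \<le> 1"
proof -
  let ?P = "\<lambda>L. L \<in> borel_measurable Q \<and> (\<forall>x. 0 \<le> L x \<and> L x \<le> 1) \<and>
    (\<exists>s :: nat \<Rightarrow> nat. strict_mono s \<and> (AE x in Q. (\<lambda>j. wavg (s j) (indicator B) x) \<longlonglongrightarrow> L x)) \<and>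
    (\<lambda>n. \<integral>x. \<bar>wavg n (indicator B) x - L x\<bar> \<partial>Q) \<longlonglongrightarrow> 0"
  have "\<exists>L. ?P L" using wavg_limit_exists[OF B] by meson
  then have "?P (SOME L. ?P L)" by (rule someI_ex)
  moreover have "lim_avg B = (SOME L. ?P L)" using B by (simp add: lim_avg_def)
  ultimately have "?P (lim_avg B)" by simp
  then show "lim_avg B \<in> borel_measurable Q" "\<exists>s :: nat \<Rightarrow> nat. strict_mono s \<and> (AE x in Q. (\<lambda>j. wavg (s j) (indicator B) x) \<longlonglongrightarrow> lim_avg B x)"
    "(\<lambda>n. \<integral>x. \<bar>wavg n (indicator B) x - lim_avg B x\<bar> \<partial>Q) \<longlonglongrightarrow> 0"
    "\<forall>x. 0 \<le> lim_avg B x \<and> lim_avg B x \<le> 1" by blast+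
qed

lemma lim_avg_bounds: "0 \<le> lim_avg B x \<and> lim_avg B x \<le> 1"
  using lim_avg_props(4)[of B] by (cases "B \<in> sets borel") (auto simp: lim_avg_def)

lemma lim_avg_meas[measurable]: "B \<in> sets borel \<Longrightarrow> lim_avg B \<in> borel_measurable inf_prod"
  using lim_avg_props(1)[of B] by simp

lemma integrable_lim_avg[simp]: "B \<in> sets borel \<Longrightarrow> integrable Q (lim_avg B)"
  by (rule integrable_bounded[OF _ lim_avg_bounds]) auto

lemma integrable_wavg[simp]: "B \<in> sets borel \<Longrightarrow> integrable Q (wavg n (indicator B))"
  by (rule integrable_bounded[OF _ wavg_ind_bounds]) auto

lemma AE_zero_of_L1_bound:
  fixes h :: "(nat \<Rightarrow> 'a) \<Rightarrow> real"
  assumes h: "integrable Q h" and b: "\<forall>\<^sub>F n in sequentially. (\<integral>x. \<bar>h x\<bar> \<partial>Q) \<le> b n" and lim: "b \<longlonglongrightarrow> 0"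
  shows "AE x in Q. h x = 0"
proof -
  have "(\<integral>x. \<bar>h x\<bar> \<partial>Q) \<le> 0"
    by (rule tendsto_lowerbound[OF lim b]) simp
  moreover have "0 \<le> (\<integral>x. \<bar>h x\<bar> \<partial>Q)" by simp
  ultimately have "(\<integral>x. \<bar>h x\<bar> \<partial>Q) = 0" by linarith
  then have "AE x in Q. \<bar>h x\<bar> = 0"
    using h by (subst (asm) integral_nonneg_eq_0_iff_AE) auto
  then show ?thesis by simp
qed

lemma lim_avg_add:
  assumes B: "B \<in> sets borel" and C: "C \<in> sets borel" and BC: "B \<inter> C = {}"
  shows "AE x in Q. lim_avg (B \<union> C) x = lim_avg B x + lim_avg C x"
proof -
  let ?d = "\<lambda>n B x. \<bar>wavg n (indicator B) x - lim_avg B x\<bar>"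
  have sum: "wavg n (indicator (B \<union> C)) x = wavg n (indicator B) x + wavg n (indicator C) x" for n x
  proof -
    have "indicator (B \<union> C) = (\<lambda>y. indicator B y + indicator C y :: real)"
      using BC by (auto simp: indicator_def fun_eq_iff)
    then show ?thesis by (simp add: wavg_add)
  qed
  have "AE x in Q. lim_avg (B \<union> C) x - (lim_avg B x + lim_avg C x) = 0"
  proof (rule AE_zero_of_L1_bound)
    show "integrable Q (\<lambda>x. lim_avg (B \<union> C) x - (lim_avg B x + lim_avg C x))"
      using B C by simp
    show "(\<lambda>n. (\<integral>x. ?d n (B \<union> C) x \<partial>Q) + ((\<integral>x. ?d n B x \<partial>Q) + (\<integral>x. ?d n C x \<partial>Q))) \<longlonglongrightarrow> 0"
      using B C by (intro tendsto_add_zero lim_avg_props(3)) auto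
    show "\<forall>\<^sub>F n in sequentially. (\<integral>x. \<bar>lim_avg (B \<union> C) x - (lim_avg B x + lim_avg C x)\<bar> \<partial>Q) \<le>
        (\<integral>x. ?d n (B \<union> C) x \<partial>Q) + ((\<integral>x. ?d n B x \<partial>Q) + (\<integral>x. ?d n C x \<partial>Q))"
    proof (intro always_eventually allI)
      fix n
      have "(\<integral>x. \<bar>lim_avg (B \<union> C) x - (lim_avg B x + lim_avg C x)\<bar> \<partial>Q) \<le>
          (\<integral>x. ?d n (B \<union> C) x + (?d n B x + ?d n C x) \<partial>Q)"
        using B C sum[of n]
        by (intro integral_mono integrable_abs Bochner_Integration.integrable_add Bochner_Integration.integrable_diff
            integrable_lim_avg integrable_wavg) auto
      also have "\<dots> = (\<integral>x. ?d n (B \<union> C) x \<partial>Q) + ((\<integral>x. ?d n B x \<partial>Q) + (\<integral>x. ?d n C x \<partial>Q))"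
        using B C by simp
      finally show "(\<integral>x. \<bar>lim_avg (B \<union> C) x - (lim_avg B x + lim_avg C x)\<bar> \<partial>Q) \<le>
          (\<integral>x. ?d n (B \<union> C) x \<partial>Q) + ((\<integral>x. ?d n B x \<partial>Q) + (\<integral>x. ?d n C x \<partial>Q))" .
    qed
  qed
  then show ?thesis by simp
qed

lemma lim_avg_UNIV: "AE x in Q. lim_avg UNIV x = 1"
proof -
  obtain M where M: "\<And>m. m \<ge> M \<Longrightarrow> 0 < \<rho> m" using eventually_\<rho>_pos by auto
  have "AE x in Q. 1 - lim_avg UNIV x = 0"
  proof (rule AE_zero_of_L1_bound[OF _ _ lim_avg_props(3)])
    show "integrable Q (\<lambda>x. 1 - lim_avg UNIV x)" by simp
    show "\<forall>\<^sub>F n in sequentially. (\<integral>x. \<bar>1 - lim_avg UNIV x\<bar> \<partial>Q) \<le>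
        (\<integral>x. \<bar>wavg n (indicator UNIV) x - lim_avg UNIV x\<bar> \<partial>Q)"
      by (intro eventually_sequentiallyI[of M]) (simp add: wavg_1 M)
  qed simp
  then show ?thesis by simp
qed

lemma integral_lim_avg_tendsto:
  assumes B: "B \<in> sets borel"
  shows "(\<lambda>n. \<integral>x. wavg n (indicator B) x \<partial>Q) \<longlonglongrightarrow> (\<integral>x. lim_avg B x \<partial>Q)"
proof -
  have "(\<lambda>n. (\<integral>x. wavg n (indicator B) x \<partial>Q) - (\<integral>x. lim_avg B x \<partial>Q)) \<longlonglongrightarrow> 0"
  proof (rule Lim_null_comparison[OF always_eventually lim_avg_props(3)[OF B]], rule allI)
    fix n
    have "norm (\<integral>x. wavg n (indicator B) x - lim_avg B x \<partial>Q) \<le> (\<integral>x. norm (wavg n (indicator B) x - lim_avg B x) \<partial>Q)"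
      by (rule integral_norm_bound)
    then show "norm ((\<integral>x. wavg n (indicator B) x \<partial>Q) - (\<integral>x. lim_avg B x \<partial>Q)) \<le>
        (\<integral>x. \<bar>wavg n (indicator B) x - lim_avg B x\<bar> \<partial>Q)"
      using B by simp
  qed
  then show ?thesis by (simp add: LIM_zero_iff)
qed

text \<open>Continuity of the mean at the empty set holds because all later averages are dominated in mean
  by a fixed early one, which involves only finitely many coordinates.\<close>

lemma random_set_function_lim_avg: "random_set_function Q lim_avg"
proof (unfold_locales)
  show "B \<in> sets borel \<Longrightarrow> lim_avg B \<in> borel_measurable Q" for B by simp
  show "0 \<le> lim_avg B x \<and> lim_avg B x \<le> 1" for B x by (rule lim_avg_bounds)
  show "AE x in Q. lim_avg (B \<union> C) x = lim_avg B x + lim_avg C x"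
    if "B \<in> sets borel" "C \<in> sets borel" "B \<inter> C = {}" for B C
    using that by (rule lim_avg_add)
  show "AE x in Q. lim_avg UNIV x = 1" by (rule lim_avg_UNIV)
  fix B :: "nat \<Rightarrow> 'a set" assume B: "\<And>n. B n \<in> sets borel" "decseq B" "(\<Inter>n. B n) = {}"
  obtain M where M: "0 < \<rho> M" using eventually_\<rho>_pos by auto
  have le: "(\<integral>x. lim_avg (B j) x \<partial>Q) \<le> c M ^ 2 * (\<integral>x. wavg M (indicator (B j)) x \<partial>Q)" for j
    using M B(1)[of j]
    by (intro LIMSEQ_le_const2[OF integral_lim_avg_tendsto] exI[of _ M] allI impI wavg_mean_le)
       (auto simp: indicator_def)
  have "(\<lambda>j. \<integral>x. wavg M (indicator (B j)) x \<partial>Q) \<longlonglongrightarrow> (\<integral>x. 0 \<partial>Q)"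
  proof (rule integral_dominated_convergence[where w="\<lambda>_. 1"])
    have ind: "(\<lambda>j. indicator (B j) y :: real) \<longlonglongrightarrow> 0" for y
      using LIMSEQ_indicator_decseq[of B y] B(2,3) by simp
    have "(\<lambda>j. wsum M (indicator (B j)) x / wtot M x) \<longlonglongrightarrow> (\<Sum>k<M. v k (x k) * 0) / wtot M x" for x
      unfolding wsum_def[of M "indicator _"] using wtot_ge[of M x] M
      by (intro tendsto_divide tendsto_sum tendsto_mult ind tendsto_const) auto
    then show "AE x in Q. (\<lambda>j. wavg M (indicator (B j)) x) \<longlonglongrightarrow> 0"
      by (simp add: wavg_def)
    show "AE x in Q. norm (wavg M (indicator (B j)) x) \<le> 1" for j
      using wavg_ind_bounds by simp
  qed (use B in auto)
  then have lim: "(\<lambda>j. c M ^ 2 * (\<integral>x. wavg M (indicator (B j)) x \<partial>Q)) \<longlonglongrightarrow> 0"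
    using tendsto_mult_right_zero by fastforce
  show "(\<lambda>n. \<integral>x. lim_avg (B n) x \<partial>Q) \<longlonglongrightarrow> 0"
    using le lim_avg_bounds by (intro tendsto_sandwich[OF _ _ tendsto_const lim]) auto
qed

end

section \<open>The directing kernel\<close>

context divergent_process begin

text \<open>The directing kernel: a regular version of the limiting weighted frequencies.\<close>

definition \<kappa> :: "(nat \<Rightarrow> 'a) \<Rightarrow> 'a measure" where
  "\<kappa> = (SOME \<kappa>. \<kappa> \<in> inf_prod \<rightarrow>\<^sub>M prob_algebra borel \<and>
    (\<forall>B\<in>sets borel. AE x in Q. measure (\<kappa> x) B = lim_avg B x))"

lemma \<kappa>_props: "\<kappa> \<in> inf_prod \<rightarrow>\<^sub>M prob_algebra borel \<and> (\<forall>B\<in>sets borel. AE x in Q. measure (\<kappa> x) B = lim_avg B x)"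
proof -
  have "\<exists>\<kappa>. \<kappa> \<in> inf_prod \<rightarrow>\<^sub>M prob_algebra borel \<and> (\<forall>B\<in>sets borel. AE x in Q. measure (\<kappa> x) B = lim_avg B x)"
    using random_set_function_kernel[OF random_set_function_lim_avg]
    by (simp add: measurable_cong_sets[OF sets_Q refl] Bex_def)
  then show ?thesis unfolding \<kappa>_def by (rule someI_ex)
qed

lemma \<kappa>_meas[measurable]: "\<kappa> \<in> inf_prod \<rightarrow>\<^sub>M prob_algebra borel"
  using \<kappa>_props by simp

lemma \<kappa>_meas_subprob[measurable]: "\<kappa> \<in> inf_prod \<rightarrow>\<^sub>M subprob_algebra borel"
  by (rule measurable_prob_algebraD) measurable

lemma \<kappa>_eq: "B \<in> sets borel \<Longrightarrow> AE x in Q. measure (\<kappa> x) B = lim_avg B x"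
  using \<kappa>_props by simp

lemma \<kappa>_prob: "prob_space (\<kappa> x)" and sets_\<kappa>[simp, measurable_cong]: "sets (\<kappa> x) = sets borel"
  using measurable_space[OF \<kappa>_meas, of x] by (auto simp: space_prob_algebra space_PiM)

lemma space_\<kappa>[simp]: "space (\<kappa> x) = UNIV"
  using sets_eq_imp_space_eq[OF sets_\<kappa>[of x]] by simp

text \<open>Swapping two coordinates preserves null sets, as it preserves a measure with a strictly positive
  density with respect to \<open>Q\<close>.\<close>

lemma AE_tr:
  assumes "AE x in Q. P x"
  shows "AE x in Q. P (tr i k x)"
proof -
  obtain N where N: "{x. \<not> P x} \<subseteq> N" "N \<in> sets Q" "emeasure Q N = 0"
    using assms by (auto elim!: AE_E)
  have [measurable]: "N \<in> sets inf_prod" using N(2) by simp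
  have pos: "0 < u i (x i) * u k (x k)" for x using u_pos by simp
  have "AE x in Q. x \<notin> N" using N(2,3) by (intro AE_not_in) (auto simp: null_sets_def)
  then have "(\<integral>\<^sup>+x. ennreal (u i (x i) * u k (x k)) * indicator N x \<partial>Q) = 0"
    by (subst nn_integral_0_iff_AE) (auto elim!: eventually_mono)
  then have "(\<integral>\<^sup>+x. ennreal (u i (x i) * u k (x k)) * indicator N (tr i k x) \<partial>Q) = 0"
    by (subst swap_u) auto
  then have "AE x in Q. ennreal (u i (x i) * u k (x k)) * indicator N (tr i k x) = 0"
    by (subst (asm) nn_integral_0_iff_AE) auto
  then show ?thesis
  proof eventually_elim
    case (elim x)
    then have "indicator N (tr i k x) = (0::ennreal)" using pos[of x] by (simp add: ennreal_eq_0_iff not_le)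
    with N(1) show ?case by (auto simp: indicator_def split: if_splits)
  qed
qed

lemma wavg_tr_diff:
  assumes \<rho>: "0 < \<rho> m"
  shows "\<bar>wavg m (indicator B) (tr i k x) - wavg m (indicator B) x\<bar> \<le> 8 / \<rho> m"
proof -
  let ?S = "wsum m (indicator B) x" and ?S' = "wsum m (indicator B) (tr i k x)"
  let ?W = "wtot m x" and ?W' = "wtot m (tr i k x)"
  have W: "\<rho> m \<le> ?W" "\<rho> m \<le> ?W'" by (rule wtot_ge)+
  have diff: "\<bar>wsum m f (tr i k x) - wsum m f x\<bar> \<le> 4" if "\<And>y. 0 \<le> f y \<and> f y \<le> 2" for f
  proof -
    have "wsum m f (tr i k x) \<le> wsum m f x + 4" for x
      by (rule wsum_tr_le) (rule that)
    from this[of x] this[of "tr i k x"] show ?thesis by (simp add: abs_le_iff)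
  qed
  have S: "\<bar>?S' - ?S\<bar> \<le> 4"
    by (rule diff) (simp add: indicator_def)
  have WW: "\<bar>?W' - ?W\<bar> \<le> 4"
    by (rule diff) simp
  have q: "\<bar>?S / ?W\<bar> \<le> 1" using wavg_ind_bounds[of m B x] unfolding wavg_def by (simp only: abs_of_nonneg)
  have "?S' / ?W' - ?S / ?W = ((?S' - ?S) - (?S / ?W) * (?W' - ?W)) / ?W'"
    using W \<rho> by (simp add: field_simps)
  then have "\<bar>?S' / ?W' - ?S / ?W\<bar> = \<bar>(?S' - ?S) - (?S / ?W) * (?W' - ?W)\<bar> / ?W'"
    using W \<rho> by simp
  also have "\<dots> \<le> (4 + 1 * 4) / ?W'"
  proof (intro divide_right_mono)
    have "\<bar>(?S / ?W) * (?W' - ?W)\<bar> \<le> 1 * 4"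
      unfolding abs_mult using q WW by (intro mult_mono) auto
    then show "\<bar>(?S' - ?S) - (?S / ?W) * (?W' - ?W)\<bar> \<le> 4 + 1 * 4"
      using S by linarith
  qed (use W \<rho> in auto)
  also have "\<dots> \<le> 8 / \<rho> m" using W \<rho> by (simp add: frac_le)
  finally show ?thesis by (simp add: wavg_def)
qed

lemma lim_avg_tr:
  assumes B: "B \<in> sets borel"
  shows "AE x in Q. lim_avg B (tr i k x) = lim_avg B x"
proof -
  obtain s :: "nat \<Rightarrow> nat" where s: "strict_mono s" "AE x in Q. (\<lambda>j. wavg (s j) (indicator B) x) \<longlonglongrightarrow> lim_avg B x"
    using lim_avg_props(2)[OF B] by auto
  obtain M where M: "\<And>m. m \<ge> M \<Longrightarrow> 0 < \<rho> m" using eventually_\<rho>_pos by auto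
  have "(\<lambda>m. 8 / \<rho> m) \<longlonglongrightarrow> 0"
    by (intro tendsto_divide_0[OF tendsto_const] filterlim_at_top_imp_at_infinity \<rho>_at_top)
  then have z: "(\<lambda>m. wavg m (indicator B) (tr i k x) - wavg m (indicator B) x) \<longlonglongrightarrow> 0" for x
    by (rule Lim_null_comparison[rotated]) (auto intro!: eventually_sequentiallyI[of M] wavg_tr_diff M)
  from s(2) AE_tr[OF s(2), of i k] show ?thesis
  proof eventually_elim
    case (elim x)
    have "(\<lambda>j. wavg (s j) (indicator B) (tr i k x) - wavg (s j) (indicator B) x) \<longlonglongrightarrow> lim_avg B (tr i k x) - lim_avg B x"
      by (intro tendsto_diff elim)
    moreover have "(\<lambda>j. wavg (s j) (indicator B) (tr i k x) - wavg (s j) (indicator B) x) \<longlonglongrightarrow> 0"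
      using LIMSEQ_subseq_LIMSEQ[OF z s(1), of x] by (simp add: comp_def)
    ultimately show ?case using LIMSEQ_unique by fastforce
  qed
qed

lemma \<kappa>_tr: "AE x in Q. \<kappa> (tr i k x) = \<kappa> x"
proof -
  obtain G :: "'a set set" where G: "countable G" "Int_stable G" "UNIV \<in> G" "sets borel = sigma_sets UNIV G"
    using countable_Int_stable_generator by blast
  have G_sets: "B \<in> sets borel" if "B \<in> G" for B using that G(4) by auto
  have "AE x in Q. \<forall>B\<in>G. measure (\<kappa> (tr i k x)) B = measure (\<kappa> x) B"
    unfolding AE_ball_countable[OF G(1)]
  proof
    fix B assume "B \<in> G"
    then have B: "B \<in> sets borel" by (rule G_sets)
    from \<kappa>_eq[OF B] AE_tr[OF \<kappa>_eq[OF B], of i k] lim_avg_tr[OF B, of i k]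
    show "AE x in Q. measure (\<kappa> (tr i k x)) B = measure (\<kappa> x) B"
      by eventually_elim simp
  qed
  then show ?thesis
  proof eventually_elim
    case (elim x)
    interpret K: prob_space "\<kappa> x" by (rule \<kappa>_prob)
    interpret K': prob_space "\<kappa> (tr i k x)" by (rule \<kappa>_prob)
    show ?case
    proof (rule measure_eqI_generator_eq[OF G(2), where \<Omega>=UNIV and A="\<lambda>_. UNIV"])
      show "emeasure (\<kappa> (tr i k x)) X = emeasure (\<kappa> x) X" if "X \<in> G" for X
        using elim that by (simp add: K.emeasure_eq_measure K'.emeasure_eq_measure)
    qed (use G in auto)
  qed
qed

lemma \<kappa>_set_meas[measurable]:
  "B \<in> sets borel \<Longrightarrow> (\<lambda>x. measure (\<kappa> x) B) \<in> borel_measurable inf_prod"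
  by (intro measurable_compose[OF \<kappa>_meas_subprob] measurable_measure_subprob_algebra)

lemma wavg_L1_\<kappa>:
  assumes B: "B \<in> sets borel"
  shows "(\<lambda>n. \<integral>x. \<bar>wavg n (indicator B) x - measure (\<kappa> x) B\<bar> \<partial>Q) \<longlonglongrightarrow> 0"
proof -
  have "(\<integral>x. \<bar>wavg n (indicator B) x - measure (\<kappa> x) B\<bar> \<partial>Q) = (\<integral>x. \<bar>wavg n (indicator B) x - lim_avg B x\<bar> \<partial>Q)" for n
    using \<kappa>_eq[OF B] B by (intro integral_cong_AE) (auto elim!: eventually_mono)
  with lim_avg_props(3)[OF B] show ?thesis by simp
qed

text \<open>
  Here the coordinate \<open>x i\<close> is compared with \<open>\<kappa>\<close>: replace \<open>\<kappa>\<close> by a weighted average, swap \<open>x i\<close> with each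
  averaged coordinate \<open>x k\<close>, \<open>k > i\<close>, under which \<open>Z\<close> is invariant, and pass to the limit. The finitely
  many terms with \<open>k \<le> i\<close> are negligible.
\<close>

lemma directing_le:
  assumes C[measurable]: "C \<in> sets borel" and D[measurable]: "D \<in> sets borel"
    and b: "0 \<le> b" "\<And>y. y \<in> C \<union> D \<Longrightarrow> u i y \<le> b"
    and Z_meas[measurable]: "Z \<in> borel_measurable inf_prod" and Z: "\<And>x. 0 \<le> Z x \<and> Z x \<le> 1"
    and Z_inv: "\<And>k. i < k \<Longrightarrow> AE x in Q. Z (tr i k x) = Z x"
  shows "(\<integral>x. indicator C (x i) * u i (x i) * measure (\<kappa> x) D * Z x \<partial>Q) \<le>
    (\<integral>x. indicator D (x i) * u i (x i) * measure (\<kappa> x) C * Z x \<partial>Q)"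
proof -
  define \<phi> where "\<phi> C x = indicator C (x i) * u i (x i)" for C and x :: "nat \<Rightarrow> 'a"
  have \<phi>_meas[measurable]: "\<phi> E \<in> borel_measurable inf_prod" if [measurable]: "E \<in> sets borel" for E
    unfolding \<phi>_def by measurable
  have \<phi>: "0 \<le> \<phi> E x \<and> \<phi> E x \<le> b" if "E \<subseteq> C \<union> D" for E x
    using that b(1) b(2)[of "x i"] u_pos[of i "x i"] by (auto simp: \<phi>_def indicator_def)
  define T where "T m E F k = (\<integral>\<^sup>+x. ennreal (\<phi> E x * (v k (x k) * indicator F (x k) / wtot m x) * Z x) \<partial>Q)" for m E F k
  have expand: "(\<integral>\<^sup>+x. ennreal (\<phi> E x * wavg m (indicator F) x * Z x) \<partial>Q) = (\<Sum>k<m. T m E F k)"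
    if \<rho>: "0 < \<rho> m" and [measurable]: "E \<in> sets borel" "F \<in> sets borel" and E: "E \<subseteq> C \<union> D" for m E F
  proof -
    have "ennreal (\<phi> E x * wavg m (indicator F) x * Z x) =
      (\<Sum>k<m. ennreal (\<phi> E x * (v k (x k) * indicator F (x k) / wtot m x) * Z x))" for x
    proof -
      have "\<phi> E x * wavg m (indicator F) x * Z x = (\<Sum>k<m. \<phi> E x * (v k (x k) * indicator F (x k) / wtot m x) * Z x)"
        unfolding wavg_def wsum_def[of m "indicator F"] by (simp only: sum_divide_distrib sum_distrib_left sum_distrib_right)
      moreover have "0 \<le> wtot m x" using wtot_ge[of m x] \<rho> by linarith
      ultimately show ?thesis
        using \<phi>[OF E] Z v_nonneg by (simp add: sum_ennreal)
    qed
    then show ?thesis unfolding T_def by (simp add: nn_integral_sum)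
  qed
  have T_small: "T m C D k \<le> ennreal (b / \<rho> m)" if \<rho>: "0 < \<rho> m" for m k
  proof -
    have "T m C D k \<le> (\<integral>\<^sup>+x. ennreal (b / \<rho> m) \<partial>Q)"
      unfolding T_def
    proof (intro nn_integral_mono ennreal_leI)
      fix x
      have W: "0 < wtot m x" "\<rho> m \<le> wtot m x" using wtot_ge[of m x] \<rho> by linarith+
      have "v k (x k) * indicator D (x k) / wtot m x \<le> 1 * 1 / \<rho> m"
        using W \<rho> v_le_1[of k "x k"] v_nonneg[of k "x k"] by (intro frac_le mult_mono) (auto simp: indicator_def)
      then have "\<phi> C x * (v k (x k) * indicator D (x k) / wtot m x) * Z x \<le> b * (1 * 1 / \<rho> m) * 1"
        using W \<rho> b(1) \<phi>[of C x] Z[of x] v_nonneg[of k "x k"] by (intro mult_mono) auto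
      then show "\<phi> C x * (v k (x k) * indicator D (x k) / wtot m x) * Z x \<le> b / \<rho> m" by simp
    qed
    then show ?thesis by (simp add: emeasure_space_1[simplified])
  qed
  have T_swap: "T m C D k \<le> ennreal (c m) * T m D C k" if \<rho>: "0 < \<rho> m" and k: "i < k" for m k
  proof -
    let ?H = "\<lambda>E F x. ennreal (a k * (indicator E (x i) * indicator F (x k)) * (1 / wtot m x) * Z x)"
    have W: "0 < wtot m x" for x using wtot_ge[of m x] \<rho> by linarith
    have T_eq: "T m E F k = (\<integral>\<^sup>+x. ennreal (u i (x i) * u k (x k)) * ?H E F x \<partial>Q)" for E F
      unfolding T_def
    proof (intro nn_integral_cong)
      fix x
      have eq: "\<phi> E x * (v k (x k) * indicator F (x k) / wtot m x) * Z x =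
          (u i (x i) * u k (x k)) * (a k * (indicator E (x i) * indicator F (x k)) * (1 / wtot m x) * Z x)"
        by (simp add: \<phi>_def v_eq_u)
      show "ennreal (\<phi> E x * (v k (x k) * indicator F (x k) / wtot m x) * Z x) =
          ennreal (u i (x i) * u k (x k)) * ?H E F x"
        unfolding eq using u_pos[of i "x i"] u_pos[of k "x k"] by (intro ennreal_mult') simp
    qed
    have "T m C D k = (\<integral>\<^sup>+x. ennreal (u i (x i) * u k (x k)) * ?H C D (tr i k x) \<partial>Q)"
      unfolding T_eq by (rule swap_u[symmetric]) measurable
    also have "\<dots> \<le> (\<integral>\<^sup>+x. ennreal (c m) * (ennreal (u i (x i) * u k (x k)) * ?H D C x) \<partial>Q)"
    proof (rule nn_integral_mono_AE)
      show "AE x in Q. ennreal (u i (x i) * u k (x k)) * ?H C D (tr i k x) \<le>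
          ennreal (c m) * (ennreal (u i (x i) * u k (x k)) * ?H D C x)"
        using Z_inv[OF k]
      proof eventually_elim
        case (elim x)
        let ?q = "a k * (indicator D (x i) * indicator C (x k)) :: real"
        have q: "0 \<le> ?q" using a_nonneg by simp
        have "?q * (1 / wtot m (tr i k x)) * Z x \<le> ?q * (c m * (1 / wtot m x)) * Z x"
          using inv_wtot_tr[OF \<rho> order_refl, of x i k] q Z[of x]
          by (intro mult_right_mono mult_left_mono) auto
        also have "\<dots> = c m * (?q * (1 / wtot m x) * Z x)" by simp
        finally have "?H C D (tr i k x) \<le> ennreal (c m) * ?H D C x"
          using c_ge_1[OF \<rho>] by (simp add: elim mult_ac ennreal_leI flip: ennreal_mult')
        then show ?case
          by (simp only: mult.left_commute[of "ennreal (c m)"]) (rule mult_left_mono, auto)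
      qed
    qed
    also have "\<dots> = ennreal (c m) * T m D C k"
      unfolding T_eq by (rule nn_integral_cmult) measurable
    finally show ?thesis .
  qed
  have step: "(\<integral>x. \<phi> C x * wavg m (indicator D) x * Z x \<partial>Q) \<le>
      real (Suc i) * (b / \<rho> m) + c m * (\<integral>x. \<phi> D x * wavg m (indicator C) x * Z x \<partial>Q)"
    if \<rho>: "0 < \<rho> m" for m
  proof -
    have bb: "0 \<le> \<phi> E x * wavg m (indicator F) x * Z x \<and> \<phi> E x * wavg m (indicator F) x * Z x \<le> b * 1 * 1"
      if "E \<subseteq> C \<union> D" for E F x
      using \<phi>[OF that, of x] wavg_ind_bounds[of m F x] Z[of x] b(1)
      by (intro conjI mult_mono mult_nonneg_nonneg) auto
    have int: "integrable Q (\<lambda>x. \<phi> E x * wavg m (indicator F) x * Z x)"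
      if "E \<subseteq> C \<union> D" and [measurable]: "E \<in> sets borel" "F \<in> sets borel" for E F
      by (rule integrable_bounded[OF _ bb]) (use that in auto)
    have nn: "(\<integral>\<^sup>+x. ennreal (\<phi> E x * wavg m (indicator F) x * Z x) \<partial>Q) =
        ennreal (\<integral>x. \<phi> E x * wavg m (indicator F) x * Z x \<partial>Q)"
      if "E \<subseteq> C \<union> D" "E \<in> sets borel" "F \<in> sets borel" for E F
      using int[OF that] bb[OF that(1)] by (intro nn_integral_eq_integral) auto
    have nonneg: "0 \<le> (\<integral>x. \<phi> D x * wavg m (indicator C) x * Z x \<partial>Q)"
      using bb[of D _ C] by (intro Bochner_Integration.integral_nonneg) auto
    have crude: "(\<Sum>k<m. if k \<le> i then ennreal (b / \<rho> m) else 0) \<le> ennreal (real (Suc i) * (b / \<rho> m))"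
    proof -
      have "(\<Sum>k<m. if k \<le> i then ennreal (b / \<rho> m) else 0) = (\<Sum>k\<in>{..<m} \<inter> {..i}. ennreal (b / \<rho> m))"
        by (subst sum.inter_restrict) auto
      also have "\<dots> \<le> (\<Sum>k\<in>{..i}. ennreal (b / \<rho> m))"
        by (intro sum_mono2) auto
      also have "\<dots> = ennreal (real (Suc i) * (b / \<rho> m))"
        by (simp add: ennreal_of_nat_eq_real_of_nat del: of_nat_Suc flip: ennreal_mult')
      finally show ?thesis .
    qed
    have "ennreal (\<integral>x. \<phi> C x * wavg m (indicator D) x * Z x \<partial>Q) = (\<Sum>k<m. T m C D k)"
      using expand[OF \<rho>, of C D] nn[of C D] by simp
    also have "\<dots> \<le> (\<Sum>k<m. (if k \<le> i then ennreal (b / \<rho> m) else 0) + ennreal (c m) * T m D C k)"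
      using T_small[OF \<rho>] T_swap[OF \<rho>] by (intro sum_mono) (auto simp: not_le intro: add_increasing2)
    also have "\<dots> = (\<Sum>k<m. if k \<le> i then ennreal (b / \<rho> m) else 0) + ennreal (c m) * (\<Sum>k<m. T m D C k)"
      by (simp add: sum.distrib sum_distrib_left)
    also have "\<dots> \<le> ennreal (real (Suc i) * (b / \<rho> m)) + ennreal (c m) * (\<Sum>k<m. T m D C k)"
      using crude by (rule add_right_mono)
    also have "(\<Sum>k<m. T m D C k) = ennreal (\<integral>x. \<phi> D x * wavg m (indicator C) x * Z x \<partial>Q)"
      using expand[OF \<rho>, of D C] nn[of D C] by simp
    also have "ennreal (c m) * \<dots> = ennreal (c m * (\<integral>x. \<phi> D x * wavg m (indicator C) x * Z x \<partial>Q))"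
      using c_ge_1[OF \<rho>] by (intro ennreal_mult'[symmetric]) simp
    also have "ennreal (real (Suc i) * (b / \<rho> m)) + \<dots> =
        ennreal (real (Suc i) * (b / \<rho> m) + c m * (\<integral>x. \<phi> D x * wavg m (indicator C) x * Z x \<partial>Q))"
      using c_ge_1[OF \<rho>] b(1) \<rho> nonneg by (intro ennreal_plus[symmetric]) auto
    finally show ?thesis
      using c_ge_1[OF \<rho>] b(1) \<rho> nonneg by (subst (asm) ennreal_le_iff) (auto intro!: add_nonneg_nonneg)
  qed
  have lim: "(\<lambda>m. \<integral>x. \<phi> E x * wavg m (indicator F) x * Z x \<partial>Q) \<longlonglongrightarrow> (\<integral>x. \<phi> E x * measure (\<kappa> x) F * Z x \<partial>Q)"
    if E: "E \<subseteq> C \<union> D" and [measurable]: "E \<in> sets borel" "F \<in> sets borel" for E F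
  proof -
    have m01: "0 \<le> measure (\<kappa> x) F \<and> measure (\<kappa> x) F \<le> 1" for x
      using prob_space.prob_le_1[OF \<kappa>_prob] by simp
    have int: "integrable Q (\<lambda>x. \<phi> E x * g x * Z x)"
      if [measurable]: "g \<in> borel_measurable inf_prod" and g: "\<And>x. 0 \<le> g x \<and> g x \<le> 1" for g
    proof (rule integrable_bounded[where b="b * 1 * 1"])
      show "0 \<le> \<phi> E x * g x * Z x \<and> \<phi> E x * g x * Z x \<le> b * 1 * 1" for x
        using \<phi>[OF E, of x] g[of x] Z[of x] b(1) by (intro conjI mult_mono mult_nonneg_nonneg) auto
    qed measurable
    have i1: "integrable Q (\<lambda>x. \<phi> E x * wavg m (indicator F) x * Z x)" for m
      by (rule int[OF _ wavg_ind_bounds]) measurable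
    have i2: "integrable Q (\<lambda>x. \<phi> E x * measure (\<kappa> x) F * Z x)"
      by (rule int[OF _ m01]) measurable
    have i3: "integrable Q (\<lambda>x. b * \<bar>wavg m (indicator F) x - measure (\<kappa> x) F\<bar>)" for m
    proof -
      have "integrable Q (\<lambda>x. measure (\<kappa> x) F)"
        by (rule integrable_bounded[OF _ m01]) measurable
      then show ?thesis
        by (intro integrable_mult_right integrable_abs Bochner_Integration.integrable_diff) auto
    qed
    have "(\<lambda>m. b * (\<integral>x. \<bar>wavg m (indicator F) x - measure (\<kappa> x) F\<bar> \<partial>Q)) \<longlonglongrightarrow> 0"
      by (intro tendsto_mult_right_zero wavg_L1_\<kappa>) measurable
    then have "(\<lambda>m. (\<integral>x. \<phi> E x * wavg m (indicator F) x * Z x \<partial>Q) - (\<integral>x. \<phi> E x * measure (\<kappa> x) F * Z x \<partial>Q)) \<longlonglongrightarrow> 0"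
    proof (rule Lim_null_comparison[rotated], intro always_eventually allI)
      fix m
      let ?d = "\<lambda>x. \<phi> E x * wavg m (indicator F) x * Z x - \<phi> E x * measure (\<kappa> x) F * Z x"
      have "norm (\<integral>x. ?d x \<partial>Q) \<le> (\<integral>x. norm (?d x) \<partial>Q)" by (rule integral_norm_bound)
      also have "\<dots> \<le> (\<integral>x. b * \<bar>wavg m (indicator F) x - measure (\<kappa> x) F\<bar> \<partial>Q)"
      proof (rule integral_mono)
        show "integrable Q (\<lambda>x. norm (?d x))"
          by (intro integrable_norm Bochner_Integration.integrable_diff i1 i2)
        fix x
        have "?d x = \<phi> E x * Z x * (wavg m (indicator F) x - measure (\<kappa> x) F)" by (simp add: algebra_simps)
        then have "norm (?d x) = \<phi> E x * Z x * \<bar>wavg m (indicator F) x - measure (\<kappa> x) F\<bar>"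
          using \<phi>[OF E, of x] Z[of x] by (simp add: abs_mult)
        also have "\<dots> \<le> (b * 1) * \<bar>wavg m (indicator F) x - measure (\<kappa> x) F\<bar>"
          using \<phi>[OF E, of x] Z[of x] b(1) by (intro mult_right_mono mult_mono) auto
        finally show "norm (?d x) \<le> b * \<bar>wavg m (indicator F) x - measure (\<kappa> x) F\<bar>" by simp
      qed (rule i3)
      finally show "norm ((\<integral>x. \<phi> E x * wavg m (indicator F) x * Z x \<partial>Q) - (\<integral>x. \<phi> E x * measure (\<kappa> x) F * Z x \<partial>Q)) \<le>
          b * (\<integral>x. \<bar>wavg m (indicator F) x - measure (\<kappa> x) F\<bar> \<partial>Q)"
        using i1 i2 by simp
    qed
    then show ?thesis by (simp add: LIM_zero_iff)
  qed
  obtain M where M: "\<And>m. m \<ge> M \<Longrightarrow> 0 < \<rho> m" using eventually_\<rho>_pos by auto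
  have "(\<lambda>m. real (Suc i) * (b / \<rho> m) + c m * (\<integral>x. \<phi> D x * wavg m (indicator C) x * Z x \<partial>Q)) \<longlonglongrightarrow>
      real (Suc i) * 0 + 1 * (\<integral>x. \<phi> D x * measure (\<kappa> x) C * Z x \<partial>Q)"
    by (intro tendsto_add tendsto_mult tendsto_const c_tendsto lim tendsto_divide_0[OF tendsto_const]
        filterlim_at_top_imp_at_infinity \<rho>_at_top) auto
  moreover have "(\<lambda>m. \<integral>x. \<phi> C x * wavg m (indicator D) x * Z x \<partial>Q) \<longlonglongrightarrow> (\<integral>x. \<phi> C x * measure (\<kappa> x) D * Z x \<partial>Q)"
    by (intro lim) auto
  ultimately have "(\<integral>x. \<phi> C x * measure (\<kappa> x) D * Z x \<partial>Q) \<le>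
      real (Suc i) * 0 + 1 * (\<integral>x. \<phi> D x * measure (\<kappa> x) C * Z x \<partial>Q)"
    using step M by (intro LIMSEQ_le) auto
  then show ?thesis by (simp add: \<phi>_def)
qed

end

section \<open>Conditional independence given the directing kernel\<close>

context divergent_process begin

lemma \<kappa>_nn_meas[measurable]:
  "f \<in> borel_measurable borel \<Longrightarrow> (\<lambda>x. \<integral>\<^sup>+y. f y \<partial>\<kappa> x) \<in> borel_measurable inf_prod"
  by (intro measurable_compose[OF \<kappa>_meas_subprob] nn_integral_measurable_subprob_algebra)

text \<open>
  Both sides are integrals of \<open>f\<close> with respect to measures on the state space, the left one a marginal
  of \<open>Q\<close> with density \<open>h\<close>, the right one a mixture of the kernels \<open>\<kappa>\<close>. Hence it suffices to compare
  them on subsets of an exhausting sequence.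
\<close>

lemma coordinate_eq_mixture:
  fixes h h' :: "(nat \<Rightarrow> 'a) \<Rightarrow> ennreal"
  assumes [measurable]: "h \<in> borel_measurable inf_prod" "h' \<in> borel_measurable inf_prod"
    and E: "\<And>j::nat. E j \<in> sets borel" "incseq E" "(\<Union>j. E j) = UNIV"
    and eq: "\<And>C j. C \<in> sets borel \<Longrightarrow>
      (\<integral>\<^sup>+x. h x * indicator (C \<inter> E j) (x i) \<partial>Q) = (\<integral>\<^sup>+x. h' x * emeasure (\<kappa> x) (C \<inter> E j) \<partial>Q)"
    and f[measurable]: "f \<in> borel_measurable borel"
  shows "(\<integral>\<^sup>+x. h x * f (x i) \<partial>Q) = (\<integral>\<^sup>+x. h' x * (\<integral>\<^sup>+y. f y \<partial>\<kappa> x) \<partial>Q)"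
proof -
  define M1 where "M1 = distr (density Q h) borel (\<lambda>x. x i)"
  define M2 where "M2 = density Q h' \<bind> \<kappa>"
  have ks: "\<kappa> \<in> density Q h' \<rightarrow>\<^sub>M subprob_algebra borel"
    by (simp add: measurable_cong_sets[OF sets_density refl] measurable_cong_sets[OF sets_Q refl])
  have s1: "sets M1 = sets borel" by (simp add: M1_def)
  have s2: "sets M2 = sets borel"
    unfolding M2_def by (rule sets_bind[OF subprob_measurableD(2)[OF ks]]) auto
  have n1: "(\<integral>\<^sup>+y. g y \<partial>M1) = (\<integral>\<^sup>+x. h x * g (x i) \<partial>Q)" if [measurable]: "g \<in> borel_measurable borel" for g
  proof -
    have "(\<integral>\<^sup>+y. g y \<partial>M1) = (\<integral>\<^sup>+x. g (x i) \<partial>density Q h)"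
      unfolding M1_def by (subst nn_integral_distr) auto
    also have "\<dots> = (\<integral>\<^sup>+x. h x * g (x i) \<partial>Q)"
      by (rule nn_integral_density) measurable
    finally show ?thesis .
  qed
  have n2: "(\<integral>\<^sup>+y. g y \<partial>M2) = (\<integral>\<^sup>+x. h' x * (\<integral>\<^sup>+y. g y \<partial>\<kappa> x) \<partial>Q)" if [measurable]: "g \<in> borel_measurable borel" for g
  proof -
    have "(\<integral>\<^sup>+y. g y \<partial>M2) = (\<integral>\<^sup>+x. (\<integral>\<^sup>+y. g y \<partial>\<kappa> x) \<partial>density Q h')"
      unfolding M2_def by (rule nn_integral_bind[OF _ ks]) measurable
    also have "\<dots> = (\<integral>\<^sup>+x. h' x * (\<integral>\<^sup>+y. g y \<partial>\<kappa> x) \<partial>Q)"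
      by (rule nn_integral_density) measurable
    finally show ?thesis .
  qed
  have "M1 = M2"
  proof (rule measure_eqI_incseq_cover[where E=E])
    show "sets M1 = sets M2" by (simp add: s1 s2)
    show "range E \<subseteq> sets M1" "incseq E" using E s1 by auto
    show "(\<Union>j. E j) = space M1" using E(3) by (simp add: M1_def)
    fix A j assume "A \<in> sets M1"
    then have A: "A \<in> sets borel" by (simp add: s1)
    then have [measurable]: "A \<inter> E j \<in> sets borel" using E(1)[of j] by auto
    have "emeasure M1 (A \<inter> E j) = (\<integral>\<^sup>+y. indicator (A \<inter> E j) y \<partial>M1)"
      using s1 by (subst nn_integral_indicator) auto
    also have "\<dots> = (\<integral>\<^sup>+x. h x * indicator (A \<inter> E j) (x i) \<partial>Q)"
      by (rule n1) measurable
    also have "\<dots> = (\<integral>\<^sup>+x. h' x * emeasure (\<kappa> x) (A \<inter> E j) \<partial>Q)" by (rule eq[OF A])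
    also have "\<dots> = (\<integral>\<^sup>+x. h' x * (\<integral>\<^sup>+y. indicator (A \<inter> E j) y \<partial>\<kappa> x) \<partial>Q)" by (subst nn_integral_indicator) auto
    also have "\<dots> = (\<integral>\<^sup>+y. indicator (A \<inter> E j) y \<partial>M2)" by (rule n2[symmetric]) measurable
    also have "\<dots> = emeasure M2 (A \<inter> E j)" using s2 by (subst nn_integral_indicator) auto
    finally show "emeasure M1 (A \<inter> E j) = emeasure M2 (A \<inter> E j)" .
  qed
  then show ?thesis using n1[OF f] n2[OF f] by simp
qed

text \<open>Test variables with values in \<open>[0, 1]\<close> that are almost surely unchanged when the \<open>i\<close>-th coordinate
  is swapped with a later one, such as products of a function of the coordinates before \<open>i\<close> and a
  function of \<open>\<kappa>\<close>.\<close>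

definition later_swap_invariant :: "nat \<Rightarrow> ((nat \<Rightarrow> 'a) \<Rightarrow> real) \<Rightarrow> bool" where
  "later_swap_invariant i Z \<longleftrightarrow> Z \<in> borel_measurable inf_prod \<and> (\<forall>x. 0 \<le> Z x \<and> Z x \<le> 1) \<and>
    (\<forall>k>i. AE x in Q. Z (tr i k x) = Z x)"

lemma directing_swap_bounded:
  assumes Z: "later_swap_invariant i Z"
    and [measurable]: "C \<in> sets borel" "D \<in> sets borel"
    and b: "0 \<le> b" "\<And>y. y \<in> C \<union> D \<Longrightarrow> u i y \<le> b"
  shows "(\<integral>\<^sup>+x. ennreal (u i (x i)) * emeasure (\<kappa> x) D * ennreal (Z x) * indicator C (x i) \<partial>Q) =
    (\<integral>\<^sup>+x. indicator D (x i) * ennreal (u i (x i)) * ennreal (Z x) * emeasure (\<kappa> x) C \<partial>Q)"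
proof -
  have Zm[measurable]: "Z \<in> borel_measurable inf_prod" and Z01: "\<And>x. 0 \<le> Z x \<and> Z x \<le> 1"
    and Zi: "\<And>k. i < k \<Longrightarrow> AE x in Q. Z (tr i k x) = Z x"
    using Z by (auto simp: later_swap_invariant_def)
  have eq: "(\<integral>x. indicator C (x i) * u i (x i) * measure (\<kappa> x) D * Z x \<partial>Q) =
    (\<integral>x. indicator D (x i) * u i (x i) * measure (\<kappa> x) C * Z x \<partial>Q)"
    using directing_le[OF _ _ b(1) b(2) Zm Z01 Zi, of C D] directing_le[OF _ _ b(1) b(2) Zm Z01 Zi, of D C]
    by (intro antisym) auto
  have nn: "(\<integral>\<^sup>+x. ennreal (indicator E (x i) * u i (x i) * measure (\<kappa> x) F * Z x) \<partial>Q) =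
      ennreal (\<integral>x. indicator E (x i) * u i (x i) * measure (\<kappa> x) F * Z x \<partial>Q)"
    if E: "E \<subseteq> C \<union> D" and [measurable]: "E \<in> sets borel" "F \<in> sets borel" for E F
  proof -
    have bb: "0 \<le> indicator E (x i) * u i (x i) * measure (\<kappa> x) F * Z x \<and>
        indicator E (x i) * u i (x i) * measure (\<kappa> x) F * Z x \<le> b * 1 * 1" for x
    proof -
      have "indicator E (x i) * u i (x i) \<le> b"
        using E b(1) b(2)[of "x i"] by (auto simp: indicator_def)
      moreover have "0 \<le> indicator E (x i) * u i (x i)" using u_pos[of i "x i"] by simp
      moreover have "measure (\<kappa> x) F \<le> 1" by (rule prob_space.prob_le_1[OF \<kappa>_prob])
      ultimately show ?thesis using Z01[of x] b(1) u_pos[of i "x i"] by (intro conjI mult_mono mult_nonneg_nonneg) auto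
    qed
    have "integrable Q (\<lambda>x. indicator E (x i) * u i (x i) * measure (\<kappa> x) F * Z x)"
      by (rule integrable_bounded[OF _ bb]) measurable
    then show ?thesis using bb by (intro nn_integral_eq_integral) auto
  qed
  have split: "ennreal (indicator E (x i) * u i (x i) * measure (\<kappa> x) F * Z x) =
      indicator E (x i) * ennreal (u i (x i)) * emeasure (\<kappa> x) F * ennreal (Z x)" for E F x
  proof -
    interpret K: prob_space "\<kappa> x" by (rule \<kappa>_prob)
    show ?thesis
      using u_pos[of i "x i"] Z01[of x]
      by (simp add: ennreal_mult K.emeasure_eq_measure ennreal_indicator less_imp_le)
  qed
  have "(\<integral>\<^sup>+x. ennreal (indicator C (x i) * u i (x i) * measure (\<kappa> x) D * Z x) \<partial>Q) =
     (\<integral>\<^sup>+x. ennreal (indicator D (x i) * u i (x i) * measure (\<kappa> x) C * Z x) \<partial>Q)"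
    using nn[of C D] nn[of D C] eq by simp
  then show ?thesis unfolding split by (simp only: mult_ac)
qed

lemma directing_swap:
  assumes Z: "later_swap_invariant i Z"
    and [measurable]: "f \<in> borel_measurable borel" "g \<in> borel_measurable borel"
  shows "(\<integral>\<^sup>+x. ennreal (u i (x i)) * (\<integral>\<^sup>+y. f y \<partial>\<kappa> x) * ennreal (Z x) * g (x i) \<partial>Q) =
    (\<integral>\<^sup>+x. f (x i) * ennreal (u i (x i)) * ennreal (Z x) * (\<integral>\<^sup>+y. g y \<partial>\<kappa> x) \<partial>Q)"
proof -
  have Zm[measurable]: "Z \<in> borel_measurable inf_prod"
    using Z by (auto simp: later_swap_invariant_def)
  \<comment> \<open>sets on which the factor \<open>u i\<close> is bounded\<close>
  define E where "E j = {y. u i y \<le> real j}" for j :: nat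
  have E[measurable]: "E j \<in> sets borel" for j unfolding E_def by measurable
  have E_inc: "incseq E" by (auto simp: incseq_def E_def)
  have E_un: "(\<Union>j. E j) = UNIV" by (auto simp: E_def real_arch_simple)
  have 1: "(\<integral>\<^sup>+x. ennreal (u i (x i)) * emeasure (\<kappa> x) (D \<inter> E j) * ennreal (Z x) * g (x i) \<partial>Q) =
      (\<integral>\<^sup>+x. indicator (D \<inter> E j) (x i) * ennreal (u i (x i)) * ennreal (Z x) * (\<integral>\<^sup>+y. g y \<partial>\<kappa> x) \<partial>Q)"
    if [measurable]: "D \<in> sets borel" for D j
  proof (rule coordinate_eq_mixture[OF _ _ E E_inc E_un])
    fix C j' assume [measurable]: "C \<in> sets (borel :: 'a measure)"
    show "(\<integral>\<^sup>+x. ennreal (u i (x i)) * emeasure (\<kappa> x) (D \<inter> E j) * ennreal (Z x) * indicator (C \<inter> E j') (x i) \<partial>Q) =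
      (\<integral>\<^sup>+x. indicator (D \<inter> E j) (x i) * ennreal (u i (x i)) * ennreal (Z x) * emeasure (\<kappa> x) (C \<inter> E j') \<partial>Q)"
      by (rule directing_swap_bounded[OF Z, where b="real (max j j')"]) (auto simp: E_def)
  qed measurable
  have "(\<integral>\<^sup>+x. (g (x i) * ennreal (u i (x i)) * ennreal (Z x)) * (\<integral>\<^sup>+y. f y \<partial>\<kappa> x) \<partial>Q) =
      (\<integral>\<^sup>+x. (ennreal (u i (x i)) * ennreal (Z x) * (\<integral>\<^sup>+y. g y \<partial>\<kappa> x)) * f (x i) \<partial>Q)"
  proof (rule coordinate_eq_mixture[OF _ _ E E_inc E_un, symmetric])
    fix C j assume [measurable]: "C \<in> sets (borel :: 'a measure)"
    show "(\<integral>\<^sup>+x. ennreal (u i (x i)) * ennreal (Z x) * (\<integral>\<^sup>+y. g y \<partial>\<kappa> x) * indicator (C \<inter> E j) (x i) \<partial>Q) =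
      (\<integral>\<^sup>+x. g (x i) * ennreal (u i (x i)) * ennreal (Z x) * emeasure (\<kappa> x) (C \<inter> E j) \<partial>Q)"
      using 1[of C j] by (simp add: mult_ac)
  qed measurable
  then show ?thesis by (simp only: mult_ac)
qed

text \<open>The density of \<open>l i\<close> relative to \<open>w\<close>, and the mass that it gives to a set under a measure \<open>p\<close>.\<close>

definition ratio :: "nat \<Rightarrow> 'a \<Rightarrow> ennreal" where "ratio i y = ennreal (l i y / w y)"

lemma ratio_meas[measurable]: "ratio i \<in> borel_measurable borel"
  unfolding ratio_def[abs_def] by measurable

lemma ratio_u: "ennreal (u i y) * ratio i y = 1"
  using w_pos[of y] l_pos[of i y] by (simp add: ratio_def u_def flip: ennreal_mult')

definition mass :: "nat \<Rightarrow> 'a set \<Rightarrow> 'a measure \<Rightarrow> ennreal" where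
  "mass i B p = (\<integral>\<^sup>+y. indicator B y * ratio i y \<partial>p)"

lemma mass_meas[measurable]:
  assumes [measurable]: "B \<in> sets borel"
  shows "mass i B \<in> borel_measurable (prob_algebra borel)"
  unfolding mass_def[abs_def] prob_algebra_def
  by (intro measurable_restrict_space1 nn_integral_measurable_subprob_algebra) measurable

text \<open>Taking \<open>f = ratio i\<close> and \<open>g = indicator B * ratio i\<close> above cancels the factor \<open>u i\<close>: weighted by the
  test variable \<open>Z\<close>, the \<open>i\<close>-th coordinate lies in \<open>B\<close> with relative frequency
  \<open>mass i B (\<kappa> x) / mass i UNIV (\<kappa> x)\<close>.\<close>

lemma mass_swap:
  assumes Z: "later_swap_invariant i Z" and [measurable]: "B \<in> sets borel"
  shows "(\<integral>\<^sup>+x. indicator B (x i) * mass i UNIV (\<kappa> x) * ennreal (Z x) \<partial>Q) =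
    (\<integral>\<^sup>+x. mass i B (\<kappa> x) * ennreal (Z x) \<partial>Q)"
proof -
  have 1: "indicator B (x i) * mass i UNIV (\<kappa> x) * ennreal (Z x) =
      ennreal (u i (x i)) * (\<integral>\<^sup>+y. ratio i y \<partial>\<kappa> x) * ennreal (Z x) * (indicator B (x i) * ratio i (x i))" for x
  proof -
    have "ennreal (u i (x i)) * (\<integral>\<^sup>+y. ratio i y \<partial>\<kappa> x) * ennreal (Z x) * (indicator B (x i) * ratio i (x i)) =
        (ennreal (u i (x i)) * ratio i (x i)) * (indicator B (x i) * mass i UNIV (\<kappa> x) * ennreal (Z x))"
      by (simp add: mass_def mult_ac)
    then show ?thesis by (simp add: ratio_u)
  qed
  have 2: "mass i B (\<kappa> x) * ennreal (Z x) =
      ratio i (x i) * ennreal (u i (x i)) * ennreal (Z x) * (\<integral>\<^sup>+y. indicator B y * ratio i y \<partial>\<kappa> x)" for x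
  proof -
    have "ratio i (x i) * ennreal (u i (x i)) * ennreal (Z x) * (\<integral>\<^sup>+y. indicator B y * ratio i y \<partial>\<kappa> x) =
        (ennreal (u i (x i)) * ratio i (x i)) * (mass i B (\<kappa> x) * ennreal (Z x))"
      by (simp add: mass_def mult_ac)
    then show ?thesis by (simp add: ratio_u)
  qed
  show ?thesis
    unfolding 1 2 by (rule directing_swap[OF Z]) measurable
qed

lemma mass_pos: "0 < mass i UNIV (\<kappa> x)"
proof (rule ccontr)
  interpret K: prob_space "\<kappa> x" by (rule \<kappa>_prob)
  assume "\<not> 0 < mass i UNIV (\<kappa> x)"
  then have "(\<integral>\<^sup>+y. ratio i y \<partial>\<kappa> x) = 0" by (simp add: mass_def not_gr_zero)
  then have "AE y in \<kappa> x. ratio i y = 0"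
    by (subst (asm) nn_integral_0_iff_AE) (auto simp: measurable_cong_sets[OF sets_\<kappa> refl])
  then have "AE y in \<kappa> x. False"
    by (rule eventually_mono) (metis mult_zero_right ratio_u zero_neq_one)
  then show False by simp
qed

lemma mass_finite: "AE x in Q. mass i UNIV (\<kappa> x) < \<infinity>"
proof -
  have sym: "later_swap_invariant i (\<lambda>_. 1)" by (simp add: later_swap_invariant_def)
  have "AE x in Q. x i \<in> {y. l i y / w y \<le> real n} \<longrightarrow> mass i UNIV (\<kappa> x) < \<infinity>" for n :: nat
  proof -
    define B where "B = {y. l i y / w y \<le> real n}"
    have B[measurable]: "B \<in> sets borel" unfolding B_def by measurable
    have "(\<integral>\<^sup>+x. indicator B (x i) * mass i UNIV (\<kappa> x) \<partial>Q) = (\<integral>\<^sup>+x. mass i B (\<kappa> x) \<partial>Q)"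
      using mass_swap[OF sym B] by simp
    also have "\<dots> \<le> (\<integral>\<^sup>+x. ennreal (real n) \<partial>Q)"
    proof (rule nn_integral_mono)
      fix x
      interpret K: prob_space "\<kappa> x" by (rule \<kappa>_prob)
      have "mass i B (\<kappa> x) \<le> (\<integral>\<^sup>+y. ennreal (real n) \<partial>\<kappa> x)"
        unfolding mass_def by (intro nn_integral_mono) (auto simp: indicator_def B_def ratio_def intro!: ennreal_leI)
      then show "mass i B (\<kappa> x) \<le> ennreal (real n)" by (simp add: K.emeasure_space_1[simplified])
    qed
    also have "\<dots> < \<infinity>" by (simp add: emeasure_space_1[simplified])
    finally have "(\<integral>\<^sup>+x. indicator B (x i) * mass i UNIV (\<kappa> x) \<partial>Q) \<noteq> \<infinity>" by simp
    then have "AE x in Q. indicator B (x i) * mass i UNIV (\<kappa> x) \<noteq> \<infinity>"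
      by (intro nn_integral_noteq_infinite) auto
    then show ?thesis
      by eventually_elim (auto simp: B_def[symmetric] less_top)
  qed
  then have "AE x in Q. \<forall>n::nat. x i \<in> {y. l i y / w y \<le> real n} \<longrightarrow> mass i UNIV (\<kappa> x) < \<infinity>"
    by (subst AE_all_countable) blast
  then show ?thesis
  proof eventually_elim
    case (elim x)
    obtain n :: nat where "l i (x i) / w (x i) \<le> real n" using real_arch_simple by blast
    with elim show ?case by auto
  qed
qed

text \<open>Dividing by the random total mass is legitimate since it is almost surely finite and may be
  absorbed into the function of \<open>\<kappa>\<close>.\<close>

lemma factor_step:
  assumes B: "\<And>j. B j \<in> sets borel" and C[measurable]: "C \<in> sets borel"
    and F[measurable]: "F \<in> borel_measurable (prob_algebra borel)"
  shows "(\<integral>\<^sup>+x. (\<Prod>j<n. indicator (B j) (x j)) * indicator C (x n) * F (\<kappa> x) \<partial>Q) =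
    (\<integral>\<^sup>+x. (\<Prod>j<n. indicator (B j) (x j)) * (mass n C (\<kappa> x) / mass n UNIV (\<kappa> x)) * F (\<kappa> x) \<partial>Q)"
proof -
  have [measurable]: "B j \<in> sets borel" for j by (rule B)
  let ?P = "\<lambda>x. (\<Prod>j<n. indicator (B j) (x j)) :: ennreal"
  \<comment> \<open>two laws of \<open>\<kappa>\<close>, equal because test variables may contain the indicator of any event of \<open>\<kappa>\<close>\<close>
  define M1 where "M1 = distr (density Q (\<lambda>x. ?P x * indicator C (x n) * mass n UNIV (\<kappa> x))) (prob_algebra borel) \<kappa>"
  define M2 where "M2 = distr (density Q (\<lambda>x. ?P x * mass n C (\<kappa> x))) (prob_algebra borel) \<kappa>"
  have n1: "(\<integral>\<^sup>+p. G p \<partial>M1) = (\<integral>\<^sup>+x. ?P x * indicator C (x n) * mass n UNIV (\<kappa> x) * G (\<kappa> x) \<partial>Q)"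
    if [measurable]: "G \<in> borel_measurable (prob_algebra borel)" for G
    unfolding M1_def by (subst nn_integral_distr, simp, simp, subst nn_integral_density) auto
  have n2: "(\<integral>\<^sup>+p. G p \<partial>M2) = (\<integral>\<^sup>+x. ?P x * mass n C (\<kappa> x) * G (\<kappa> x) \<partial>Q)"
    if [measurable]: "G \<in> borel_measurable (prob_algebra borel)" for G
    unfolding M2_def by (subst nn_integral_distr, simp, simp, subst nn_integral_density) auto
  have "M1 = M2"
  proof (rule measure_eqI)
    show "sets M1 = sets M2" by (simp add: M1_def M2_def)
    fix S assume "S \<in> sets M1"
    then have S[measurable]: "S \<in> sets (prob_algebra borel)" by (simp add: M1_def)
    let ?Z = "\<lambda>x. (\<Prod>j<n. indicator (B j) (x j)) * indicator S (\<kappa> x) :: real"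
    have Z: "later_swap_invariant n ?Z"
      unfolding later_swap_invariant_def
    proof (intro conjI allI impI)
      show "?Z \<in> borel_measurable inf_prod" by measurable
      fix x
      show "0 \<le> ?Z x" by (intro mult_nonneg_nonneg prod_nonneg) auto
      show "?Z x \<le> 1" by (intro mult_le_one prod_nonneg prod_le_1) (auto simp: indicator_def)
    next
      fix k assume k: "n < k"
      show "AE x in Q. ?Z (tr n k x) = ?Z x"
        using \<kappa>_tr[of n k]
      proof eventually_elim
        case (elim x)
        have "(\<Prod>j<n. indicator (B j) (tr n k x j)) = (\<Prod>j<n. indicator (B j) (x j) :: real)"
          using k by (intro prod.cong) (auto simp: Transposition.transpose_def)
        with elim show ?case by simp
      qed
    qed
    have eZ: "ennreal (?Z x) = ?P x * indicator S (\<kappa> x)" for x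
      by (simp add: ennreal_mult' prod_nonneg ennreal_indicator flip: prod_ennreal)
    have "emeasure M1 S = (\<integral>\<^sup>+p. indicator S p \<partial>M1)"
      by (subst nn_integral_indicator) (auto simp: M1_def)
    also have "\<dots> = (\<integral>\<^sup>+x. indicator C (x n) * mass n UNIV (\<kappa> x) * ennreal (?Z x) \<partial>Q)"
      unfolding eZ by (subst n1) (auto simp: mult_ac)
    also have "\<dots> = (\<integral>\<^sup>+x. mass n C (\<kappa> x) * ennreal (?Z x) \<partial>Q)"
      by (rule mass_swap[OF Z C])
    also have "\<dots> = (\<integral>\<^sup>+p. indicator S p \<partial>M2)"
      unfolding eZ by (subst n2) (auto simp: mult_ac)
    also have "\<dots> = emeasure M2 S"
      by (subst nn_integral_indicator) (auto simp: M2_def)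
    finally show "emeasure M1 S = emeasure M2 S" .
  qed
  then have "(\<integral>\<^sup>+x. ?P x * indicator C (x n) * mass n UNIV (\<kappa> x) * (F (\<kappa> x) / mass n UNIV (\<kappa> x)) \<partial>Q) =
      (\<integral>\<^sup>+x. ?P x * mass n C (\<kappa> x) * (F (\<kappa> x) / mass n UNIV (\<kappa> x)) \<partial>Q)"
    using n1[of "\<lambda>p. F p / mass n UNIV p"] n2[of "\<lambda>p. F p / mass n UNIV p"] by simp
  moreover have "(\<integral>\<^sup>+x. ?P x * indicator C (x n) * mass n UNIV (\<kappa> x) * (F (\<kappa> x) / mass n UNIV (\<kappa> x)) \<partial>Q) =
      (\<integral>\<^sup>+x. ?P x * indicator C (x n) * F (\<kappa> x) \<partial>Q)"
  proof (rule nn_integral_cong_AE)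
    show "AE x in Q. ?P x * indicator C (x n) * mass n UNIV (\<kappa> x) * (F (\<kappa> x) / mass n UNIV (\<kappa> x)) =
       ?P x * indicator C (x n) * F (\<kappa> x)"
      using mass_finite[of n]
    proof eventually_elim
      case (elim x)
      have "mass n UNIV (\<kappa> x) * (F (\<kappa> x) / mass n UNIV (\<kappa> x)) = F (\<kappa> x)"
        using elim mass_pos[of n x]
        by (metis ennreal_divide_self ennreal_times_divide infinity_ennreal_def less_irrefl mult.commute mult.right_neutral top.not_eq_extremum)
      then show ?case by (simp only: mult.assoc)
    qed
  qed
  moreover have "?P x * mass n C (\<kappa> x) * (F (\<kappa> x) / mass n UNIV (\<kappa> x)) =
      ?P x * (mass n C (\<kappa> x) / mass n UNIV (\<kappa> x)) * F (\<kappa> x)" for x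
    by (simp add: divide_ennreal_def mult_ac)
  ultimately show ?thesis by simp
qed

text \<open>Given \<open>\<kappa>\<close>, the coordinates are independent, the \<open>j\<close>-th one with law proportional to
  \<open>ratio j \<cdot> \<kappa>\<close>.\<close>

lemma factorization:
  assumes B: "\<And>j. B j \<in> sets borel" and F: "F \<in> borel_measurable (prob_algebra borel)"
  shows "(\<integral>\<^sup>+x. (\<Prod>j<n. indicator (B j) (x j)) * F (\<kappa> x) \<partial>Q) =
    (\<integral>\<^sup>+x. (\<Prod>j<n. mass j (B j) (\<kappa> x) / mass j UNIV (\<kappa> x)) * F (\<kappa> x) \<partial>Q)"
  using F
proof (induction n arbitrary: F)
  case (Suc n)
  note [measurable] = Suc.prems B
  let ?F = "\<lambda>p. mass n (B n) p / mass n UNIV p * F p"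
  have "(\<integral>\<^sup>+x. (\<Prod>j<Suc n. indicator (B j) (x j)) * F (\<kappa> x) \<partial>Q) =
      (\<integral>\<^sup>+x. (\<Prod>j<n. indicator (B j) (x j)) * indicator (B n) (x n) * F (\<kappa> x) \<partial>Q)"
    by (simp add: mult_ac)
  also have "\<dots> = (\<integral>\<^sup>+x. (\<Prod>j<n. indicator (B j) (x j)) * ?F (\<kappa> x) \<partial>Q)"
    by (subst factor_step[OF B B Suc.prems]) (simp add: mult_ac)
  also have "\<dots> = (\<integral>\<^sup>+x. (\<Prod>j<n. mass j (B j) (\<kappa> x) / mass j UNIV (\<kappa> x)) * ?F (\<kappa> x) \<partial>Q)"
    by (rule Suc.IH) measurable
  also have "\<dots> = (\<integral>\<^sup>+x. (\<Prod>j<Suc n. mass j (B j) (\<kappa> x) / mass j UNIV (\<kappa> x)) * F (\<kappa> x) \<partial>Q)"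
    by (simp add: mult_ac)
  finally show ?case .
qed simp

end

section \<open>The mixing distribution\<close>

context divergent_process begin

text \<open>The random measure \<open>P\<close> of the mixture: dividing by \<open>w\<close> turns the masses of \<open>ratio i\<close> under \<open>\<kappa>\<close> into
  integrals of \<open>l i\<close>. On the null set where this fails to be admissible, a point mass is used, under
  which all weights have positive finite integrals.\<close>

definition directing :: "(nat \<Rightarrow> 'a) \<Rightarrow> 'a measure" where
  "directing x = (if \<forall>i. mass i UNIV (\<kappa> x) < \<infinity> then density (\<kappa> x) (\<lambda>y. ennreal (1 / w y))
    else return borel undefined)"

lemma directing_good: "AE x in Q. \<forall>i. mass i UNIV (\<kappa> x) < \<infinity>"
  using mass_finite by (simp add: AE_all_countable)

lemma nn_integral_directing:
  assumes "\<forall>i. mass i UNIV (\<kappa> x) < \<infinity>" and [measurable]: "B \<in> sets borel"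
  shows "(\<integral>\<^sup>+y\<in>B. ennreal (l i y) \<partial>directing x) = mass i B (\<kappa> x)"
proof -
  have "(\<integral>\<^sup>+y\<in>B. ennreal (l i y) \<partial>directing x) =
      (\<integral>\<^sup>+y. ennreal (1 / w y) * (ennreal (l i y) * indicator B y) \<partial>\<kappa> x)"
    using assms(1) unfolding directing_def by (simp, intro nn_integral_density) measurable
  also have "\<dots> = (\<integral>\<^sup>+y. indicator B y * ratio i y \<partial>\<kappa> x)"
  proof (intro nn_integral_cong)
    fix y
    have "ennreal (1 / w y) * ennreal (l i y) = ratio i y"
      using w_pos[of y] by (simp add: ratio_def flip: ennreal_mult')
    then show "ennreal (1 / w y) * (ennreal (l i y) * indicator B y) = indicator B y * ratio i y"
      by (simp only: mult_ac flip: \<open>_ = ratio i y\<close>)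
  qed
  finally show ?thesis by (simp add: mass_def)
qed

lemma sets_directing[simp]: "sets (directing x) = sets borel"
  by (simp add: directing_def)

lemma directing_in_measures_for: "directing x \<in> measures_for l"
proof (cases "\<forall>i. mass i UNIV (\<kappa> x) < \<infinity>")
  case True
  then show ?thesis
    using nn_integral_directing[OF True, of UNIV] mass_pos by (simp add: measures_for_def)
next
  case False
  then have "directing x = return borel undefined" by (auto simp: directing_def)
  then show ?thesis using l_pos by (simp add: measures_for_def nn_integral_return)
qed

lemma directing_meas[measurable]: "directing \<in> inf_prod \<rightarrow>\<^sub>M restrict_space all_measures (measures_for l)"
proof (rule measurable_restrict_space2)
  show "directing \<in> space inf_prod \<rightarrow> measures_for l" by (simp add: directing_in_measures_for)
  have e: "(\<lambda>x. emeasure (directing x) A) \<in> borel_measurable inf_prod" if [measurable]: "A \<in> sets borel" for A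
  proof -
    have "emeasure (directing x) A = (if \<forall>i. mass i UNIV (\<kappa> x) < \<infinity> then (\<integral>\<^sup>+y. ennreal (1 / w y) * indicator A y \<partial>\<kappa> x)
        else indicator A undefined)" for x
      by (auto simp: directing_def emeasure_density)
    then show ?thesis by simp
  qed
  show "directing \<in> inf_prod \<rightarrow>\<^sub>M all_measures"
    unfolding all_measures_def
  proof (rule measurable_measure_of)
    fix S assume "S \<in> {{P. sets P = sets borel \<and> emeasure P A \<le> ennreal t} | A t. A \<in> sets (borel :: 'a measure) \<and> 0 \<le> t}"
    then obtain A t where S: "S = {P. sets P = sets borel \<and> emeasure P A \<le> ennreal t}" and A: "A \<in> sets borel" by auto
    have "directing -` S \<inter> space inf_prod = {x \<in> space inf_prod. emeasure (directing x) A \<le> ennreal t}"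
      by (auto simp: S)
    also have "\<dots> \<in> sets inf_prod" using e[OF A] by measurable
    finally show "directing -` S \<inter> space inf_prod \<in> sets inf_prod" .
  qed auto
qed

lemma ex_mixing_distribution: "\<exists>\<mu>. distribution_on_measures_for l \<mu> \<and> Q = tilted_mixture l \<mu>"
proof -
  define \<mu> where "\<mu> = distr Q (restrict_space all_measures (measures_for l)) directing"
  have \<mu>: "distribution_on_measures_for l \<mu>"
    unfolding distribution_on_measures_for_def \<mu>_def by (auto intro!: prob_space_distr)
  have "Q = tilted_mixture l \<mu>"
  proof (rule tilted_mixture_eqI[OF l_weight \<mu> prob_space_axioms sets_Q])
    fix J and A :: "nat \<Rightarrow> 'a set" assume J: "finite J" "\<And>j. j \<in> J \<Longrightarrow> A j \<in> sets borel"
    let ?E = "prod_emb UNIV (\<lambda>_. borel) J (PiE J A)"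
    have E_sets: "?E \<in> sets Q" unfolding sets_Q using J by (intro sets_PiM_I) auto
    define B where "B j = (if j \<in> J then A j else UNIV)" for j
    have B: "B j \<in> sets borel" for j using J(2) by (simp add: B_def)
    define n where "n = Suc (Max (insert 0 J))"
    have n: "J \<subseteq> {..<n}"
      using J(1) unfolding n_def by (auto simp: less_Suc_eq_le simp del: Max_insert intro!: Max_ge)
    have ind: "indicator ?E x = (\<Prod>j<n. indicator (B j) (x j) :: ennreal)" for x
    proof (cases "x \<in> ?E")
      case True
      then have "(\<Prod>j<n. indicator (B j) (x j) :: ennreal) = 1"
        by (intro prod.neutral) (auto simp: B_def prod_emb_iff PiE_iff)
      with True show ?thesis by simp
    next
      case False
      then obtain j where "j \<in> J" "x j \<notin> A j" by (auto simp: prod_emb_iff PiE_iff)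
      then have "(\<Prod>j<n. indicator (B j) (x j) :: ennreal) = 0"
        using n by (intro prod_zero) (auto simp: B_def intro!: bexI[of _ j])
      with False show ?thesis by simp
    qed
    have "emeasure Q ?E = (\<integral>\<^sup>+x. (\<Prod>j<n. indicator (B j) (x j)) * 1 \<partial>Q)"
      using E_sets by (simp flip: ind)
    also have "\<dots> = (\<integral>\<^sup>+x. (\<Prod>j<n. mass j (B j) (\<kappa> x) / mass j UNIV (\<kappa> x)) * 1 \<partial>Q)"
      by (rule factorization[OF B, of "\<lambda>_. 1"]) simp
    also have "\<dots> = (\<integral>\<^sup>+x. (\<Prod>j\<in>J. (\<integral>\<^sup>+y\<in>A j. ennreal (l j y) \<partial>directing x) / (\<integral>\<^sup>+y. ennreal (l j y) \<partial>directing x)) \<partial>Q)"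
    proof (rule nn_integral_cong_AE)
      show "AE x in Q. (\<Prod>j<n. mass j (B j) (\<kappa> x) / mass j UNIV (\<kappa> x)) * 1 =
        (\<Prod>j\<in>J. (\<integral>\<^sup>+y\<in>A j. ennreal (l j y) \<partial>directing x) / (\<integral>\<^sup>+y. ennreal (l j y) \<partial>directing x))"
        using directing_good
      proof eventually_elim
        case (elim x)
        have "(\<Prod>j<n. mass j (B j) (\<kappa> x) / mass j UNIV (\<kappa> x)) = (\<Prod>j\<in>J. mass j (B j) (\<kappa> x) / mass j UNIV (\<kappa> x))"
        proof (rule prod.mono_neutral_right)
          show "\<forall>j\<in>{..<n} - J. mass j (B j) (\<kappa> x) / mass j UNIV (\<kappa> x) = 1"
          proof
            fix j assume "j \<in> {..<n} - J"
            moreover have "mass j UNIV (\<kappa> x) \<noteq> 0" using mass_pos[of j x] by (metis less_irrefl)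
            ultimately show "mass j (B j) (\<kappa> x) / mass j UNIV (\<kappa> x) = 1"
              using elim by (simp add: B_def ennreal_divide_self)
          qed
        qed (use n in auto)
        also have "\<dots> = (\<Prod>j\<in>J. (\<integral>\<^sup>+y\<in>A j. ennreal (l j y) \<partial>directing x) / (\<integral>\<^sup>+y. ennreal (l j y) \<partial>directing x))"
          using nn_integral_directing[OF elim] nn_integral_directing[OF elim, of UNIV] J(2)
          by (intro prod.cong refl) (simp add: B_def)
        finally show ?case by simp
      qed
    qed
    also have "\<dots> = (\<integral>\<^sup>+P. (\<Prod>j\<in>J. (\<integral>\<^sup>+y\<in>A j. ennreal (l j y) \<partial>P) / (\<integral>\<^sup>+y. ennreal (l j y) \<partial>P)) \<partial>\<mu>)"
      unfolding \<mu>_def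
    proof (rule nn_integral_distr[symmetric])
      show "directing \<in> Q \<rightarrow>\<^sub>M restrict_space all_measures (measures_for l)" by measurable
    qed (simp add: tilt_factors_measurable[OF l_weight J(2)])
    finally show "emeasure Q ?E = (\<integral>\<^sup>+P. (\<Prod>j\<in>J. (\<integral>\<^sup>+y\<in>A j. ennreal (l j y) \<partial>P) / (\<integral>\<^sup>+y. ennreal (l j y) \<partial>P)) \<partial>\<mu>)" .
  qed
  with \<mu> show ?thesis by blast
qed

end

theorem theorem6:
  fixes l :: "nat \<Rightarrow> 'a::polish_space \<Rightarrow> real"
  assumes "\<forall>i. l i \<in> weight_functions"
    and "\<exists>w \<in> weight_functions.
           (\<Sum>i. (INF x. ennreal (l i x / w x)) / (SUP x. ennreal (l i x / w x))) = (\<infinity>::ennreal)"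
  shows "l \<in> Lambda_dF"
proof -
  obtain w where w: "w \<in> weight_functions"
    and div: "(\<Sum>i. (INF x. ennreal (l i x / w x)) / (SUP x. ennreal (l i x / w x))) = (\<infinity>::ennreal)"
    using assms(2) by auto
  have w_pos: "0 < w x" for x using w by (simp add: weight_functions_def)
  have l_pos: "0 < l i x" for i x using assms(1) by (simp add: weight_functions_def)
  define I where "I i = (INF x. ennreal (l i x / w x))" for i
  define S where "S i = (SUP x. ennreal (l i x / w x))" for i
  define a where "a i = enn2real (I i)" for i
  define r where "r i = enn2real (I i / S i)" for i
  have I_le: "I i \<le> ennreal (l i x / w x)" for i x unfolding I_def by (rule INF_lower) simp
  have S_ge: "ennreal (l i x / w x) \<le> S i" for i x unfolding S_def by (rule SUP_upper) simp
  have I_fin: "I i < top" for i using I_le[of i undefined] by (rule le_less_trans) simp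
  have I_a: "I i = ennreal (a i)" for i using I_fin[of i] by (simp add: a_def)
  have a0: "0 \<le> a i" for i by (simp add: a_def)
  have S_pos: "0 < S i" for i
    using S_ge[of i undefined] l_pos[of i undefined] w_pos[of undefined]
    by (metis ennreal_less_zero_iff divide_pos_pos less_le_trans)
  have fin: "I i / S i < top" for i
    using I_fin[of i] S_pos[of i] by (auto simp: ennreal_divide_eq_top_iff less_top[symmetric])
  have a_le: "a i \<le> l i x / w x" for i x
    using I_le[of i x] l_pos[of i x] w_pos[of x] by (simp add: I_a)
  have r_le: "r i \<le> a i * w x / l i x" for i x
  proof (cases "S i" rule: ennreal_cases)
    case (real s)
    have q: "0 < l i x / w x" using l_pos[of i x] w_pos[of x] by simp
    have s: "l i x / w x \<le> s" using S_ge[of i x] real by simp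
    have "r i = a i / s" using real s q a0[of i] by (simp add: r_def I_a divide_ennreal)
    also have "\<dots> \<le> a i / (l i x / w x)" using s q a0 by (intro divide_left_mono mult_pos_pos) auto
    finally show ?thesis by simp
  next
    case top
    \<comment> \<open>the quotient by an infinite supremum is zero\<close>
    then show ?thesis
      using l_pos[of i x] w_pos[of x] a0[of i] by (simp add: r_def I_a)
  qed
  have r0: "0 \<le> r i" for i by (simp add: r_def)
  have "(\<Sum>i. ennreal (r i)) = \<infinity>"
    using div fin by (simp add: r_def I_def S_def)
  then have not_summable: "\<not> summable r"
    using suminf_ennreal2[OF r0] by auto
  have diverges: "filterlim (\<lambda>m. \<Sum>k<m. r k) at_top sequentially"
    unfolding filterlim_at_top
  proof
    fix Z :: real
    have "\<not> (\<forall>m. (\<Sum>k<m. r k) \<le> Z)"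
      using not_summable summableI_nonneg_bounded[of r Z] r0 by blast
    then obtain m where m: "Z < (\<Sum>k<m. r k)" by (auto simp: not_le)
    show "\<forall>\<^sub>F m in sequentially. Z \<le> (\<Sum>k<m. r k)"
    proof (rule eventually_sequentiallyI[of m])
      fix n assume "m \<le> n"
      then have "(\<Sum>k<m. r k) \<le> (\<Sum>k<n. r k)" using r0 by (intro sum_mono2) auto
      with m show "Z \<le> (\<Sum>k<n. r k)" by linarith
    qed
  qed
  have "\<exists>\<mu>. distribution_on_measures_for l \<mu> \<and> Q = tilted_mixture l \<mu>"
    if Q: "prob_space Q" "weighted_exchangeable l Q" for Q
  proof -
    interpret prob_space Q by (rule Q(1))
    interpret divergent_process Q l w a r "\<lambda>i y. a i * w y / l i y"
    proof
      show "a i * w y / l i y \<le> 1" for i y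
        using a_le[of i y] l_pos[of i y] w_pos[of y] by (simp add: field_simps)
    qed (use assms(1) Q w a0 r0 r_le diverges in auto)
    show ?thesis by (rule ex_mixing_distribution)
  qed
  then show ?thesis using assms(1) by (auto simp: Lambda_dF_def)
qed

end
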